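(* Let $\Delta$ be a complete simplicial multi-fan of dimension $n$ such that the Todd genus $T_0(\Delta)$ equals $1$ and $w(I)=1$ for all $I\in\Sigma^{(n)}$; let the edge vectors $v_i$ be primitive. If $c_1(\Delta)$ is $T$-Cartier divisible by $n$, then one of the following two possibilities occurs. (a) $\Delta$ is non-singular and $$T_y(\Delta)=(1-y)\sum_{k=0}^{n-1}(-y)^k.$$ (b) $n\ge2$ and there is a unique non-empty $K\in\Sigma$ such that $\hat H_K\neq\emptyset$. In this case $$T_y(\Delta)=\sum_{k=0}^{n}(-y)^k,\qquad T_y(\Delta_K)=\sum_{k=0}^{n-2}(-y)^k,$$ and $$\hat T_y(\Delta)=T_y(\Delta)+(-y)T_y(\Delta_K)=(1-y)\sum_{k=0}^{n-1}(-y)^k.$$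
   Context: Multi-fans. Let $L$ be a lattice of rank $n$, $L_{\mathbb R}=L\otimes\mathbb R$, $L^*=\mathrm{Hom}(L,\mathbb Z)$, and $\langle\cdot,\cdot\rangle$ the dual pairing. An $n$-dimensional simplicial multi-fan in $L$ is a triple $\Delta=(\Sigma,C,w^\pm)$, where: $\Sigma$ is a finite abstract simplicial complex with the empty simplex included; $\Sigma^{(k)}$ is the set of simplices with exactly $k$ elements (so $\Sigma^{(0)}=\{\emptyset\}$, and a vertex $i$ is identified with $\{i\}\in\Sigma^{(1)}$); $\Sigma=\bigsqcup_{k=0}^n\Sigma^{(k)}$, $\Sigma^{(n)}\neq\emptyset$, and every simplex is contained in an element of $\Sigma^{(n)}$; $C$ assigns to each $I\in\Sigma^{(k)}$ a $k$-dimensional strongly convex rational polyhedral cone $C(I)\subset L_{\mathbb R}$ such that $C(J)$ is a face of $C(I)$ whenever $J$ is a face of $I$ (so $C(I)$ is spanned by the rays $C(i)$, $i\in I$); and $w^\pm:\Sigma^{(n)}\to\mathbb Z_{\ge0}$ are functions, with $w=w^+-w^-$. A vector $v\in L_{\mathbb R}$ is generic if it lies on no linear subspace spanned by a cone $C(J)$ of dimension less than $n$. $\Delta$ is pre-complete if $d_v=\sum_{I\in\Sigma^{(n)},\,v\in C(I)}w(I)$ is independent of the generic vector $v$; this integer is $\deg(\Delta)$. For $K\in\Sigma$, let $\Sigma_K=\{J\in\Sigma: K\subset J\}$ (a simplicial complex with minimum element $K$), let $L^K$ be the image of $L$ in $L_{\mathbb R}/\mathrm{span}\,C(K)$, let $C_K(J)$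 be the projection of $C(J)$, and let $w_K^\pm$ be the restriction of $w^\pm$ to $\Sigma_K^{(n-|K|)}=\{I\in\Sigma^{(n)}:K\subset I\}$; then $\Delta_K=(\Sigma_K,C_K,w_K^\pm)$ is the projected multi-fan in $L^K$, of dimension $n-|K|$. $\Delta$ is complete if $\Delta_K$ is pre-complete for all $K\in\Sigma$. Edge vectors. For $i\in\Sigma^{(1)}$, $v_i\in L$ is the primitive vector generating the ray $C(i)$; $\mathcal V=\{v_i\}$. $\Delta$ is non-singular if $\{v_i\}_{i\in I}$ is a basis of $L$ for every $I\in\Sigma^{(n)}$. For $I\in\Sigma^{(n)}$, $\{u_i^I\}_{i\in I}\subset L_{\mathbb R}^*$ is the basis dual to $\{v_i\}_{i\in I}$, and $H_I=L/L_{I,\mathcal V}$ with $L_{I,\mathcal V}$ the lattice generated by $\{v_i\}_{i\in I}$. Chern class. $H_T^2(\Delta)$ is the free abelian group on symbols $x_i$, $i\in\Sigma^{(1)}$, and $L^*$ is embedded in it by $u\mapsto\sum_i\langle u,v_i\rangle x_i$. For $I\in\Sigma^{(n)}$, $\iota_I^*:H_T^2(\Delta)\to L_{\mathbb R}^*$ is given by $\iota_I^*(x_i)=u_i^I$ if $i\in I$ and $0$ otherwise. An element $x\in H_T^2(\Delta)$ is $T$-Cartier if $\iota_I^*(x)\in L^*$ for every $I\in\Sigma^{(n)}$. $c_1^T(\Delta)=\sum_ix_i$, $c_1(\Delta)$ is its image in $H_T^2(\Delta)/L^*$, and $c_1(\Delta)$ is $T$-Cartier divisible by $N$ if $c_1^T(\Delta)=Nx+u$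 with $x\in H_T^2(\Delta)$ $T$-Cartier and $u\in L^*$. $T_y$-genera. $T_y(\Delta)=\sum_{I\in\Sigma^{(n)}}\frac{w(I)}{|H_I|}\sum_{h\in H_I}\prod_{i\in I}\frac{1+y\chi_I(u_i^I,h)^{-1}t^{-u_i^I}}{1-\chi_I(u_i^I,h)^{-1}t^{-u_i^I}}$, where $\chi_I(u,h)=e^{2\pi\sqrt{-1}\langle u,v(h)\rangle}$, $v(h)\in L$ a representative of $h$, and $t^u$ are formal exponentials. It is known that $T_y(\Delta)=\sum_{k=0}^nh_k(\Delta)(-y)^k$, where $h_k(\Delta)=\sum_{I\in\Sigma^{(n)},\,\mu(I)=k}w(I)$, $\mu(I)=\#\{i\in I:\langle u_i^I,v\rangle>0\}$ for any generic $v$ (independent of $v$ and of the choice of generating vectors); the same definition applies to $\Delta_K$. $T_0(\Delta)=h_0(\Delta)$ is the Todd genus. For $K\in\Sigma$ let $L_K=L\cap\mathrm{span}\,C(K)$, $L_{K,\mathcal V}$ the sublattice generated by $\{v_i\}_{i\in K}$, $H_K=L_K/L_{K,\mathcal V}$, and $\{u_i^K\}_{i\in K}$ the basis of $(\mathrm{span}\,C(K))^*$ dual to $\{v_i\}_{i\in K}$. Put $\hat H_K=H_K\setminus\bigcup_{J\subsetneq K}H_J=\{h\in H_K:\langle u_i^K,v(h)\rangle\notin\mathbb Z\text{ for all }i\in K\}$ ($v(h)\in L_K$ a representative), with $\hat H_\emptyset=H_\emptyset=0$. For $h\in H_K$ let $f_{K,h}=\sum_{i\in K}\langle u_i^K,v(h)\rangle$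 where $v(h)\in L_K$ is the unique representative with $0\le\langle u_i^K,v(h)\rangle<1$ for all $i\in K$. The orbifold $T_y$-genus is $\hat T_y(\Delta)=\sum_{k=0}^n\sum_{K\in\Sigma^{(k)}}\sum_{h\in\hat H_K}(-y)^{f_{K,h}}T_y(\Delta_K)$. *)

theory Defs
  imports
    "HOL-Analysis.Analysis"
    "HOL-Library.Poly_Mapping"
    "HOL-Computational_Algebra.Fraction_Field"
begin

section \<open>Formal exponentials\<close>

text \<open>
  A copy of a Euclidean space, carrying a lexicographic order that is compatible with addition.
  The order only serves to make the group algebra of formal exponentials an integral domain,
  so that its field of fractions is available; nothing below depends on the choice of it.
\<close>

typedef (overloaded) ('a::euclidean_space) exponent = "UNIV :: 'a set"
  morphisms vec_of_exponent Exponent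
  by simp

definition exponent_coords :: "'a::euclidean_space exponent \<Rightarrow> (nat \<Rightarrow>\<^sub>0 real)" where
  "exponent_coords x =
     (\<Sum>k<DIM('a). Poly_Mapping.single k (vec_of_exponent x \<bullet> from_nat_into Basis k))"

instantiation exponent :: (euclidean_space) ab_group_add
begin

definition "0 = Exponent 0"
definition "x + y = Exponent (vec_of_exponent x + vec_of_exponent y)"
definition "x - y = Exponent (vec_of_exponent x - vec_of_exponent y)"
definition "- x = Exponent (- vec_of_exponent x)"

instance
  by standard
    (simp_all add: zero_exponent_def plus_exponent_def minus_exponent_def uminus_exponent_def
      Exponent_inverse vec_of_exponent_inverse algebra_simps)

end

lemma exponent_coords_add: "exponent_coords (x + y) = exponent_coords x + exponent_coords y"
  by (simp add: exponent_coords_def plus_exponent_def Exponent_inverse inner_add_left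
      Poly_Mapping.single_add sum.distrib)

lemma lookup_exponent_coords:
  fixes x :: "'a::euclidean_space exponent"
  assumes "k < DIM('a)"
  shows "Poly_Mapping.lookup (exponent_coords x) k = vec_of_exponent x \<bullet> from_nat_into Basis k"
  using assms
  by (simp add: exponent_coords_def lookup_sum lookup_single when_def sum.delta if_distrib)

lemma exponent_coords_inject:
  fixes x y :: "'a::euclidean_space exponent"
  assumes "exponent_coords x = exponent_coords y"
  shows "x = y"
proof -
  have "vec_of_exponent x \<bullet> b = vec_of_exponent y \<bullet> b" if "b \<in> Basis" for b
  proof -
    have "bij_betw (from_nat_into (Basis :: 'a set)) {..<DIM('a)} Basis"
      by (rule bij_betw_from_nat_into_finite) simp
    then have "b \<in> from_nat_into Basis ` {..<DIM('a)}"
      using that by (simp only: bij_betw_def)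
    then obtain k where "k < DIM('a)" "b = from_nat_into Basis k"
      by blast
    then show ?thesis
      using lookup_exponent_coords[of k x] lookup_exponent_coords[of k y] assms by simp
  qed
  then have "vec_of_exponent x = vec_of_exponent y"
    by (rule euclidean_eqI)
  then show ?thesis
    by (simp add: vec_of_exponent_inject)
qed

instantiation exponent :: (euclidean_space) linordered_ab_group_add
begin

definition "x \<le> y \<longleftrightarrow> exponent_coords x \<le> exponent_coords y"
definition "x < y \<longleftrightarrow> exponent_coords x < exponent_coords y"

instance
  by standard
    (auto simp: less_eq_exponent_def less_exponent_def exponent_coords_add
      intro: exponent_coords_inject)

end

text \<open>
  Coefficients are complex combinations of formal real powers of the indeterminate \<open>-y\<close>
  (the orbifold genus involves fractional powers).
\<close>

type_synonym 'a exp_field = "('a exponent \<Rightarrow>\<^sub>0 (real \<Rightarrow>\<^sub>0 complex)) fract"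

definition const :: "complex \<Rightarrow> 'a::euclidean_space exp_field" where
  "const c = Fract (Poly_Mapping.single 0 (Poly_Mapping.single 0 c)) 1"

text \<open>\<open>neg_y_pow r\<close> is \<open>(-y)^r\<close>.\<close>

definition neg_y_pow :: "real \<Rightarrow> 'a::euclidean_space exp_field" where
  "neg_y_pow r = Fract (Poly_Mapping.single 0 (Poly_Mapping.single r 1)) 1"

definition var_y :: "'a::euclidean_space exp_field" where
  "var_y = - neg_y_pow 1"

text \<open>\<open>t_exp u\<close> is the formal exponential \<open>t^u\<close>.\<close>

definition t_exp :: "'a::euclidean_space \<Rightarrow> 'a exp_field" where
  "t_exp u = Fract (Poly_Mapping.single (Exponent u) 1) 1"


section \<open>Lattices\<close>

text \<open>
  A lattice \<open>L\<close> is realised inside a Euclidean space, possibly not with full rank, and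
  \<open>L \<otimes> \<real>\<close> is \<open>span L\<close>.  Linear forms on a subspace \<open>W\<close> (in particular on \<open>span L\<close>) are
  represented by vectors of \<open>W\<close> via the inner product.
\<close>

definition int_span :: "'a::euclidean_space set \<Rightarrow> 'a set" where
  "int_span S = {\<Sum>s\<in>S. of_int (c s) *\<^sub>R s | c :: 'a \<Rightarrow> int. True}"

definition lattice_basis :: "'a::euclidean_space set \<Rightarrow> 'a set \<Rightarrow> bool" where
  "lattice_basis L B \<longleftrightarrow> independent B \<and> int_span B = L"

definition is_lattice :: "'a::euclidean_space set \<Rightarrow> bool" where
  "is_lattice L \<longleftrightarrow> (\<exists>B. lattice_basis L B)"

definition dual_lattice :: "'a::euclidean_space set \<Rightarrow> 'a set" where
  "dual_lattice L = {u \<in> span L. \<forall>l\<in>L. u \<bullet> l \<in> \<int>}"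

definition primitive :: "'a::euclidean_space set \<Rightarrow> 'a \<Rightarrow> bool" where
  "primitive L v \<longleftrightarrow> v \<in> L \<and> v \<noteq> 0 \<and> (\<forall>c::real. c *\<^sub>R v \<in> L \<longrightarrow> c \<in> \<int>)"

definition rational_polyhedral_cone :: "'a::euclidean_space set \<Rightarrow> 'a set \<Rightarrow> bool" where
  "rational_polyhedral_cone L C \<longleftrightarrow> (\<exists>S. finite S \<and> S \<subseteq> L \<and> C = convex_cone hull S)"

definition strongly_convex :: "'a::euclidean_space set \<Rightarrow> bool" where
  "strongly_convex C \<longleftrightarrow> C \<inter> uminus ` C = {0}"


section \<open>Multi-fans\<close>

record ('i, 'a) multi_fan =
  lat :: "'a set"
  splx :: "'i set set"
  cone_of :: "'i set \<Rightarrow> 'a set"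
  w_plus :: "'i set \<Rightarrow> nat"
  w_minus :: "'i set \<Rightarrow> nat"

definition splx_of :: "('i, 'a::euclidean_space) multi_fan \<Rightarrow> nat \<Rightarrow> 'i set set" where
  "splx_of \<Delta> k = {I \<in> splx \<Delta>. card I = k}"

definition mf_dim :: "('i, 'a::euclidean_space) multi_fan \<Rightarrow> nat" where
  "mf_dim \<Delta> = dim (lat \<Delta>)"

abbreviation top_splx :: "('i, 'a::euclidean_space) multi_fan \<Rightarrow> 'i set set" where
  "top_splx \<Delta> \<equiv> splx_of \<Delta> (mf_dim \<Delta>)"

definition weight :: "('i, 'a::euclidean_space) multi_fan \<Rightarrow> 'i set \<Rightarrow> int" where
  "weight \<Delta> I = int (w_plus \<Delta> I) - int (w_minus \<Delta> I)"

definition simplicial_multi_fan :: "nat \<Rightarrow> ('i, 'a::euclidean_space) multi_fan \<Rightarrow> bool" where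
  "simplicial_multi_fan n \<Delta> \<longleftrightarrow>
     is_lattice (lat \<Delta>) \<and> dim (lat \<Delta>) = n \<and>
     finite (splx \<Delta>) \<and> (\<forall>I\<in>splx \<Delta>. finite I \<and> card I \<le> n) \<and>
     {} \<in> splx \<Delta> \<and> (\<forall>I\<in>splx \<Delta>. \<forall>J. J \<subseteq> I \<longrightarrow> J \<in> splx \<Delta>) \<and>
     splx_of \<Delta> n \<noteq> {} \<and> (\<forall>J\<in>splx \<Delta>. \<exists>I\<in>splx_of \<Delta> n. J \<subseteq> I) \<and>
     (\<forall>I\<in>splx \<Delta>.
        rational_polyhedral_cone (lat \<Delta>) (cone_of \<Delta> I) \<and>
        strongly_convex (cone_of \<Delta> I) \<and>
        dim (cone_of \<Delta> I) = card I \<and>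
        (\<forall>J. J \<subseteq> I \<longrightarrow> cone_of \<Delta> J face_of cone_of \<Delta> I) \<and>
        cone_of \<Delta> I = convex_cone hull (\<Union>i\<in>I. cone_of \<Delta> {i}))"

definition generic :: "('i, 'a::euclidean_space) multi_fan \<Rightarrow> 'a \<Rightarrow> bool" where
  "generic \<Delta> v \<longleftrightarrow> v \<in> span (lat \<Delta>) \<and>
     (\<forall>J\<in>splx \<Delta>. dim (cone_of \<Delta> J) < mf_dim \<Delta> \<longrightarrow> v \<notin> span (cone_of \<Delta> J))"

definition pre_complete :: "('i, 'a::euclidean_space) multi_fan \<Rightarrow> bool" where
  "pre_complete \<Delta> \<longleftrightarrow>
     (\<exists>d. \<forall>v. generic \<Delta> v \<longrightarrow> (\<Sum>I | I \<in> top_splx \<Delta> \<and> v \<in> cone_of \<Delta> I. weight \<Delta> I) = d)"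

text \<open>
  The quotient of \<open>span L\<close> by a subspace \<open>W\<close> is realised as the orthogonal complement of \<open>W\<close>;
  the quotient map is then \<open>quot_map W\<close>, the orthogonal projection with kernel \<open>W\<close>.
\<close>

definition quot_map :: "'a::euclidean_space set \<Rightarrow> 'a \<Rightarrow> 'a" where
  "quot_map W x = (THE y. y \<in> orthogonal_comp W \<and> x - y \<in> W)"

text \<open>
  In the projected multi-fan, a simplex \<open>J\<close> containing \<open>K\<close> is represented by \<open>J - K\<close>,
  so that the minimum element \<open>K\<close> becomes the empty simplex.
\<close>

definition projected :: "('i, 'a::euclidean_space) multi_fan \<Rightarrow> 'i set \<Rightarrow> ('i, 'a) multi_fan" where
  "projected \<Delta> K =
     \<lparr> lat = quot_map (span (cone_of \<Delta> K)) ` lat \<Delta>,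
       splx = {J. J \<inter> K = {} \<and> J \<union> K \<in> splx \<Delta>},
       cone_of = (\<lambda>J. quot_map (span (cone_of \<Delta> K)) ` cone_of \<Delta> (J \<union> K)),
       w_plus = (\<lambda>I. w_plus \<Delta> (I \<union> K)),
       w_minus = (\<lambda>I. w_minus \<Delta> (I \<union> K)) \<rparr>"

definition complete_multi_fan :: "('i, 'a::euclidean_space) multi_fan \<Rightarrow> bool" where
  "complete_multi_fan \<Delta> \<longleftrightarrow> (\<forall>K\<in>splx \<Delta>. pre_complete (projected \<Delta> K))"

definition edge_vec :: "('i, 'a::euclidean_space) multi_fan \<Rightarrow> 'i \<Rightarrow> 'a" where
  "edge_vec \<Delta> i = (THE v. v \<in> cone_of \<Delta> {i} \<and> primitive (lat \<Delta>) v)"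

definition nonsingular :: "('i, 'a::euclidean_space) multi_fan \<Rightarrow> bool" where
  "nonsingular \<Delta> \<longleftrightarrow>
     (\<forall>I\<in>top_splx \<Delta>. inj_on (edge_vec \<Delta>) I \<and> lattice_basis (lat \<Delta>) (edge_vec \<Delta> ` I))"

definition dual_vec :: "('i, 'a::euclidean_space) multi_fan \<Rightarrow> 'i set \<Rightarrow> 'i \<Rightarrow> 'a" where
  "dual_vec \<Delta> K i =
     (THE u. u \<in> span (cone_of \<Delta> K) \<and> (\<forall>j\<in>K. u \<bullet> edge_vec \<Delta> j = (if j = i then 1 else 0)))"


section \<open>The groups \<open>H\<^sub>K\<close>\<close>

definition sublat :: "('i, 'a::euclidean_space) multi_fan \<Rightarrow> 'i set \<Rightarrow> 'a set" where
  "sublat \<Delta> K = lat \<Delta> \<inter> span (cone_of \<Delta> K)"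

definition edge_sublat :: "('i, 'a::euclidean_space) multi_fan \<Rightarrow> 'i set \<Rightarrow> 'a set" where
  "edge_sublat \<Delta> K = int_span (edge_vec \<Delta> ` K)"

definition H_grp :: "('i, 'a::euclidean_space) multi_fan \<Rightarrow> 'i set \<Rightarrow> 'a set set" where
  "H_grp \<Delta> K =
     sublat \<Delta> K // {(a, b). a \<in> sublat \<Delta> K \<and> b \<in> sublat \<Delta> K \<and> a - b \<in> edge_sublat \<Delta> K}"

definition rep :: "'a set \<Rightarrow> 'a" where
  "rep h = (SOME v. v \<in> h)"

definition H_hat :: "('i, 'a::euclidean_space) multi_fan \<Rightarrow> 'i set \<Rightarrow> 'a set set" where
  "H_hat \<Delta> K = {h \<in> H_grp \<Delta> K. \<forall>i\<in>K. dual_vec \<Delta> K i \<bullet> rep h \<notin> \<int>}"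

definition frac_rep :: "('i, 'a::euclidean_space) multi_fan \<Rightarrow> 'i set \<Rightarrow> 'a set \<Rightarrow> 'a" where
  "frac_rep \<Delta> K h = (THE v. v \<in> h \<and> (\<forall>i\<in>K. 0 \<le> dual_vec \<Delta> K i \<bullet> v \<and> dual_vec \<Delta> K i \<bullet> v < 1))"

definition f_inv :: "('i, 'a::euclidean_space) multi_fan \<Rightarrow> 'i set \<Rightarrow> 'a set \<Rightarrow> real" where
  "f_inv \<Delta> K h = (\<Sum>i\<in>K. dual_vec \<Delta> K i \<bullet> frac_rep \<Delta> K h)"


section \<open>Divisibility of the first Chern class\<close>

text \<open>
  Elements \<open>\<Sum> a\<^sub>i x\<^sub>i\<close> of the equivariant second cohomology are given by their coefficient
  functions \<open>a\<close>, of which only the values at vertices matter.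
\<close>

definition restr :: "('i, 'a::euclidean_space) multi_fan \<Rightarrow> 'i set \<Rightarrow> ('i \<Rightarrow> int) \<Rightarrow> 'a" where
  "restr \<Delta> I a = (\<Sum>i\<in>I. of_int (a i) *\<^sub>R dual_vec \<Delta> I i)"

definition T_Cartier :: "('i, 'a::euclidean_space) multi_fan \<Rightarrow> ('i \<Rightarrow> int) \<Rightarrow> bool" where
  "T_Cartier \<Delta> a \<longleftrightarrow> (\<forall>I\<in>top_splx \<Delta>. restr \<Delta> I a \<in> dual_lattice (lat \<Delta>))"

definition c1_T_Cartier_divisible :: "('i, 'a::euclidean_space) multi_fan \<Rightarrow> nat \<Rightarrow> bool" where
  "c1_T_Cartier_divisible \<Delta> N \<longleftrightarrow>
     (\<exists>a u. T_Cartier \<Delta> a \<and> u \<in> dual_lattice (lat \<Delta>) \<and>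
        (\<forall>i. {i} \<in> splx \<Delta> \<longrightarrow> 1 = real N * of_int (a i) + u \<bullet> edge_vec \<Delta> i))"


section \<open>\<open>T\<^sub>y\<close>-genera\<close>

definition chi :: "'a::euclidean_space \<Rightarrow> 'a set \<Rightarrow> complex" where
  "chi u h = exp (2 * of_real pi * \<i> * of_real (u \<bullet> rep h))"

text \<open>\<open>T_genus_at \<Delta> y\<close> is defined for arbitrary \<open>y\<close> in order to include the value at \<open>y = 0\<close>.\<close>

definition T_genus_at ::
    "('i, 'a::euclidean_space) multi_fan \<Rightarrow> 'a exp_field \<Rightarrow> 'a exp_field" where
  "T_genus_at \<Delta> y =
     (\<Sum>I\<in>top_splx \<Delta>. of_int (weight \<Delta> I) / of_nat (card (H_grp \<Delta> I)) *
        (\<Sum>h\<in>H_grp \<Delta> I. \<Prod>i\<in>I.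
           (1 + y * const (inverse (chi (dual_vec \<Delta> I i) h)) * t_exp (- dual_vec \<Delta> I i)) /
           (1 - const (inverse (chi (dual_vec \<Delta> I i) h)) * t_exp (- dual_vec \<Delta> I i))))"

definition T_genus :: "('i, 'a::euclidean_space) multi_fan \<Rightarrow> 'a exp_field" where
  "T_genus \<Delta> = T_genus_at \<Delta> var_y"

definition Todd_genus :: "('i, 'a::euclidean_space) multi_fan \<Rightarrow> 'a exp_field" where
  "Todd_genus \<Delta> = T_genus_at \<Delta> 0"

definition orbifold_T_genus :: "('i, 'a::euclidean_space) multi_fan \<Rightarrow> 'a exp_field" where
  "orbifold_T_genus \<Delta> =
     (\<Sum>k = 0..mf_dim \<Delta>. \<Sum>K\<in>splx_of \<Delta> k. \<Sum>h\<in>H_hat \<Delta> K.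
        neg_y_pow (f_inv \<Delta> K h) * T_genus (projected \<Delta> K))"

end

theory Submission
  imports Defs "HOL-Computational_Algebra.Polynomial"
begin

text \<open>
  The Todd genus being one, a generic vector lies in exactly one maximal cone.  Hence the lattice is
  tiled by the maximal cones, made half-open by means of a generic vector, and every lattice point
  is uniquely the sum of a box point (coordinates between \<open>0\<close> and \<open>1\<close>) of a maximal cone and a
  nonnegative integral combination of the edge vectors of that cone.  Divisibility gives \<open>u\<close> in the
  dual lattice such that on each maximal cone the sum of the coordinates is congruent to
  \<open>\<langle>u, l\<rangle>\<close> modulo \<open>n\<close>.  For an \<open>n\<close>-th root of unity \<open>\<zeta> \<noteq> 1\<close>, the character with value
  \<open>\<zeta>\<close> raised to \<open>\<langle>u, l\<rangle>\<close> takes the value \<open>\<zeta>\<close> on every edge vector; the operators \<open>f - \<zeta> T f\<close>, with \<open>T\<close>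
  the translation by an edge vector, annihilate it on the lattice, but cut its restriction to a
  half-open cone down to the box.  So the sum of the character over all box points vanishes, and the
  coordinate sums of the box points are equidistributed modulo \<open>n\<close>.  Since the sums \<open>0\<close> and \<open>n\<close>
  occur once each, every sum strictly between occurs exactly twice.

  There are \<open>h\<^sub>k\<close> box points with integral coordinates and coordinate sum \<open>k\<close>.  If \<open>h\<^sub>1 = 2\<close>, then
  \<open>h\<^sub>k \<ge> 2\<close> for \<open>0 < k < n\<close>, so that all box points are integral and the fan is non-singular.  If
  \<open>h\<^sub>1 = 1\<close> (and \<open>n \<ge> 2\<close>), the fan has \<open>n + 1\<close> edge vectors, whose linear relation has the coefficients
  \<open>1, 1, 2, \<dots>, 2\<close>, and the class of \<open>(v\<^sub>a + v\<^sub>b) / 2\<close> accounts for all other box points.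

  The formula for the \<open>T\<^sub>y\<close>-genus in terms of the \<open>h\<^sub>k\<close> follows by expanding all fractions into series
  in the direction of a generic vector: the coefficients of the sum do not depend on the direction,
  because only the degrees of links enter, and a nonzero exponent does not occur in the expansion
  for a suitable direction.
\<close>

section \<open>Dual bases and perturbations\<close>

text \<open>The character has no total over an infinite cone. This is why translation operators are
  applied to functions on the lattice before any total is taken. One and the same product of
  operators, over all edge vectors, serves every cone, because only the whole tiling is annihilated
  and not a single cone. The boxes are adapted to a generic vector for a second reason: an integral
  coordinate of a box point is then 0 or 1 according to its sign on that vector. The zero class of
  \<open>H I\<close> thus contributes the coordinate sum \<open>neg {} x I\<close>, and the
  h-numbers become part of the count of box points. The genera of projected multi-fans are needed as
  well, and their edge vectors are only positive multiples of the projected ones. The combinatorics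
  and the genus formula are therefore developed for abstract families of edge vectors in a discrete
  group.\<close>

definition indep_family :: "('i \<Rightarrow> 'a::euclidean_space) \<Rightarrow> 'i set \<Rightarrow> bool" where
  "indep_family v I \<longleftrightarrow> finite I \<and> inj_on v I \<and> independent (v ` I)"

definition dual_basis_vec :: "('i \<Rightarrow> 'a::euclidean_space) \<Rightarrow> 'i set \<Rightarrow> 'i \<Rightarrow> 'a" where
  "dual_basis_vec v I i =
     (THE u. u \<in> span (v ` I) \<and> (\<forall>j\<in>I. u \<bullet> v j = (if j = i then 1 else 0)))"

lemma span_family:
  fixes v :: "'i \<Rightarrow> 'a::euclidean_space"
  assumes "finite I"
  shows "x \<in> span (v ` I) \<longleftrightarrow> (\<exists>c. x = (\<Sum>i\<in>I. c i *\<^sub>R v i))"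
proof
  assume "x \<in> span (v ` I)"
  then show "\<exists>c. x = (\<Sum>i\<in>I. c i *\<^sub>R v i)"
  proof (induction rule: span_induct_alt)
    case base
    show ?case by (rule exI[of _ "\<lambda>_. 0"]) simp
  next
    case (step c y z)
    then obtain d j where "z = (\<Sum>i\<in>I. d i *\<^sub>R v i)" "j \<in> I" "y = v j" by blast
    then have "c *\<^sub>R y + z = (\<Sum>i\<in>I. ((if i = j then c else 0) + d i) *\<^sub>R v i)"
      using assms by (simp add: scaleR_add_left sum.distrib if_distrib[of "\<lambda>r. r *\<^sub>R _"] sum.delta cong: if_cong)
    then show ?case by (intro exI)
  qed
next
  assume "\<exists>c. x = (\<Sum>i\<in>I. c i *\<^sub>R v i)"
  then show "x \<in> span (v ` I)" by (auto intro: span_sum span_scale span_base)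
qed

lemma span_orthogonal_eqI:
  fixes x y :: "'a::euclidean_space"
  assumes "x \<in> span S" "y \<in> span S" "\<And>s. s \<in> S \<Longrightarrow> x \<bullet> s = y \<bullet> s"
  shows "x = y"
proof -
  have "(x - y) \<bullet> z = 0" if "z \<in> span S" for z
    using that by (induction rule: span_induct_alt) (auto simp: inner_add_right inner_diff_left assms(3))
  then have "(x - y) \<bullet> (x - y) = 0"
    using assms(1,2) span_diff by blast
  then show ?thesis by simp
qed

text \<open>The component of \<open>v i\<close> orthogonal to the other vectors pairs to zero with
  them and to its own squared norm with \<open>v i\<close>; independence makes it nonzero, so it can
  be normalised.\<close>

lemma indep_family_exists_dual:
  fixes v :: "'i \<Rightarrow> 'a::euclidean_space"
  assumes "indep_family v I" "i \<in> I"
  shows "\<exists>u\<in>span (v ` I). \<forall>j\<in>I. u \<bullet> v j = (if j = i then 1 else 0)"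
proof -
  let ?U = "v ` (I - {i})"
  have sub: "?U \<subseteq> v ` I" by blast
  have "v i \<notin> span ?U"
  proof -
    have "v ` I - {v i} = ?U"
      using assms by (auto simp: indep_family_def inj_on_def)
    then show ?thesis using assms unfolding indep_family_def dependent_def by (metis imageI)
  qed
  obtain p q where pq: "p \<in> span ?U" "\<And>w. w \<in> span ?U \<Longrightarrow> orthogonal q w" "v i = p + q"
    using orthogonal_subspace_decomp_exists[of ?U "v i"] by metis
  have q0: "q \<noteq> 0" using pq \<open>v i \<notin> span ?U\<close> by auto
  have "q = v i - p" using pq by simp
  then have "q \<in> span (v ` I)"
    using pq(1) span_mono[OF sub] assms(2) by (metis imageI span_base span_diff subsetD)
  moreover have "q \<bullet> v j = 0" if "j \<in> I" "j \<noteq> i" for j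
    using pq(2)[of "v j"] that by (auto simp: orthogonal_def span_base)
  moreover have "q \<bullet> v i = q \<bullet> q"
    using pq(2)[OF pq(1)] pq(3) by (simp add: orthogonal_def inner_add_right)
  ultimately show ?thesis
    using q0 by (intro bexI[of _ "q /\<^sub>R (q \<bullet> q)"]) (auto intro: span_scale)
qed

lemma dual_basis_vec_unique:
  fixes v :: "'i \<Rightarrow> 'a::euclidean_space"
  assumes "u \<in> span (v ` I)" "\<And>j. j \<in> I \<Longrightarrow> u \<bullet> v j = (if j = i then 1 else 0)"
  shows "dual_basis_vec v I i = u"
  unfolding dual_basis_vec_def
proof (rule the_equality)
  fix u' assume "u' \<in> span (v ` I) \<and> (\<forall>j\<in>I. u' \<bullet> v j = (if j = i then 1 else 0))"
  then show "u' = u" by (intro span_orthogonal_eqI[of u' "v ` I" u]) (auto simp: assms)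
qed (use assms in auto)

lemma dual_basis_vec:
  fixes v :: "'i \<Rightarrow> 'a::euclidean_space"
  assumes "indep_family v I" "i \<in> I"
  shows dual_basis_vec_in_span: "dual_basis_vec v I i \<in> span (v ` I)"
    and inner_dual_basis_vec: "j \<in> I \<Longrightarrow> dual_basis_vec v I i \<bullet> v j = (if j = i then 1 else 0)"
proof -
  obtain u where "u \<in> span (v ` I)" "\<forall>j\<in>I. u \<bullet> v j = (if j = i then 1 else 0)"
    using indep_family_exists_dual[OF assms] by blast
  moreover from this have "dual_basis_vec v I i = u" by (auto intro: dual_basis_vec_unique)
  ultimately show "dual_basis_vec v I i \<in> span (v ` I)"
    "j \<in> I \<Longrightarrow> dual_basis_vec v I i \<bullet> v j = (if j = i then 1 else 0)" by auto
qed

text \<open>A dual system certifies independence. For projected multi-fans the dual vectors are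
  known first, and independence is deduced from them.\<close>

lemma indep_familyI:
  fixes v :: "'i \<Rightarrow> 'a::euclidean_space"
  assumes "finite I" "\<And>i j. i \<in> I \<Longrightarrow> j \<in> I \<Longrightarrow> d i \<bullet> v j = (if j = i then 1 else 0)"
  shows "indep_family v I"
proof -
  have "inj_on v I"
    by (rule inj_onI) (metis assms(2) zero_neq_one)
  moreover have "v i \<notin> span (v ` I - {v i})" if "i \<in> I" for i
  proof
    assume "v i \<in> span (v ` I - {v i})"
    moreover have "d i \<bullet> x = 0" if x: "x \<in> v ` I - {v i}" for x
    proof -
      obtain j where "j \<in> I" "x = v j" "j \<noteq> i" using x by blast
      then show ?thesis using assms(2)[OF \<open>i \<in> I\<close>] by simp
    qed
    ultimately have "d i \<bullet> v i = 0"
      using orthogonal_to_span[of "v i" "v ` I - {v i}" "d i"] by (auto simp: orthogonal_def)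
    then show False using assms(2)[OF that that] by simp
  qed
  ultimately show ?thesis using assms(1) by (auto simp: indep_family_def dependent_def)
qed

lemma inner_dual_sum:
  fixes v :: "'i \<Rightarrow> 'a::euclidean_space"
  assumes "indep_family v I" "i \<in> I" "J \<subseteq> I"
  shows "dual_basis_vec v I i \<bullet> (\<Sum>j\<in>J. c j *\<^sub>R v j) = (if i \<in> J then c i else 0)"
proof -
  have fin: "finite J" using assms by (auto simp: indep_family_def intro: finite_subset)
  have "dual_basis_vec v I i \<bullet> (\<Sum>j\<in>J. c j *\<^sub>R v j) = (\<Sum>j\<in>J. if j = i then c j else 0)"
    unfolding inner_sum_right
    by (rule sum.cong) (use assms in \<open>auto simp: inner_dual_basis_vec subset_iff\<close>)
  then show ?thesis using fin by simp
qed

lemma dual_basis_expansion: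
  fixes v :: "'i \<Rightarrow> 'a::euclidean_space"
  assumes "indep_family v I" "x \<in> span (v ` I)"
  shows "(\<Sum>i\<in>I. (dual_basis_vec v I i \<bullet> x) *\<^sub>R v i) = x"
proof -
  obtain c where "x = (\<Sum>i\<in>I. c i *\<^sub>R v i)"
    using assms span_family[of I x v] by (auto simp: indep_family_def)
  moreover from this have "dual_basis_vec v I i \<bullet> x = c i" if "i \<in> I" for i
    using inner_dual_sum[OF assms(1) that, of I] that by simp
  ultimately show ?thesis by simp
qed

lemma inner_eq_sum_dual:
  fixes v :: "'i \<Rightarrow> 'a::euclidean_space"
  assumes "indep_family v I" "x \<in> span (v ` I)"
  shows "y \<bullet> x = (\<Sum>i\<in>I. (dual_basis_vec v I i \<bullet> x) * (y \<bullet> v i))"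
proof -
  have "y \<bullet> x = y \<bullet> (\<Sum>i\<in>I. (dual_basis_vec v I i \<bullet> x) *\<^sub>R v i)"
    by (simp only: dual_basis_expansion[OF assms])
  then show ?thesis by (simp add: inner_sum_right)
qed

text \<open>Nonzero signs survive a small move and vanishing ones are decided by \<open>y\<close>;
  finitely many forms allow a common step \<open>e\<close>.\<close>

lemma perturbation:
  fixes p y :: "'a::euclidean_space"
  assumes "finite U"
  shows "\<exists>e>0. \<forall>u\<in>U. sgn (u \<bullet> (p + e *\<^sub>R y)) = (if u \<bullet> p \<noteq> 0 then sgn (u \<bullet> p) else sgn (u \<bullet> y))"
proof -
  have "\<forall>\<^sub>F e in at_right (0::real). sgn (u \<bullet> (p + e *\<^sub>R y)) = (if u \<bullet> p \<noteq> 0 then sgn (u \<bullet> p) else sgn (u \<bullet> y))" for u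
  proof (cases "u \<bullet> p = 0")
    case True
    show ?thesis
      by (rule eventually_at_rightI[of 0 1]) (auto simp: True inner_add_right sgn_mult)
  next
    case False
    have lim: "((\<lambda>e. u \<bullet> (p + e *\<^sub>R y)) \<longlongrightarrow> u \<bullet> (p + 0 *\<^sub>R y)) (at_right 0)"
      by (intro tendsto_intros)
    consider "u \<bullet> p > 0" | "u \<bullet> p < 0" using False by linarith
    then show ?thesis
    proof cases
      case 1
      then have "\<forall>\<^sub>F e in at_right 0. u \<bullet> (p + e *\<^sub>R y) > 0"
        using order_tendstoD(1)[OF lim, of 0] by simp
      then show ?thesis by eventually_elim (use 1 in simp)
    next
      case 2
      then have "\<forall>\<^sub>F e in at_right 0. u \<bullet> (p + e *\<^sub>R y) < 0"
        using order_tendstoD(2)[OF lim, of 0] by simp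
      then show ?thesis by eventually_elim (use 2 in simp)
    qed
  qed
  then have "\<forall>\<^sub>F e in at_right (0::real). \<forall>u\<in>U. sgn (u \<bullet> (p + e *\<^sub>R y)) = (if u \<bullet> p \<noteq> 0 then sgn (u \<bullet> p) else sgn (u \<bullet> y))"
    using assms by (simp add: eventually_ball_finite_distrib)
  moreover have "\<forall>\<^sub>F e in at_right (0::real). e > 0"
    by (simp add: eventually_at_right_less)
  ultimately have "\<forall>\<^sub>F e in at_right (0::real). e > 0 \<and> (\<forall>u\<in>U. sgn (u \<bullet> (p + e *\<^sub>R y)) = (if u \<bullet> p \<noteq> 0 then sgn (u \<bullet> p) else sgn (u \<bullet> y)))"
    by eventually_elim blast
  then show ?thesis
    by (rule eventually_happens'[rotated]) simp
qed

text \<open>To leave the hyperplane orthogonal to a new vector \<open>u\<close>, move slightly in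
  the direction \<open>u\<close> itself, where \<open>u\<close> has positive value; the hyperplanes
  avoided before stay avoided.\<close>

lemma exists_avoiding_hyperplanes:
  fixes U :: "'a::euclidean_space set"
  assumes "finite U" "subspace W" "\<And>u. u \<in> U \<Longrightarrow> u \<in> W \<and> u \<noteq> 0"
  shows "\<exists>x\<in>W. \<forall>u\<in>U. u \<bullet> x \<noteq> 0"
  using assms(1,3)
proof (induction U rule: finite_induct)
  case empty
  then show ?case using assms(2) subspace_0 by blast
next
  case (insert u U)
  then obtain x where x: "x \<in> W" "\<forall>u\<in>U. u \<bullet> x \<noteq> 0" by blast
  obtain e where e: "e > 0"
    "\<forall>u'\<in>insert u U. sgn (u' \<bullet> (x + e *\<^sub>R u)) = (if u' \<bullet> x \<noteq> 0 then sgn (u' \<bullet> x) else sgn (u' \<bullet> u))"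
    using perturbation[of "insert u U" x u] insert.hyps by blast
  have "u' \<bullet> (x + e *\<^sub>R u) \<noteq> 0" if "u' \<in> insert u U" for u'
  proof -
    have "sgn (u' \<bullet> (x + e *\<^sub>R u)) \<noteq> 0"
      using e(2)[rule_format, OF that] that x(2) insert.prems[of u] by (auto simp: sgn_0_0)
    then show ?thesis by (auto simp: sgn_0_0)
  qed
  moreover have "x + e *\<^sub>R u \<in> W"
    using x(1) insert.prems[of u] assms(2) by (auto intro: subspace_add subspace_scale)
  ultimately show ?case by blast
qed

section \<open>Sums over stars\<close>

text \<open>No basis is asked for, so that the image of a lattice in a quotient can be treated
  without constructing one.\<close>

definition discrete_subgroup :: "'a::euclidean_space set \<Rightarrow> bool" where
  "discrete_subgroup L \<longleftrightarrow> 0 \<in> L \<and> (\<forall>x\<in>L. \<forall>y\<in>L. x - y \<in> L) \<and> (\<forall>B. bounded B \<longrightarrow> finite (L \<inter> B))"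

lemma discrete_subgroup_mult:
  assumes "discrete_subgroup L" "x \<in> L"
  shows "of_int m *\<^sub>R x \<in> L"
proof -
  have L: "0 \<in> L" "\<And>x y. x \<in> L \<Longrightarrow> y \<in> L \<Longrightarrow> x - y \<in> L"
    using assms(1) by (auto simp: discrete_subgroup_def)
  have neg: "- y \<in> L" if "y \<in> L" for y using L(2)[OF L(1) that] by simp
  have nat: "of_nat k *\<^sub>R x \<in> L" for k
  proof (induction k)
    case (Suc k)
    have "of_nat (Suc k) *\<^sub>R x = of_nat k *\<^sub>R x - (- x)" by (simp add: scaleR_add_left)
    then show ?case using L(2)[OF Suc neg[OF assms(2)]] by simp
  qed (simp add: L)
  show ?thesis
  proof (cases m rule: int_cases2)
    case (nonneg k)
    then show ?thesis using nat[of k] by simp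
  next
    case (nonpos k)
    then show ?thesis using neg[OF nat[of k]] by simp
  qed
qed

text \<open>The core shared by a multi-fan and its projections. Cones enter only through the
  coordinates with respect to the edge vectors of maximal simplices.\<close>

locale lattice_fan =
  fixes L :: "'a::euclidean_space set" and S :: "'i set set" and n :: nat
    and v :: "'i \<Rightarrow> 'a" and w :: "'i set \<Rightarrow> int"
  assumes discrete_subgroup: "discrete_subgroup L"
    and finite_S: "finite S"
    and finite_simplex: "I \<in> S \<Longrightarrow> finite I"
    and subset_closed: "I \<in> S \<Longrightarrow> J \<subseteq> I \<Longrightarrow> J \<in> S"
    and extends_to_top: "J \<in> S \<Longrightarrow> \<exists>I\<in>S. J \<subseteq> I \<and> card I = n"
    and edge_mem: "I \<in> S \<Longrightarrow> i \<in> I \<Longrightarrow> v i \<in> L"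
    and indep_top: "I \<in> S \<Longrightarrow> card I = n \<Longrightarrow> indep_family v I"
    and span_top: "I \<in> S \<Longrightarrow> card I = n \<Longrightarrow> span (v ` I) = span L"
begin

definition tops :: "'i set set" where "tops = {I \<in> S. card I = n}"

definition star :: "'i set \<Rightarrow> 'i set set" where "star K = {I \<in> tops. K \<subseteq> I}"

abbreviation d :: "'i set \<Rightarrow> 'i \<Rightarrow> 'a" where "d \<equiv> dual_basis_vec v"

text \<open>The zero set of \<open>d I i\<close> is spanned by the facet of \<open>I\<close>
  opposite to \<open>i\<close>, so this is genericity expressed in coordinates.\<close>

definition regular :: "'a \<Rightarrow> bool" where
  "regular x \<longleftrightarrow> x \<in> span L \<and> (\<forall>I\<in>tops. \<forall>i\<in>I. d I i \<bullet> x \<noteq> 0)"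

definition neg :: "'i set \<Rightarrow> 'a \<Rightarrow> 'i set \<Rightarrow> nat" where
  "neg K x I = card {i \<in> I - K. d I i \<bullet> x < 0}"

lemma finite_tops: "finite tops"
  using finite_S by (auto simp: tops_def)

lemma finite_star: "finite (star K)"
  using finite_tops by (auto simp: star_def)

lemma topsD:
  assumes "I \<in> tops"
  shows "I \<in> S" "finite I" "card I = n" "indep_family v I" "span (v ` I) = span L"
  using assms finite_simplex indep_top span_top by (auto simp: tops_def)

lemma starD:
  assumes "I \<in> star K"
  shows "I \<in> tops" "K \<subseteq> I" "finite K"
  using assms topsD(2) by (auto simp: star_def intro: finite_subset)

lemma star_nonempty: "K \<in> S \<Longrightarrow> \<exists>I. I \<in> star K"
  using extends_to_top[of K] by (auto simp: star_def tops_def)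

lemma star_empty [simp]: "star {} = tops"
  by (simp add: star_def)

lemma zero_mem: "0 \<in> L"
  and diff_mem: "x \<in> L \<Longrightarrow> y \<in> L \<Longrightarrow> x - y \<in> L"
  and discrete: "bounded B \<Longrightarrow> finite (L \<inter> B)"
  using discrete_subgroup by (auto simp: discrete_subgroup_def)

lemma uminus_mem: "x \<in> L \<Longrightarrow> - x \<in> L"
  using diff_mem[of 0 x] zero_mem by simp

lemma add_mem: "x \<in> L \<Longrightarrow> y \<in> L \<Longrightarrow> x + y \<in> L"
  using diff_mem[of x "- y"] uminus_mem by simp

lemma scale_int_mem: "x \<in> L \<Longrightarrow> of_int m *\<^sub>R x \<in> L"
  by (rule discrete_subgroup_mult[OF discrete_subgroup])

lemma sum_mem: "(\<And>i. i \<in> A \<Longrightarrow> f i \<in> L) \<Longrightarrow> sum f A \<in> L"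
  by (induction A rule: infinite_finite_induct) (auto simp: zero_mem add_mem)

lemma dual_in_span: "I \<in> tops \<Longrightarrow> i \<in> I \<Longrightarrow> d I i \<in> span L"
  using dual_basis_vec_in_span[of v I i] topsD by metis

lemma dual_inner: "I \<in> tops \<Longrightarrow> i \<in> I \<Longrightarrow> j \<in> I \<Longrightarrow> d I i \<bullet> v j = (if j = i then 1 else 0)"
  using inner_dual_basis_vec topsD(4) by metis

lemma dual_nonzero: "I \<in> tops \<Longrightarrow> i \<in> I \<Longrightarrow> d I i \<noteq> 0"
  using dual_inner[of I i i] by auto

text \<open>The point \<open>p\<close> decides all signs it can and \<open>y\<close> breaks the
  ties. The set \<open>U\<close> holds further forms whose signs at \<open>p\<close> are to be
  kept.\<close>

lemma perturb_regular:
  assumes "p \<in> span L" "regular y" "finite U"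
  shows "\<exists>x. regular x \<and>
    (\<forall>I\<in>tops. \<forall>i\<in>I. sgn (d I i \<bullet> x) = (if d I i \<bullet> p \<noteq> 0 then sgn (d I i \<bullet> p) else sgn (d I i \<bullet> y))) \<and>
    (\<forall>u\<in>U. u \<bullet> p \<noteq> 0 \<longrightarrow> sgn (u \<bullet> x) = sgn (u \<bullet> p))"
proof -
  have "finite (U \<union> (\<Union>I\<in>tops. d I ` I))"
    using assms(3) finite_tops topsD(2) by blast
  from perturbation[OF this, of p y] obtain e where e: "e > 0"
    "\<forall>u\<in>U \<union> (\<Union>I\<in>tops. d I ` I). sgn (u \<bullet> (p + e *\<^sub>R y)) = (if u \<bullet> p \<noteq> 0 then sgn (u \<bullet> p) else sgn (u \<bullet> y))"
    by blast
  define x where "x = p + e *\<^sub>R y"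
  have sg: "sgn (d I i \<bullet> x) = (if d I i \<bullet> p \<noteq> 0 then sgn (d I i \<bullet> p) else sgn (d I i \<bullet> y))"
    if "I \<in> tops" "i \<in> I" for I i
    using e(2) that unfolding x_def by blast
  have "d I i \<bullet> x \<noteq> 0" if "I \<in> tops" "i \<in> I" for I i
    using sg[OF that] assms(2) that by (auto simp: regular_def sgn_0_0 split: if_splits)
  moreover have "x \<in> span L"
    using assms(1,2) unfolding x_def regular_def by (auto intro: span_add span_scale)
  ultimately have "regular x" by (auto simp: regular_def)
  moreover have "\<forall>u\<in>U. u \<bullet> p \<noteq> 0 \<longrightarrow> sgn (u \<bullet> x) = sgn (u \<bullet> p)"
    using e(2) unfolding x_def by auto
  ultimately show ?thesis using sg by blast
qed

lemma exists_regular: "\<exists>x. regular x"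
proof -
  have "finite (\<Union>I\<in>tops. d I ` I)"
    using finite_tops topsD(2) by blast
  then have "\<exists>x\<in>span L. \<forall>u\<in>(\<Union>I\<in>tops. d I ` I). u \<bullet> x \<noteq> 0"
    by (rule exists_avoiding_hyperplanes) (use dual_in_span dual_nonzero in auto)
  then show ?thesis by (auto simp: regular_def)
qed

lemma regular_uminus: "regular x \<Longrightarrow> regular (- x)"
  by (auto simp: regular_def span_neg)

lemma regular_pos_iff: "regular x \<Longrightarrow> I \<in> tops \<Longrightarrow> i \<in> I \<Longrightarrow> d I i \<bullet> x > 0 \<longleftrightarrow> \<not> d I i \<bullet> x < 0"
  by (force simp: regular_def)

end

text \<open>Pre-completeness of every projected multi-fan, read in the original space: for
  \<open>i\<close> in \<open>I - K\<close> the form \<open>d I i\<close> vanishes on the edge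
  vectors of \<open>K\<close>, so its sign at \<open>x\<close> tells where the image of
  \<open>x\<close> lies.\<close>

locale complete_lattice_fan = lattice_fan L S n v w
  for L :: "'a::euclidean_space set" and S :: "'i set set" and n and v :: "'i \<Rightarrow> 'a" and w +
  assumes complete: "K \<in> S \<Longrightarrow> regular x \<Longrightarrow> regular y \<Longrightarrow>
    (\<Sum>I | I \<in> star K \<and> (\<forall>i\<in>I - K. d I i \<bullet> x > 0). w I) =
    (\<Sum>I | I \<in> star K \<and> (\<forall>i\<in>I - K. d I i \<bullet> y > 0). w I)"
begin

text \<open>
  Expanding the product over the subsets of positive coordinates leaves, for every simplex \<open>J\<close>,
  the degree of its link as the only dependence on \<open>x\<close>.
\<close>

lemma star_sum_expansion:
  fixes \<alpha> :: "'i \<Rightarrow> 'r::comm_ring_1"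
  assumes "finite K"
  shows "(\<Sum>I\<in>star K. of_int (w I) * (\<Prod>i\<in>I - K. \<alpha> i + (if d I i \<bullet> x > 0 then \<beta> else 0))) =
    (\<Sum>J | J \<in> S \<and> K \<subseteq> J. (\<Prod>i\<in>J - K. \<alpha> i) * \<beta> ^ (n - card J) *
       of_int (\<Sum>I | I \<in> star J \<and> (\<forall>i\<in>I - J. d I i \<bullet> x > 0). w I))"
proof -
  let ?c = "\<lambda>I i. if d I i \<bullet> x > 0 then \<beta> else 0"
  have finI: "finite I" if "I \<in> star K" for I
    using that starD(1) topsD(2) by blast
  have "(\<Sum>I\<in>star K. of_int (w I) * (\<Prod>i\<in>I - K. \<alpha> i + ?c I i)) =
    (\<Sum>I\<in>star K. \<Sum>B\<in>Pow (I - K). of_int (w I) * ((\<Prod>i\<in>B. \<alpha> i) * (\<Prod>i\<in>I - K - B. ?c I i)))"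
    by (intro sum.cong refl) (use finI in \<open>simp add: prod_add sum_distrib_left\<close>)
  also have "\<dots> = (\<Sum>(I, B)\<in>(SIGMA I:star K. Pow (I - K)). of_int (w I) * ((\<Prod>i\<in>B. \<alpha> i) * (\<Prod>i\<in>I - K - B. ?c I i)))"
    by (rule sum.Sigma) (use finI finite_star in auto)
  \<comment> \<open>Regroup by \<open>J = K \<union> B\<close>, where \<open>B\<close> collects the
    factors that contributed \<alpha>.\<close>
  also have "\<dots> = (\<Sum>(J, I)\<in>(SIGMA J:{J \<in> S. K \<subseteq> J}. star J). of_int (w I) * ((\<Prod>i\<in>J - K. \<alpha> i) * (\<Prod>i\<in>I - J. ?c I i)))"
  proof (rule sum.reindex_bij_witness[of _ "\<lambda>(J, I). (I, J - K)" "\<lambda>(I, B). (K \<union> B, I)"], goal_cases)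
    case (5 a)
    then show ?case by (auto simp: Diff_Un Diff_Int_distrib intro!: arg_cong2[where f="(*)"] prod.cong)
  qed (auto simp: star_def tops_def intro: subset_closed)
  also have "\<dots> = (\<Sum>J | J \<in> S \<and> K \<subseteq> J. \<Sum>I\<in>star J. of_int (w I) * ((\<Prod>i\<in>J - K. \<alpha> i) * (\<Prod>i\<in>I - J. ?c I i)))"
    by (rule sum.Sigma[symmetric]) (use finite_star finite_S in auto)
  also have "\<dots> = (\<Sum>J | J \<in> S \<and> K \<subseteq> J. (\<Prod>i\<in>J - K. \<alpha> i) * \<beta> ^ (n - card J) *
       of_int (\<Sum>I | I \<in> star J \<and> (\<forall>i\<in>I - J. d I i \<bullet> x > 0). w I))"
  proof (intro sum.cong refl)
    fix J
    have "(\<Prod>i\<in>I - J. ?c I i) = (if \<forall>i\<in>I - J. d I i \<bullet> x > 0 then \<beta> ^ (n - card J) else 0)"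
      if "I \<in> star J" for I
    proof -
      have I: "finite I" "card I = n" "J \<subseteq> I"
        using starD(1,2)[OF that] topsD(2,3) by auto
      then have "card (I - J) = n - card J"
        by (simp add: card_Diff_subset finite_subset)
      then show ?thesis
        using I by (auto intro!: prod_zero)
    qed
    then have "(\<Sum>I\<in>star J. of_int (w I) * ((\<Prod>i\<in>J - K. \<alpha> i) * (\<Prod>i\<in>I - J. ?c I i))) =
      (\<Sum>I\<in>star J. if \<forall>i\<in>I - J. d I i \<bullet> x > 0 then of_int (w I) * ((\<Prod>i\<in>J - K. \<alpha> i) * \<beta> ^ (n - card J)) else 0)"
      by (intro sum.cong) auto
    also have "\<dots> = (\<Sum>I | I \<in> star J \<and> (\<forall>i\<in>I - J. d I i \<bullet> x > 0). of_int (w I) * ((\<Prod>i\<in>J - K. \<alpha> i) * \<beta> ^ (n - card J)))"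
      by (rule sum.inter_filter[symmetric]) (rule finite_star)
    finally show "(\<Sum>I\<in>star J. of_int (w I) * ((\<Prod>i\<in>J - K. \<alpha> i) * (\<Prod>i\<in>I - J. ?c I i))) =
      (\<Prod>i\<in>J - K. \<alpha> i) * \<beta> ^ (n - card J) *
       of_int (\<Sum>I | I \<in> star J \<and> (\<forall>i\<in>I - J. d I i \<bullet> x > 0). w I)"
      by (simp add: of_int_sum sum_distrib_left sum_distrib_right mult_ac)
  qed
  finally show ?thesis .
qed

lemma star_sum_regular:
  fixes \<alpha> :: "'i \<Rightarrow> 'r::comm_ring_1"
  assumes "finite K" "regular x" "regular y"
  shows "(\<Sum>I\<in>star K. of_int (w I) * (\<Prod>i\<in>I - K. \<alpha> i + (if d I i \<bullet> x > 0 then \<beta> else 0))) =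
    (\<Sum>I\<in>star K. of_int (w I) * (\<Prod>i\<in>I - K. \<alpha> i + (if d I i \<bullet> y > 0 then \<beta> else 0)))"
  unfolding star_sum_expansion[OF assms(1)]
  by (intro sum.cong refl) (use complete[OF _ assms(2,3)] in auto)

text \<open>With \<alpha> = \<open>X\<close> and \<beta> = \<open>1 - X\<close> a factor is
  \<open>X\<close> at a negative coordinate and 1 at a positive one. The invariant sum is then the
  generating polynomial of the weights by number of negative coordinates, and its coefficients are
  compared.\<close>

lemma weight_neg_regular:
  assumes "finite K" "regular x" "regular y"
  shows "(\<Sum>I | I \<in> star K \<and> neg K x I = k. w I) = (\<Sum>I | I \<in> star K \<and> neg K y I = k. w I)"
proof -
  define X :: "int poly" where "X = monom 1 1"
  have coeff: "(\<Sum>I | I \<in> star K \<and> neg K z I = k. w I) =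
    poly.coeff (\<Sum>I\<in>star K. of_int (w I) * (\<Prod>i\<in>I - K. X + (if d I i \<bullet> z > 0 then 1 - X else 0))) k"
    if "regular z" for z
  proof -
    have "(\<Prod>i\<in>I - K. X + (if d I i \<bullet> z > 0 then 1 - X else 0)) = monom 1 (neg K z I)"
      if "I \<in> star K" for I
    proof -
      have I: "I \<in> tops" "finite I" using starD(1)[OF that] topsD(2) by auto
      have "(\<Prod>i\<in>I - K. X + (if d I i \<bullet> z > 0 then 1 - X else 0)) = (\<Prod>i\<in>I - K. if d I i \<bullet> z < 0 then X else 1)"
        by (rule prod.cong) (use regular_pos_iff[OF \<open>regular z\<close> I(1)] in auto)
      also have "\<dots> = (\<Prod>i | i \<in> I - K \<and> d I i \<bullet> z < 0. X)"
        by (rule prod.inter_filter[symmetric]) (use I in simp)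
      also have "\<dots> = monom 1 (neg K z I)"
        by (simp add: neg_def X_def monom_power)
      finally show ?thesis .
    qed
    then have "(\<Sum>I\<in>star K. of_int (w I) * (\<Prod>i\<in>I - K. X + (if d I i \<bullet> z > 0 then 1 - X else 0))) =
      (\<Sum>I\<in>star K. monom (w I) (neg K z I))"
      by (intro sum.cong refl) (simp add: of_int_poly smult_monom)
    then show ?thesis
      by (simp add: coeff_sum if_distrib sum.inter_filter finite_star)
  qed
  show ?thesis
    unfolding coeff[OF assms(2)] coeff[OF assms(3)] star_sum_regular[OF assms] ..
qed

end

section \<open>Series expansions of fractions\<close>

text \<open>
  Functions on the exponents, without any condition on their support, form a module over the
  group algebra.  An expansion of a fraction is a function that a nonzero denominator carries to the
  numerator; it is not unique, but an expansion with finite support determines the fraction.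
\<close>

definition act :: "('e::ab_group_add \<Rightarrow>\<^sub>0 'r::comm_ring_1) \<Rightarrow> ('e \<Rightarrow> 'r) \<Rightarrow> 'e \<Rightarrow> 'r" where
  "act p f x = (\<Sum>a\<in>Poly_Mapping.keys p. Poly_Mapping.lookup p a * f (x - a))"

lemma act_superset:
  assumes "finite A" "Poly_Mapping.keys p \<subseteq> A"
  shows "act p f x = (\<Sum>a\<in>A. Poly_Mapping.lookup p a * f (x - a))"
  unfolding act_def
  by (rule sum.mono_neutral_left) (use assms in \<open>auto simp: in_keys_iff\<close>)

lemma act_add_left: "act (p + q) f x = act p f x + act q f x"
proof -
  let ?A = "Poly_Mapping.keys p \<union> Poly_Mapping.keys q"
  have "Poly_Mapping.keys (p + q) \<subseteq> ?A" by (rule keys_add)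
  then show ?thesis
    using act_superset[of ?A p f x] act_superset[of ?A q f x] act_superset[of ?A "p + q" f x]
    by (simp add: lookup_add distrib_right sum.distrib)
qed

lemma act_single: "act (Poly_Mapping.single a c) f x = c * f (x - a)"
  using act_superset[of "{a}" "Poly_Mapping.single a c" f x] by simp

lemma act_0_left [simp]: "act 0 f x = 0"
  by (simp add: act_def)

lemma act_uminus_left: "act (- p) f x = - act p f x"
  using act_add_left[of p "- p" f x] by (simp add: eq_neg_iff_add_eq_0 add.commute)

lemma act_diff_left: "act (p - q) f x = act p f x - act q f x"
  using act_add_left[of p "- q" f x] by (simp add: act_uminus_left)

lemma act_1: "act 1 f x = f x"
  using act_single[of 0 1 f x] by simp

lemma act_of_nat: "act (of_nat k) f x = of_nat k * f x"
  by (induction k) (simp_all add: act_add_left act_1 algebra_simps)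

lemma act_of_int: "act (of_int k) f x = of_int k * f x"
  by (cases k rule: int_cases2) (simp_all add: act_of_nat act_uminus_left)

lemma act_add_right: "act p (\<lambda>x. f x + g x) x = act p f x + act p g x"
  by (simp add: act_def algebra_simps sum.distrib)

lemma poly_mapping_additive_induct [case_names zero add single]:
  assumes "P 0" "\<And>p q. P p \<Longrightarrow> P q \<Longrightarrow> P (p + q)" "\<And>a c. P (Poly_Mapping.single a c)"
  shows "P (p :: 'e \<Rightarrow>\<^sub>0 'r::comm_monoid_add)"
proof (induction p rule: update_induct)
  case const
  show ?case by (rule assms)
next
  case (update f a b)
  then have "Poly_Mapping.update a b f = f + Poly_Mapping.single a b"
    by (intro poly_mapping_eqI)
      (auto simp: lookup_update lookup_add lookup_single when_def in_keys_iff)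
  then show ?case using update assms by metis
qed

lemma act_mult: "act (p * q) f x = act p (act q f) x"
proof (induction p arbitrary: x rule: poly_mapping_additive_induct)
  case zero
  show ?case by simp
next
  case (add p p')
  then show ?case by (simp add: algebra_simps act_add_left)
next
  case (single a c)
  show ?case
  proof (induction q arbitrary: x rule: poly_mapping_additive_induct)
    case (add q q')
    then show ?case by (simp add: distrib_left act_add_left act_single)
  qed (simp_all add: act_single mult_single algebra_simps)
qed

lemma act_lookup: "act p (Poly_Mapping.lookup q) x = Poly_Mapping.lookup (p * q) x"
proof (induction p arbitrary: x rule: poly_mapping_additive_induct)
  case zero
  show ?case by simp
next
  case (add p p')
  then show ?case by (simp add: algebra_simps act_add_left lookup_add)
next
  case (single a c)
  show ?case
  proof (induction q arbitrary: x rule: poly_mapping_additive_induct)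
    case (add q q')
    then show ?case by (simp add: distrib_left act_single lookup_add)
  qed (auto simp: act_single mult_single lookup_single when_def algebra_simps)
qed

definition expansion ::
    "('e::linordered_ab_group_add \<Rightarrow>\<^sub>0 'r::idom) fract \<Rightarrow> ('e \<Rightarrow> 'r) \<Rightarrow> bool" where
  "expansion Q f \<longleftrightarrow> (\<exists>p q. q \<noteq> 0 \<and> Q = Fract p q \<and> act q f = Poly_Mapping.lookup p)"

lemma expansion_add:
  assumes "expansion Q f" "expansion Q' f'"
  shows "expansion (Q + Q') (\<lambda>x. f x + f' x)"
proof -
  obtain p q where Q: "q \<noteq> 0" "Q = Fract p q" "act q f = Poly_Mapping.lookup p"
    using assms(1) unfolding expansion_def by blast
  obtain p' q' where Q': "q' \<noteq> 0" "Q' = Fract p' q'" "act q' f' = Poly_Mapping.lookup p'"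
    using assms(2) unfolding expansion_def by blast
  have "act (q * q') (\<lambda>x. f x + f' x) x = Poly_Mapping.lookup (p * q' + p' * q) x" for x
    using act_mult[of q' q f x] act_mult[of q q' f' x]
    by (simp add: act_add_right Q Q' act_lookup lookup_add mult.commute)
  then have "act (q * q') (\<lambda>x. f x + f' x) = Poly_Mapping.lookup (p * q' + p' * q)" ..
  then show ?thesis
    unfolding expansion_def using Q Q' by (intro exI[of _ "p * q' + p' * q"] exI[of _ "q * q'"]) simp
qed

lemma expansion_lookup: "expansion (Fract r 1) (Poly_Mapping.lookup r)"
  unfolding expansion_def by (intro exI[of _ r] exI[of _ 1]) (auto simp: act_1)

lemma expansion_sum:
  assumes "\<And>i. i \<in> A \<Longrightarrow> expansion (Q i) (f i)"
  shows "expansion (\<Sum>i\<in>A. Q i) (\<lambda>x. \<Sum>i\<in>A. f i x)"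
  using assms
proof (induction A rule: infinite_finite_induct)
  case (insert i A)
  then show ?case by (simp add: expansion_add)
qed (use expansion_lookup[of 0] in \<open>simp_all add: fract_collapse lookup_zero[abs_def]\<close>)

lemma expansion_mult:
  assumes "expansion Q f"
  shows "expansion (Fract r 1 * Q) (act r f)"
proof -
  obtain p q where Q: "q \<noteq> 0" "Q = Fract p q" "act q f = Poly_Mapping.lookup p"
    using assms(1) unfolding expansion_def by blast
  have "act q (act r f) = Poly_Mapping.lookup (r * p)"
    by (simp add: fun_eq_iff act_mult[symmetric] mult.commute[of q r]) (simp add: act_mult Q act_lookup)
  then show ?thesis
    unfolding expansion_def using Q by (intro exI[of _ "r * p"] exI[of _ q]) simp
qed

text \<open>A candidate for the quotient is only checked by multiplying back. For a denominator
  \<open>1 - z\<close> the series in \<open>z\<close> and the series in \<open>1 / z\<close> both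
  pass this test, which leaves the direction of expansion free.\<close>

lemma expansion_divide:
  assumes "expansion Q f" "act r g = f" "r \<noteq> 0"
  shows "expansion (Q / Fract r 1) g"
proof -
  obtain p q where Q: "q \<noteq> 0" "Q = Fract p q" "act q f = Poly_Mapping.lookup p"
    using assms(1) unfolding expansion_def by blast
  have "act (q * r) g = Poly_Mapping.lookup p"
    by (simp add: fun_eq_iff act_mult assms(2) Q(3))
  then show ?thesis
    unfolding expansion_def using Q assms(3) by (intro exI[of _ p] exI[of _ "q * r"]) simp
qed

lemma expansion_finite_unique:
  assumes "expansion Q (Poly_Mapping.lookup r)"
  shows "Q = Fract r 1"
proof -
  obtain p q where Q: "q \<noteq> 0" "Q = Fract p q" "act q (Poly_Mapping.lookup r) = Poly_Mapping.lookup p"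
    using assms(1) unfolding expansion_def by blast
  have "q * r = p"
    by (rule poly_mapping_eqI) (metis Q(3) act_lookup)
  then show ?thesis using Q by (simp add: eq_fract mult.commute)
qed

lemma Fract_of_int_eq: "Fract (of_int k) 1 = (of_int k :: 'r::idom fract)"
proof (cases k)
  case (nonneg m)
  then show ?thesis by (simp add: Fract_of_nat_eq)
next
  case (neg m)
  have "Fract (of_int k) 1 = - Fract (of_nat (Suc m)) (1::'r)"
    unfolding minus_fract by (simp add: neg)
  then show ?thesis unfolding Fract_of_nat_eq by (simp add: neg)
qed

section \<open>Expansion of one factor\<close>

definition unit_char :: "real \<Rightarrow> complex" where
  "unit_char r = exp (2 * of_real pi * \<i> * of_real r)"

lemma unit_char_add: "unit_char (r + s) = unit_char r * unit_char s"
  by (simp add: unit_char_def exp_add[symmetric] algebra_simps)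

lemma unit_char_0 [simp]: "unit_char 0 = 1"
  by (simp add: unit_char_def)

lemma unit_char_eq_1_iff: "unit_char r = 1 \<longleftrightarrow> r \<in> \<int>"
proof
  assume "unit_char r = 1"
  then obtain k :: int where "2 * pi * r = of_int (2 * k) * pi"
    by (auto simp: unit_char_def exp_eq_1)
  then have "pi * (2 * r) = pi * of_int (2 * k)" by (simp only: mult_ac)
  then have "r = of_int k" by simp
  then show "r \<in> \<int>" by simp
next
  assume "r \<in> \<int>"
  then obtain k :: int where "r = of_int k" by (auto elim: Ints_cases)
  then show "unit_char r = 1"
    unfolding unit_char_def exp_eq_1 by (auto intro!: exI[of _ k])
qed

lemma unit_char_sum: "unit_char (\<Sum>i\<in>A. f i) = (\<Prod>i\<in>A. unit_char (f i))"
  by (induction A rule: infinite_finite_induct) (simp_all add: unit_char_add)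

text \<open>
  The coefficients of the expansion of \<open>(1 + \<rho> z) / (1 - z)\<close>, in powers of \<open>z\<close> if \<open>s\<close> holds and in
  powers of \<open>1 / z\<close> otherwise.  The two differ by the constant \<open>1 + \<rho>\<close> in every degree.
\<close>

definition neg_coeff :: "'r::comm_ring_1 \<Rightarrow> real \<Rightarrow> 'r" where
  "neg_coeff \<rho> k = (if k > 0 then 0 else if k = 0 then - \<rho> else - (1 + \<rho>))"

definition gen_coeff :: "'r::comm_ring_1 \<Rightarrow> bool \<Rightarrow> real \<Rightarrow> 'r" where
  "gen_coeff \<rho> s k = neg_coeff \<rho> k + (if s then 1 + \<rho> else 0)"

text \<open>Coefficients of \<open>(1 + \<rho> c z) / (1 - c z)\<close> with
  \<open>c = unit_char (- \<theta>)\<close>. The degree is a real number because exponents are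
  arbitrary vectors; off the integers the coefficient is zero.\<close>

definition twisted_coeff :: "(real \<Rightarrow>\<^sub>0 complex) \<Rightarrow> bool \<Rightarrow> real \<Rightarrow> real \<Rightarrow> (real \<Rightarrow>\<^sub>0 complex)" where
  "twisted_coeff \<rho> s \<theta> k =
     (if k \<in> \<int> then Poly_Mapping.single 0 (unit_char (- (k * \<theta>))) * gen_coeff \<rho> s k else 0)"

text \<open>Multiplication by \<open>1 - c z\<close>, degree by degree. The constant by which the
  two directions differ cancels in the difference, so both satisfy the same recurrence.\<close>

lemma twisted_coeff_recurrence:
  fixes \<theta> k :: real
  defines "c \<equiv> Poly_Mapping.single 0 (unit_char (- \<theta>))"
  shows "twisted_coeff \<rho> s \<theta> k - c * twisted_coeff \<rho> s \<theta> (k - 1) =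
    (if k = 0 then 1 else 0) + \<rho> * c * (if k = 1 then 1 else 0)"
proof (cases "k \<in> \<int>")
  case False
  then have "k - 1 \<notin> \<int>" "k \<noteq> 0" "k \<noteq> 1" by (auto simp: minus_in_Ints_iff)
  then show ?thesis using False by (simp add: twisted_coeff_def)
next
  case True
  then obtain m :: int where m: "k = of_int m" by (auto elim: Ints_cases)
  let ?C = "\<lambda>k. Poly_Mapping.single 0 (unit_char (- (k * \<theta>))) :: real \<Rightarrow>\<^sub>0 complex"
  have "c * ?C (k - 1) = ?C k"
    by (simp add: c_def mult_single unit_char_add[symmetric] algebra_simps)
  moreover have "twisted_coeff \<rho> s \<theta> k = ?C k * gen_coeff \<rho> s k"
    "twisted_coeff \<rho> s \<theta> (k - 1) = ?C (k - 1) * gen_coeff \<rho> s (k - 1)"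
    using True by (simp_all add: twisted_coeff_def)
  ultimately have "twisted_coeff \<rho> s \<theta> k - c * twisted_coeff \<rho> s \<theta> (k - 1) =
     ?C k * (gen_coeff \<rho> s k - gen_coeff \<rho> s (k - 1))"
    by (simp only: right_diff_distrib mult.assoc[symmetric])
  also have "gen_coeff \<rho> s k - gen_coeff \<rho> s (k - 1) = (if k = 0 then 1 else if k = 1 then \<rho> else 0)"
  proof -
    consider "m < 0" | "m = 0" | "m = 1" | "m > 1" by linarith
    then show ?thesis by cases (auto simp: gen_coeff_def neg_coeff_def m)
  qed
  finally show ?thesis by (simp add: c_def mult.commute)
qed

lemma gen_coeff_0: "gen_coeff \<rho> s 0 = (if s then 1 else - \<rho>)"
  by (simp add: gen_coeff_def neg_coeff_def)

lemma gen_coeff_nonzero: "gen_coeff \<rho> s k \<noteq> 0 \<Longrightarrow> if s then k \<ge> 0 else k \<le> 0"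
  by (auto simp: gen_coeff_def neg_coeff_def split: if_splits)

section \<open>The genus as a sum over maximal simplices\<close>

lemma equiv_subgroup_rel:
  fixes L :: "'a::ab_group_add set"
  assumes "0 \<in> M" "\<And>x y. x \<in> M \<Longrightarrow> y \<in> M \<Longrightarrow> x - y \<in> M"
  shows "equiv L {(a, b). a \<in> L \<and> b \<in> L \<and> a - b \<in> M}"
proof (rule equivI)
  show "refl_on L {(a, b). a \<in> L \<and> b \<in> L \<and> a - b \<in> M}"
    using assms(1) by (auto simp: refl_on_def)
  show "sym {(a, b). a \<in> L \<and> b \<in> L \<and> a - b \<in> M}"
    using assms(2)[OF assms(1)] by (force simp: sym_def)
  show "trans {(a, b). a \<in> L \<and> b \<in> L \<and> a - b \<in> M}"
  proof (rule transI, clarsimp)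
    fix x y z assume "x - y \<in> M" "y - z \<in> M"
    then have "(x - y) - (0 - (y - z)) \<in> M" using assms by blast
    then show "x - z \<in> M" by simp
  qed
qed auto

lemma int_span_family:
  fixes v :: "'i \<Rightarrow> 'a::euclidean_space"
  assumes "inj_on v I"
  shows "x \<in> int_span (v ` I) \<longleftrightarrow> (\<exists>m :: 'i \<Rightarrow> int. x = (\<Sum>i\<in>I. of_int (m i) *\<^sub>R v i))"
proof
  assume "x \<in> int_span (v ` I)"
  then obtain c :: "'a \<Rightarrow> int" where "x = (\<Sum>s\<in>v ` I. of_int (c s) *\<^sub>R s)"
    by (auto simp: int_span_def)
  then have "x = (\<Sum>i\<in>I. of_int (c (v i)) *\<^sub>R v i)"
    using assms by (simp add: sum.reindex)
  then show "\<exists>m :: 'i \<Rightarrow> int. x = (\<Sum>i\<in>I. of_int (m i) *\<^sub>R v i)" by (intro exI[of _ "\<lambda>i. c (v i)"])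
next
  assume "\<exists>m :: 'i \<Rightarrow> int. x = (\<Sum>i\<in>I. of_int (m i) *\<^sub>R v i)"
  then obtain m :: "'i \<Rightarrow> int" where "x = (\<Sum>i\<in>I. of_int (m i) *\<^sub>R v i)" ..
  also have "\<dots> = (\<Sum>s\<in>v ` I. of_int (m (inv_into I v s)) *\<^sub>R s)"
    using assms by (simp add: sum.reindex)
  finally show "x \<in> int_span (v ` I)"
    unfolding int_span_def by (intro CollectI exI[of _ "\<lambda>s. m (inv_into I v s)"]) simp
qed

lemma int_span_subgroup:
  fixes A :: "'a::euclidean_space set"
  shows "0 \<in> int_span A" "x \<in> int_span A \<Longrightarrow> y \<in> int_span A \<Longrightarrow> x - y \<in> int_span A"
proof -
  show "0 \<in> int_span A"
    unfolding int_span_def by (intro CollectI exI[of _ "\<lambda>_. 0"]) simp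
  assume "x \<in> int_span A" "y \<in> int_span A"
  then obtain c c' :: "'a \<Rightarrow> int" where
    "x = (\<Sum>s\<in>A. of_int (c s) *\<^sub>R s)" "y = (\<Sum>s\<in>A. of_int (c' s) *\<^sub>R s)"
    by (auto simp: int_span_def)
  then show "x - y \<in> int_span A"
    unfolding int_span_def by (intro CollectI exI[of _ "\<lambda>s. c s - c' s"])
      (simp add: scaleR_diff_left sum_subtractf)
qed

section \<open>The finite groups of maximal simplices and the orthogonality of their
  characters\<close>

context lattice_fan
begin

text \<open>A maximal simplex spans everything, so its lattice is all of \<open>L\<close> and this
  is the relation behind \<open>H_grp\<close>.\<close>

definition H_rel :: "'i set \<Rightarrow> ('a \<times> 'a) set" where
  "H_rel I = {(a, b). a \<in> L \<and> b \<in> L \<and> a - b \<in> int_span (v ` I)}"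

definition H :: "'i set \<Rightarrow> 'a set set" where
  "H I = L // H_rel I"

lemma equiv_H_rel: "equiv L (H_rel I)"
  unfolding H_rel_def by (rule equiv_subgroup_rel) (rule int_span_subgroup; assumption)+

lemma rep_mem: "h \<in> H I \<Longrightarrow> rep h \<in> h"
  unfolding rep_def H_def using in_quotient_imp_non_empty[OF equiv_H_rel] some_in_eq by blast

lemma rep_mem_L: "h \<in> H I \<Longrightarrow> rep h \<in> L"
  using rep_mem[of h I] in_quotient_imp_subset[OF equiv_H_rel] unfolding H_def by blast

lemma finite_bounded_coords:
  assumes "I \<in> tops"
  shows "finite {l \<in> L. \<forall>i\<in>I. \<bar>d I i \<bullet> l\<bar> \<le> M}"
proof -
  have "norm l \<le> (\<Sum>i\<in>I. M * norm (v i))" if "l \<in> L" "\<forall>i\<in>I. \<bar>d I i \<bullet> l\<bar> \<le> M" for l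
  proof -
    have "norm l = norm (\<Sum>i\<in>I. (d I i \<bullet> l) *\<^sub>R v i)"
      using dual_basis_expansion[OF topsD(4)[OF assms], of l] topsD(5)[OF assms] that(1) by (simp add: span_base)
    also have "\<dots> \<le> (\<Sum>i\<in>I. M * norm (v i))"
      by (rule sum_norm_le) (use that(2) in \<open>auto intro: mult_right_mono\<close>)
    finally show ?thesis .
  qed
  then have "bounded {l \<in> L. \<forall>i\<in>I. \<bar>d I i \<bullet> l\<bar> \<le> M}"
    unfolding bounded_iff by blast
  then have "finite (L \<inter> {l \<in> L. \<forall>i\<in>I. \<bar>d I i \<bullet> l\<bar> \<le> M})" by (rule discrete)
  then show ?thesis by (rule finite_subset[rotated]) auto
qed

lemma int_span_mem_L: "I \<in> S \<Longrightarrow> J \<subseteq> I \<Longrightarrow> (\<Sum>i\<in>J. of_int (m i) *\<^sub>R v i) \<in> L"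
  by (intro sum_mem scale_int_mem) (use edge_mem in auto)

lemma int_span_edges_iff:
  assumes "I \<in> tops"
  shows "x \<in> int_span (v ` I) \<longleftrightarrow> (\<exists>m :: 'i \<Rightarrow> int. x = (\<Sum>i\<in>I. of_int (m i) *\<^sub>R v i))"
  by (rule int_span_family) (use topsD(4)[OF assms] in \<open>simp add: indep_family_def\<close>)

text \<open>Subtracting integral parts leaves a representative with coordinates in
  \<open>[0, 1)\<close>, and \<open>L\<close> has only finitely many such points.\<close>

lemma finite_H:
  assumes I: "I \<in> tops"
  shows "finite (H I)"
proof -
  define fr where "fr l = l - (\<Sum>i\<in>I. of_int \<lfloor>d I i \<bullet> l\<rfloor> *\<^sub>R v i)" for l
  have fr_coord: "d I i \<bullet> fr l = frac (d I i \<bullet> l)" if "i \<in> I" for i l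
    using inner_dual_sum[OF topsD(4)[OF I] that, of I] that by (simp add: fr_def inner_diff_right frac_def)
  have fr_mem: "fr l \<in> L" if "l \<in> L" for l
    unfolding fr_def by (intro diff_mem that int_span_mem_L[of I]) (use topsD[OF I] in auto)
  have fr_rel: "(fr l, l) \<in> H_rel I" if "l \<in> L" for l
  proof -
    have "fr l - l = (\<Sum>i\<in>I. of_int (- \<lfloor>d I i \<bullet> l\<rfloor>) *\<^sub>R v i)"
      by (simp add: fr_def sum_negf)
    then have "fr l - l \<in> int_span (v ` I)"
      unfolding int_span_edges_iff[OF I] by (intro exI[of _ "\<lambda>i. - \<lfloor>d I i \<bullet> l\<rfloor>"])
    then show ?thesis using that fr_mem by (simp add: H_rel_def)
  qed
  let ?B = "{l \<in> L. \<forall>i\<in>I. \<bar>d I i \<bullet> l\<bar> \<le> 1}"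
  have "H I \<subseteq> (\<lambda>l. H_rel I `` {l}) ` ?B"
  proof
    fix h assume "h \<in> H I"
    then obtain l where l: "l \<in> L" "h = H_rel I `` {l}" by (auto simp: H_def quotient_def)
    have "h = H_rel I `` {fr l}"
      using l equiv_class_eq[OF equiv_H_rel fr_rel] by simp
    moreover have "fr l \<in> ?B"
      using l fr_mem fr_coord by (simp add: frac_lt_1 less_imp_le)
    ultimately show "h \<in> (\<lambda>l. H_rel I `` {l}) ` ?B" by blast
  qed
  then show ?thesis using finite_bounded_coords[OF I] finite_surj by blast
qed

lemma H_nonempty: "H I \<noteq> {}"
  using zero_mem by (auto simp: H_def quotient_def)

text \<open>If the character is nontrivial at \<open>l0\<close>, translation by \<open>l0\<close>
  permutes the classes and multiplies the sum by a factor other than 1, which forces the sum to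
  vanish.\<close>

lemma character_sum:
  assumes I: "I \<in> tops" and x: "\<And>j. j \<in> I \<Longrightarrow> x \<bullet> v j \<in> \<int>"
  shows "(\<Sum>h\<in>H I. unit_char (x \<bullet> rep h)) = (if \<forall>l\<in>L. x \<bullet> l \<in> \<int> then of_nat (card (H I)) else 0)"
proof (cases "\<forall>l\<in>L. x \<bullet> l \<in> \<int>")
  case True
  then have "unit_char (x \<bullet> rep h) = 1" if "h \<in> H I" for h
    using rep_mem_L that unit_char_eq_1_iff by blast
  then show ?thesis using True by simp
next
  case False
  then obtain l0 where l0: "l0 \<in> L" "x \<bullet> l0 \<notin> \<int>" by blast
  have int: "x \<bullet> y \<in> \<int>" if y: "y \<in> int_span (v ` I)" for y
  proof -
    obtain m :: "'i \<Rightarrow> int" where "y = (\<Sum>i\<in>I. of_int (m i) *\<^sub>R v i)"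
      using y unfolding int_span_edges_iff[OF I] by blast
    then show ?thesis using x by (auto simp: inner_sum_right intro!: Ints_sum)
  qed
  have cong: "unit_char (x \<bullet> a) = unit_char (x \<bullet> b)" if "(a, b) \<in> H_rel I" for a b
  proof -
    have "x \<bullet> (a - b) \<in> \<int>" using that int by (simp add: H_rel_def)
    then have "unit_char (x \<bullet> b + x \<bullet> (a - b)) = unit_char (x \<bullet> b)"
      by (simp only: unit_char_add unit_char_eq_1_iff[THEN iffD2] mult_1_right)
    then show ?thesis by (simp add: inner_diff_right)
  qed
  define \<tau> where "\<tau> h = H_rel I `` {rep h + l0}" for h
  have \<tau>_mem: "\<tau> h \<in> H I" if "h \<in> H I" for h
    unfolding \<tau>_def H_def using add_mem[OF rep_mem_L[OF that] l0(1)] by (rule quotientI)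
  have "inj_on \<tau> (H I)"
  proof (rule inj_onI)
    fix h h' assume h: "h \<in> H I" "h' \<in> H I" "\<tau> h = \<tau> h'"
    have "(rep h + l0, rep h' + l0) \<in> H_rel I"
      using h(3) eq_equiv_class[OF _ equiv_H_rel] add_mem[OF rep_mem_L[OF h(2)] l0(1)] unfolding \<tau>_def by blast
    then have "(rep h, rep h') \<in> H_rel I"
      using rep_mem_L h by (simp add: H_rel_def)
    then show "h = h'"
      using quotient_eqI[OF equiv_H_rel, of h I h' "rep h" "rep h'"] h rep_mem unfolding H_def by blast
  qed
  then have bij: "bij_betw \<tau> (H I) (H I)"
    using \<tau>_mem finite_H[OF I] by (simp add: bij_betw_def endo_inj_surj image_subsetI)
  have step: "unit_char (x \<bullet> rep (\<tau> h)) = unit_char (x \<bullet> l0) * unit_char (x \<bullet> rep h)" if "h \<in> H I" for h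
  proof -
    have "(rep h + l0, rep (\<tau> h)) \<in> H_rel I"
      using rep_mem[OF \<tau>_mem[OF that]] unfolding \<tau>_def by blast
    from cong[OF this] show ?thesis by (simp add: inner_add_right unit_char_add mult.commute)
  qed
  have "(\<Sum>h\<in>H I. unit_char (x \<bullet> rep h)) = (\<Sum>h\<in>H I. unit_char (x \<bullet> rep (\<tau> h)))"
    using sum.reindex_bij_betw[OF bij, of "\<lambda>h. unit_char (x \<bullet> rep h)"] by simp
  also have "\<dots> = unit_char (x \<bullet> l0) * (\<Sum>h\<in>H I. unit_char (x \<bullet> rep h))"
    by (simp add: sum_distrib_left step)
  finally have "(unit_char (x \<bullet> l0) - 1) * (\<Sum>h\<in>H I. unit_char (x \<bullet> rep h)) = 0"
    by (simp add: algebra_simps)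
  then show ?thesis using False l0(2) unit_char_eq_1_iff by auto
qed

end

lemma single_prod:
  "Poly_Mapping.single (0 :: 'e::comm_monoid_add) (\<Prod>i\<in>A. f i :: 'r::comm_semiring_1) = (\<Prod>i\<in>A. Poly_Mapping.single 0 (f i))"
  by (induction A rule: infinite_finite_induct) (simp_all add: mult_single[of 0 _ 0, simplified, symmetric])

lemma single_sum: "Poly_Mapping.single a (\<Sum>i\<in>A. f i) = (\<Sum>i\<in>A. Poly_Mapping.single a (f i))"
  by (induction A rule: infinite_finite_induct) (simp_all add: Poly_Mapping.single_add)

section \<open>Expansion of the contribution of one maximal simplex\<close>

context lattice_fan
begin

text \<open>The factors run along independent directions \<open>- d I j\<close>, so the coefficient
  at an exponent \<open>x\<close> splits into one factor for each degree
  \<open>- (x \<bullet> v j)\<close>. A direction not yet multiplied in contributes a Kronecker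
  delta, and the restriction to \<open>span L\<close> excludes exponents not detected by these
  degrees.\<close>

lemma factor_product_expansion:
  assumes I: "I \<in> tops" and "J \<subseteq> I"
  shows "expansion
     (\<Prod>j\<in>J. (1 + Fract (Poly_Mapping.single 0 \<rho>) 1 * const (unit_char (- \<theta> j)) * t_exp (- d I j)) /
              (1 - const (unit_char (- \<theta> j)) * t_exp (- d I j)))
     (\<lambda>x. if vec_of_exponent x \<in> span L
          then \<Prod>j\<in>I. if j \<in> J then twisted_coeff \<rho> (s j) (\<theta> j) (- (vec_of_exponent x \<bullet> v j))
                       else of_bool (vec_of_exponent x \<bullet> v j = 0)
          else 0)"
  (is "expansion (?Q J) (?F J)")
proof -
  have "finite J" using assms topsD(2) finite_subset by blast
  then show ?thesis using assms(2)
  proof (induction J rule: finite_induct)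
    case empty
    have zero: "x = 0" if "vec_of_exponent x \<in> span L" "\<forall>j\<in>I. vec_of_exponent x \<bullet> v j = 0" for x
    proof -
      have "vec_of_exponent x = 0"
        by (rule span_orthogonal_eqI[of _ "v ` I"]) (use that topsD(5)[OF I] in \<open>auto simp: span_zero\<close>)
      then show ?thesis by (metis zero_exponent_def vec_of_exponent_inverse)
    qed
    have "?F {} = Poly_Mapping.lookup 1"
    proof
      fix x :: "'a exponent"
      show "?F {} x = Poly_Mapping.lookup 1 x"
      proof (cases "x = 0")
        case True
        then show ?thesis by (simp add: zero_exponent_def Exponent_inverse span_zero lookup_one when_def)
      next
        case False
        then have "vec_of_exponent x \<notin> span L \<or> (\<exists>j\<in>I. vec_of_exponent x \<bullet> v j \<noteq> 0)" using zero by blast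
        then have "?F {} x = 0" using topsD(2)[OF I] by (auto intro!: prod_zero)
        then show ?thesis using False by (simp add: lookup_one)
      qed
    qed
    then show ?case using expansion_lookup[of 1] by (simp add: fract_collapse)
  next
    case (insert j J)
    then have j: "j \<in> I" "j \<notin> J" and IH: "expansion (?Q J) (?F J)" by auto
    define a where "a = Exponent (- d I j)"
    define c where "c = Poly_Mapping.single (0::real) (unit_char (- \<theta> j))"
    define z where "z = Poly_Mapping.single a c"
    have vec_shift: "vec_of_exponent (x - a) = vec_of_exponent x + d I j" for x
      by (simp add: a_def minus_exponent_def Exponent_inverse)
    have zQ: "const (unit_char (- \<theta> j)) * t_exp (- d I j) = Fract z 1"
      by (simp add: const_def t_exp_def z_def a_def c_def mult_single)
    have "a \<noteq> 0"
    proof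
      assume "a = 0"
      then have "- d I j = 0" unfolding a_def zero_exponent_def by (simp add: Exponent_inject)
      then show False using dual_nonzero[OF I j(1)] by simp
    qed
    then have nz: "1 - z \<noteq> 0"
      by (auto simp: z_def lookup_minus lookup_single lookup_one dest!: arg_cong[where f="\<lambda>p. Poly_Mapping.lookup p 0"])
    have "act (1 - z) (?F (insert j J)) x = act (1 + Poly_Mapping.single 0 \<rho> * z) (?F J) x" for x
    proof (cases "vec_of_exponent x \<in> span L")
      case False
      then have "vec_of_exponent (x - a) \<notin> span L"
        unfolding vec_shift using dual_in_span[OF I j(1)] span_add_eq2 by blast
      then show ?thesis using False
        by (simp add: z_def act_add_left act_diff_left act_1 act_mult act_single)
    next
      case True
      let ?k = "- (vec_of_exponent x \<bullet> v j)"
      let ?P = "\<Prod>i\<in>I - {j}. if i \<in> J then twisted_coeff \<rho> (s i) (\<theta> i) (- (vec_of_exponent x \<bullet> v i))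
                       else of_bool (vec_of_exponent x \<bullet> v i = 0)"
      have in_span: "vec_of_exponent (x - a) \<in> span L"
        unfolding vec_shift using dual_in_span[OF I j(1)] True by (rule span_add[rotated])
      \<comment> \<open>Translation by \<open>- d I j\<close> changes only the degree in direction
        \<open>j\<close>; this reduces the claim to the recurrence for a single factor.\<close>
      have other: "vec_of_exponent (x - a) \<bullet> v i = vec_of_exponent x \<bullet> v i" if "i \<in> I - {j}" for i
        using that dual_inner[OF I j(1), of i] by (simp add: vec_shift inner_add_left)
      have own: "vec_of_exponent (x - a) \<bullet> v j = vec_of_exponent x \<bullet> v j + 1"
        using dual_inner[OF I j(1) j(1)] by (simp add: vec_shift inner_add_left)
      have split: "?F J' y = (if j \<in> J' then twisted_coeff \<rho> (s j) (\<theta> j) (- (vec_of_exponent y \<bullet> v j))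
          else of_bool (vec_of_exponent y \<bullet> v j = 0)) * ?P"
        if "vec_of_exponent y \<in> span L" "J' \<in> {J, insert j J}" "y \<in> {x, x - a}" for J' y
      proof -
        have "(\<Prod>i\<in>I - {j}. if i \<in> J' then twisted_coeff \<rho> (s i) (\<theta> i) (- (vec_of_exponent y \<bullet> v i))
            else of_bool (vec_of_exponent y \<bullet> v i = 0)) = ?P"
          by (rule prod.cong) (use that other in auto)
        then show ?thesis
          using that(1) by (simp add: prod.remove[OF topsD(2)[OF I] j(1)])
      qed
      have F1: "?F (insert j J) x = twisted_coeff \<rho> (s j) (\<theta> j) ?k * ?P"
        by (subst split) (use True in auto)
      have F2: "?F (insert j J) (x - a) = twisted_coeff \<rho> (s j) (\<theta> j) (?k - 1) * ?P"
        by (subst split) (use in_span own in auto)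
      have F3: "?F J x = of_bool (?k = 0) * ?P"
        by (subst split) (use True j in auto)
      have "vec_of_exponent (x - a) \<bullet> v j = 0 \<longleftrightarrow> ?k = 1" using own by linarith
      then have F4: "?F J (x - a) = of_bool (?k = 1) * ?P"
        by (subst split) (use in_span j in auto)
      have "act (1 - z) (?F (insert j J)) x = ?F (insert j J) x - c * ?F (insert j J) (x - a)"
        by (simp only: z_def act_diff_left act_1 act_single)
      also have "\<dots> = (twisted_coeff \<rho> (s j) (\<theta> j) ?k - c * twisted_coeff \<rho> (s j) (\<theta> j) (?k - 1)) * ?P"
        unfolding F1 F2 by (simp only: left_diff_distrib mult.assoc)
      also have "\<dots> = (of_bool (?k = 0) + \<rho> * c * of_bool (?k = 1)) * ?P"
        unfolding c_def twisted_coeff_recurrence by (simp only: of_bool_def)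
      also have "\<dots> = ?F J x + \<rho> * c * ?F J (x - a)"
        unfolding F3 F4 by (simp only: distrib_right mult.assoc)
      also have "\<dots> = act (1 + Poly_Mapping.single 0 \<rho> * z) (?F J) x"
        by (simp only: z_def mult_single act_add_left act_1 act_single add_0)
      finally show ?thesis .
    qed
    then have shift: "act (1 - z) (?F (insert j J)) = act (1 + Poly_Mapping.single 0 \<rho> * z) (?F J)" ..
    have "expansion (Fract (1 + Poly_Mapping.single 0 \<rho> * z) 1 * ?Q J / Fract (1 - z) 1) (?F (insert j J))"
      by (rule expansion_divide[OF expansion_mult[OF IH] shift nz])
    also have "Fract (1 + Poly_Mapping.single 0 \<rho> * z) 1 * ?Q J / Fract (1 - z) 1 = ?Q (insert j J)"
    proof -
      have "Fract (1 + Poly_Mapping.single 0 \<rho> * z) 1 = 1 + Fract (Poly_Mapping.single 0 \<rho>) 1 * Fract z 1"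
        "Fract (1 - z) 1 = 1 - Fract z 1"
        by (simp_all add: One_fract_def)
      then show ?thesis
        using insert.hyps by (simp add: mult.assoc zQ)
    qed
    finally show ?case .
  qed
qed

lemma unit_char_coord_product:
  assumes I: "I \<in> tops" and x: "x \<in> span L" and h: "h \<in> H I"
  shows "(\<Prod>j\<in>I. unit_char ((x \<bullet> v j) * (d I j \<bullet> rep h))) = unit_char (x \<bullet> rep h)"
proof -
  have "rep h \<in> span (v ` I)"
    using rep_mem_L[OF h] topsD(5)[OF I] by (simp add: span_base)
  from inner_eq_sum_dual[OF topsD(4)[OF I] this, of x] show ?thesis
    by (simp add: unit_char_sum mult.commute)
qed

text \<open>At a fixed exponent \<open>x\<close> the twists of all directions combine to the
  character \<open>unit_char (x \<bullet> rep h)\<close>. Averaging over \<open>H I\<close> keeps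
  the exponents that are integral on all of \<open>L\<close> and removes the others, so the
  condition on the surviving exponents is the same for every maximal simplex.\<close>

lemma top_term_expansion:
  assumes I: "I \<in> tops"
  shows "expansion
    (of_int m / of_nat (card (H I)) * (\<Sum>h\<in>H I. \<Prod>j\<in>I.
        (1 + Fract (Poly_Mapping.single 0 \<rho>) 1 * const (inverse (chi (d I j) h)) * t_exp (- d I j)) /
        (1 - const (inverse (chi (d I j) h)) * t_exp (- d I j))))
    (\<lambda>x. if vec_of_exponent x \<in> span L \<and> (\<forall>l\<in>L. vec_of_exponent x \<bullet> l \<in> \<int>)
          then of_int m * (\<Prod>j\<in>I. gen_coeff \<rho> (s j) (- (vec_of_exponent x \<bullet> v j))) else 0)"
    (is "expansion _ ?f")
proof -
  let ?N = "card (H I)"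
  have N: "?N \<noteq> 0" using finite_H[OF I] H_nonempty by simp
  have chi: "inverse (chi (d I j) h) = unit_char (- (d I j \<bullet> rep h))" for j h
    by (simp add: chi_def unit_char_def exp_minus)
  let ?Q = "\<lambda>h. \<Prod>j\<in>I. (1 + Fract (Poly_Mapping.single 0 \<rho>) 1 * const (inverse (chi (d I j) h)) * t_exp (- d I j)) /
        (1 - const (inverse (chi (d I j) h)) * t_exp (- d I j))"
  let ?F = "\<lambda>h x. if vec_of_exponent x \<in> span L
      then \<Prod>j\<in>I. twisted_coeff \<rho> (s j) (d I j \<bullet> rep h) (- (vec_of_exponent x \<bullet> v j)) else 0"
  have "expansion (?Q h) (?F h)" for h
  proof -
    have "(\<lambda>x. if vec_of_exponent x \<in> span L
        then \<Prod>j\<in>I. if j \<in> I then twisted_coeff \<rho> (s j) (d I j \<bullet> rep h) (- (vec_of_exponent x \<bullet> v j))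
                     else of_bool (vec_of_exponent x \<bullet> v j = 0) else 0) = ?F h"
      by (intro ext if_cong prod.cong refl) simp
    then show ?thesis
      unfolding chi using factor_product_expansion[OF I order_refl, of \<rho> "\<lambda>j. d I j \<bullet> rep h" s] by (simp only:)
  qed
  then have sum: "expansion (\<Sum>h\<in>H I. ?Q h) (\<lambda>x. \<Sum>h\<in>H I. ?F h x)"
    by (rule expansion_sum)
  have avg: "of_int m * (\<Sum>h\<in>H I. ?F h x) = of_nat ?N * ?f x" for x
  proof (cases "vec_of_exponent x \<in> span L")
    case False
    then show ?thesis by simp
  next
    case True
    let ?x = "vec_of_exponent x"
    show ?thesis
    proof (cases "\<forall>j\<in>I. ?x \<bullet> v j \<in> \<int>")
      case False
      then obtain j where j: "j \<in> I" "?x \<bullet> v j \<notin> \<int>" by blast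
      then have "?F h x = 0" for h
        using topsD(2)[OF I] by (auto simp: twisted_coeff_def minus_in_Ints_iff intro!: prod_zero)
      then have "(\<Sum>h\<in>H I. ?F h x) = 0" by (intro sum.neutral ballI)
      moreover have "\<not> (\<forall>l\<in>L. ?x \<bullet> l \<in> \<int>)"
        using j edge_mem[OF topsD(1)[OF I] j(1)] by blast
      ultimately show ?thesis by (simp only: simp_thms if_False mult_zero_right)
    next
      case int: True
      let ?P = "\<Prod>j\<in>I. gen_coeff \<rho> (s j) (- (?x \<bullet> v j))"
      have "?F h x = Poly_Mapping.single 0 (unit_char (?x \<bullet> rep h)) * ?P" if "h \<in> H I" for h
      proof -
        have "?F h x = (\<Prod>j\<in>I. Poly_Mapping.single 0 (unit_char ((?x \<bullet> v j) * (d I j \<bullet> rep h)))) * ?P"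
          using True int by (simp add: twisted_coeff_def minus_in_Ints_iff prod.distrib cong: prod.cong)
        also have "(\<Prod>j\<in>I. Poly_Mapping.single (0::real) (unit_char ((?x \<bullet> v j) * (d I j \<bullet> rep h)))) =
            Poly_Mapping.single 0 (\<Prod>j\<in>I. unit_char ((?x \<bullet> v j) * (d I j \<bullet> rep h)))"
          by (rule single_prod[symmetric])
        finally show ?thesis unfolding unit_char_coord_product[OF I True that] .
      qed
      then have "(\<Sum>h\<in>H I. ?F h x) = (\<Sum>h\<in>H I. Poly_Mapping.single 0 (unit_char (?x \<bullet> rep h))) * ?P"
        by (simp only: sum_distrib_right cong: sum.cong)
      also have "(\<Sum>h\<in>H I. Poly_Mapping.single (0::real) (unit_char (?x \<bullet> rep h))) =
          Poly_Mapping.single 0 (\<Sum>h\<in>H I. unit_char (?x \<bullet> rep h))"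
        by (rule single_sum[symmetric])
      also have "\<dots> = (if \<forall>l\<in>L. ?x \<bullet> l \<in> \<int> then of_nat ?N else 0)"
        using character_sum[OF I, of ?x] int by simp
      finally show ?thesis using True by (simp add: mult.left_commute)
    qed
  qed
  have "act (of_nat ?N) ?f = act (of_int m) (\<lambda>x. \<Sum>h\<in>H I. ?F h x)"
    by (simp only: fun_eq_iff act_of_nat act_of_int avg simp_thms)
  from expansion_divide[OF expansion_mult[OF sum, of "of_int m"] this]
  have "expansion (Fract (of_int m) 1 * (\<Sum>h\<in>H I. ?Q h) / Fract (of_nat ?N) 1) ?f"
    using N by simp
  then show ?thesis by (simp only: Fract_of_int_eq Fract_of_nat_eq times_divide_eq_left)
qed

end

context complete_lattice_fan
begin

theorem genus_sum:
  assumes y: "regular y"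
  shows "(\<Sum>I\<in>tops. of_int (w I) / of_nat (card (H I)) * (\<Sum>h\<in>H I. \<Prod>j\<in>I.
        (1 + Fract (Poly_Mapping.single 0 \<rho>) 1 * const (inverse (chi (d I j) h)) * t_exp (- d I j)) /
        (1 - const (inverse (chi (d I j) h)) * t_exp (- d I j)))) =
    Fract (Poly_Mapping.single 0 (\<Sum>I\<in>tops. of_int (w I) * (- \<rho>) ^ neg {} y I)) 1" (is "?Q = _")
proof -
  let ?P = "\<lambda>z x I. \<Prod>j\<in>I. gen_coeff \<rho> (d I j \<bullet> z > 0) (- (x \<bullet> v j))"
  let ?f = "\<lambda>z x. \<Sum>I\<in>tops. if x \<in> span L \<and> (\<forall>l\<in>L. x \<bullet> l \<in> \<int>) then of_int (w I) * ?P z x I else 0"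
  have exp: "expansion ?Q (\<lambda>x. ?f y (vec_of_exponent x))"
    by (rule expansion_sum, rule top_term_expansion)
  \<comment> \<open>\<open>gen_coeff\<close> is a constant \<alpha> plus \<open>1 + \<rho>\<close>
    at positive coordinates, so \<open>star_sum_regular\<close> applies at each exponent
    separately.\<close>
  have indep: "(\<Sum>I\<in>tops. of_int (w I) * ?P z x I) = (\<Sum>I\<in>tops. of_int (w I) * ?P y x I)" if "regular z" for z x
    using star_sum_regular[of "{}" z y "\<lambda>j. neg_coeff \<rho> (- (x \<bullet> v j))" "1 + \<rho>"] that y
    by (simp add: gen_coeff_def)
  have "?f y (vec_of_exponent x) =
      Poly_Mapping.lookup (Poly_Mapping.single 0 (\<Sum>I\<in>tops. of_int (w I) * (- \<rho>) ^ neg {} y I)) x" for x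
  proof (cases "x = 0")
    case True
    have "?P y 0 I = (- \<rho>) ^ neg {} y I" if "I \<in> tops" for I
    proof -
      have "?P y 0 I = (\<Prod>j\<in>I. if d I j \<bullet> y < 0 then - \<rho> else 1)"
        by (rule prod.cong) (use regular_pos_iff[OF y that] in \<open>auto simp: gen_coeff_0\<close>)
      also have "\<dots> = (\<Prod>j | j \<in> I \<and> d I j \<bullet> y < 0. - \<rho>)"
        by (rule prod.inter_filter[symmetric]) (use topsD(2)[OF that] in simp)
      finally show ?thesis by (simp add: neg_def)
    qed
    then show ?thesis using True
      by (simp add: zero_exponent_def Exponent_inverse span_zero)
  next
    case False
    let ?x = "vec_of_exponent x"
    have x0: "?x \<noteq> 0"
      using False by (metis zero_exponent_def vec_of_exponent_inverse)
    have "?f y ?x = 0"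
    proof (cases "?x \<in> span L")
      case True
      \<comment> \<open>Expand in a direction \<open>z\<close> on which the exponent is positive. A
        nonzero coefficient would make every product
        \<open>(d I j \<bullet> z) * (?x \<bullet> v j)\<close> nonpositive, while these products
        add up to \<open>?x \<bullet> z\<close>.\<close>
      obtain z where z: "regular z" "?x \<bullet> z > 0"
        using perturb_regular[OF True y, of "{?x}"] x0 by (auto simp: sgn_1_pos)
      have "?P z ?x I = 0" if I: "I \<in> tops" for I
      proof (rule ccontr)
        assume "?P z ?x I \<noteq> 0"
        then have nz: "gen_coeff \<rho> (d I j \<bullet> z > 0) (- (?x \<bullet> v j)) \<noteq> 0" if "j \<in> I" for j
          using that topsD(2)[OF I] by (auto simp: prod_zero_iff)
        have "(d I j \<bullet> z) * (?x \<bullet> v j) \<le> 0" if "j \<in> I" for j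
          using gen_coeff_nonzero[OF nz[OF that]]
          by (auto simp: mult_le_0_iff split: if_splits)
        then have "(\<Sum>j\<in>I. (d I j \<bullet> z) * (?x \<bullet> v j)) \<le> 0"
          by (rule sum_nonpos)
        moreover have "z \<in> span (v ` I)" using z(1) topsD(5)[OF I] by (simp add: regular_def)
        ultimately show False
          using z(2) inner_eq_sum_dual[OF topsD(4)[OF I], of z ?x] by simp
      qed
      then have "(\<Sum>I\<in>tops. of_int (w I) * ?P y ?x I) = 0"
        unfolding indep[OF z(1), symmetric] by simp
      moreover have "?f y ?x = (\<Sum>I\<in>tops. of_int (w I) * ?P y ?x I)" if "\<forall>l\<in>L. ?x \<bullet> l \<in> \<int>"
        by (intro sum.cong refl if_P conjI True that)
      moreover have "?f y ?x = 0" if "\<not> (\<forall>l\<in>L. ?x \<bullet> l \<in> \<int>)"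
        by (intro sum.neutral ballI if_not_P) (use that in blast)
      ultimately show ?thesis by metis
    qed simp
    then show ?thesis using False by (simp add: lookup_single)
  qed
  then show ?thesis
    using exp by (intro expansion_finite_unique) simp
qed

end

section \<open>Fans of degree one\<close>

context lattice_fan
begin

lemma edge_in_span: "I \<in> S \<Longrightarrow> i \<in> I \<Longrightarrow> v i \<in> span L"
  using edge_mem span_base by blast

lemma edge_sum_in_span: "I \<in> S \<Longrightarrow> J \<subseteq> I \<Longrightarrow> (\<Sum>j\<in>J. c j *\<^sub>R v j) \<in> span L"
  by (intro span_sum span_scale) (use edge_in_span in blast)

lemma dual_inner_sum: "I \<in> tops \<Longrightarrow> i \<in> I \<Longrightarrow> J \<subseteq> I \<Longrightarrow> d I i \<bullet> (\<Sum>j\<in>J. c j *\<^sub>R v j) = (if i \<in> J then c i else 0)"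
  using inner_dual_sum[OF topsD(4)] by metis

lemma dual_inner_edges: "I \<in> tops \<Longrightarrow> i \<in> I \<Longrightarrow> J \<subseteq> I \<Longrightarrow> d I i \<bullet> (\<Sum>j\<in>J. v j) = (if i \<in> J then 1 else 0)"
  using dual_inner_sum[of I i J "\<lambda>_. 1"] by simp

lemma edges_in_span: "I \<in> S \<Longrightarrow> J \<subseteq> I \<Longrightarrow> (\<Sum>j\<in>J. v j) \<in> span L"
  using edge_sum_in_span[of I J "\<lambda>_. 1"] by simp

lemma coords_eqI:
  assumes "I \<in> tops" "x \<in> span L" "y \<in> span L" "\<And>i. i \<in> I \<Longrightarrow> d I i \<bullet> x = d I i \<bullet> y"
  shows "x = y"
proof -
  have "(\<Sum>i\<in>I. (d I i \<bullet> z) *\<^sub>R v i) = z" if "z \<in> span L" for z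
    using dual_basis_expansion[OF topsD(4)[OF assms(1)]] that topsD(5)[OF assms(1)] by simp
  from this[OF assms(2)] this[OF assms(3)]
  have "x = (\<Sum>i\<in>I. (d I i \<bullet> x) *\<^sub>R v i)" "y = (\<Sum>i\<in>I. (d I i \<bullet> y) *\<^sub>R v i)"
    by (simp_all only:)
  moreover have "(\<Sum>i\<in>I. (d I i \<bullet> x) *\<^sub>R v i) = (\<Sum>i\<in>I. (d I i \<bullet> y) *\<^sub>R v i)"
    using assms(4) by simp
  ultimately show ?thesis by simp
qed

text \<open>
  The witness is a point in the relative interior of the cone over \<open>K\<close>, moved slightly in the
  direction \<open>y\<close>.
\<close>

lemma near_face:
  assumes "K \<in> S" "regular y"
  shows "\<exists>x. regular x \<and> (\<forall>I\<in>star K. (\<forall>i\<in>K. d I i \<bullet> x > 0) \<and>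
    (\<forall>i\<in>I - K. (d I i \<bullet> x > 0 \<longleftrightarrow> d I i \<bullet> y > 0) \<and> (d I i \<bullet> x < 0 \<longleftrightarrow> d I i \<bullet> y < 0)))"
proof -
  let ?p = "\<Sum>i\<in>K. v i"
  have "?p \<in> span L" using edges_in_span[OF assms(1)] by blast
  from perturb_regular[OF this assms(2), of "{}"] obtain x where x: "regular x"
    "\<forall>I\<in>tops. \<forall>i\<in>I. sgn (d I i \<bullet> x) = (if d I i \<bullet> ?p \<noteq> 0 then sgn (d I i \<bullet> ?p) else sgn (d I i \<bullet> y))"
    by blast
  show ?thesis
  proof (intro exI[of _ x] conjI ballI x(1))
    fix I i assume I: "I \<in> star K"
    note ID = starD[OF I]
    show "d I i \<bullet> x > 0" if "i \<in> K"
      using x(2)[rule_format, OF ID(1), of i] dual_inner_edges[OF ID(1) _ ID(2), of i] ID(2) that by (auto simp: sgn_1_pos)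
    have sg: "sgn (d I i \<bullet> x) = sgn (d I i \<bullet> y)" if "i \<in> I - K"
      using x(2)[rule_format, OF ID(1), of i] dual_inner_edges[OF ID(1) _ ID(2), of i] that by auto
    show "d I i \<bullet> x > 0 \<longleftrightarrow> d I i \<bullet> y > 0" if "i \<in> I - K" using sg[OF that] by (metis sgn_greater)
    show "d I i \<bullet> x < 0 \<longleftrightarrow> d I i \<bullet> y < 0" if "i \<in> I - K" using sg[OF that] by (metis sgn_less)
  qed
qed

end

text \<open>With all weights equal to 1, the Todd genus counts the maximal cones containing a
  generic vector; \<open>degree_one\<close> is the form in which it enters.\<close>

locale unit_fan = complete_lattice_fan L S n v w
  for L :: "'a::euclidean_space set" and S :: "'i set set" and n and v :: "'i \<Rightarrow> 'a" and w +
  assumes weight_one: "I \<in> tops \<Longrightarrow> w I = 1"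
    and degree_one: "regular x \<Longrightarrow> card {I \<in> tops. \<forall>i\<in>I. d I i \<bullet> x > 0} = 1"
    and n_pos: "n \<ge> 1"
begin

lemma sum_weight: "A \<subseteq> tops \<Longrightarrow> (\<Sum>I\<in>A. w I) = int (card A)"
  by (subst sum.cong[where B=A and h="\<lambda>_. 1"]) (use weight_one in auto)

text \<open>Vectors close to the interior of the cone over \<open>K\<close> see only its star, so
  the degree of the link is at most the degree of the fan. It is not zero, because some vector does
  lie in a cone of the link, and it is the same for all regular vectors.\<close>

lemma link_degree_one:
  assumes "K \<in> S" "regular y"
  shows "card {I \<in> star K. \<forall>i\<in>I - K. d I i \<bullet> y > 0} = 1"
proof -
  let ?A = "\<lambda>y. {I \<in> star K. \<forall>i\<in>I - K. d I i \<bullet> y > 0}"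
  have sub: "?A y \<subseteq> tops" for y by (auto simp: star_def)
  have fin: "finite (?A y)" for y using finite_star by simp
  have le: "card (?A y) \<le> 1" if "regular y" for y
  proof -
    obtain x where x: "regular x" "\<forall>I\<in>star K. \<forall>i\<in>K. d I i \<bullet> x > 0"
      "\<forall>I\<in>star K. \<forall>i\<in>I - K. d I i \<bullet> x > 0 \<longleftrightarrow> d I i \<bullet> y > 0"
      using near_face[OF assms(1) \<open>regular y\<close>] by blast
    have "?A y \<subseteq> {I \<in> tops. \<forall>i\<in>I. d I i \<bullet> x > 0}"
    proof clarsimp
      fix I assume I: "I \<in> star K" "\<forall>i\<in>I - K. d I i \<bullet> y > 0"
      have "d I i \<bullet> x > 0" if "i \<in> I" for i
        using x(2,3) I that by blast
      then show "I \<in> tops \<and> (\<forall>i\<in>I. d I i \<bullet> x > 0)" using starD[OF I(1)] by blast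
    qed
    then have "card (?A y) \<le> card {I \<in> tops. \<forall>i\<in>I. d I i \<bullet> x > 0}"
      by (rule card_mono[rotated]) (simp add: finite_tops)
    then show ?thesis using degree_one[OF x(1)] by simp
  qed
  obtain I where I: "I \<in> star K" using star_nonempty[OF assms(1)] by blast
  \<comment> \<open>Taking \<open>I\<close> itself as the face puts \<open>z\<close> into the
    interior of the cone over \<open>I\<close>.\<close>
  obtain z where z: "regular z" "\<forall>J\<in>star I. \<forall>i\<in>I. d J i \<bullet> z > 0"
    using near_face[OF topsD(1)[OF starD(1)[OF I]] assms(2)] by blast
  have "I \<in> ?A z" using I z(2) starD(1)[OF I] by (auto simp: star_def)
  then have "card (?A z) \<noteq> 0" unfolding card_0_eq[OF fin] by blast
  moreover have "card (?A y) = card (?A z)"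
    using complete[OF assms(1) assms(2) z(1)] sum_weight[OF sub] by simp
  ultimately show ?thesis using le[OF assms(2)] by simp
qed

text \<open>The h-numbers of the projected multi-fan at \<open>K\<close>, with negative instead of
  positive coordinates counted; by \<open>h_eq\<close> any regular vector gives the same
  value.\<close>

definition h :: "'i set \<Rightarrow> nat \<Rightarrow> nat" where
  "h K k = card {I \<in> star K. neg K (SOME x. regular x) I = k}"

lemma h_eq:
  assumes "K \<in> S" "regular x"
  shows "h K k = card {I \<in> star K. neg K x I = k}"
proof -
  have "regular (SOME x. regular x)" using exists_regular by (rule someI_ex)
  from weight_neg_regular[OF finite_simplex[OF assms(1)] this assms(2), of k] show ?thesis
    unfolding h_def by (subst (asm) (1 2) sum_weight) (auto simp: star_def)
qed

lemma neg_eq_0_iff: "regular x \<Longrightarrow> I \<in> star K \<Longrightarrow> neg K x I = 0 \<longleftrightarrow> (\<forall>i\<in>I - K. d I i \<bullet> x > 0)"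
  using starD(1) topsD(2) regular_pos_iff by (fastforce simp: neg_def)

lemma h_0: "K \<in> S \<Longrightarrow> h K 0 = 1"
  using exists_regular link_degree_one[of K] by (auto simp: h_eq neg_eq_0_iff cong: conj_cong)

lemma empty_in_S: "{} \<in> S"
proof -
  obtain x where "regular x" using exists_regular by blast
  from degree_one[OF this] obtain I where "I \<in> tops" by (auto simp: card_1_singleton_iff)
  then show ?thesis using topsD(1) subset_closed by blast
qed

text \<open>Take a face \<open>K'\<close> of size \<open>n - k\<close> above \<open>K\<close>. Its
  link has degree one also at \<open>- y\<close>, which gives a maximal simplex whose link
  coordinates at \<open>y\<close> are all negative. For a vector near \<open>K'\<close>, moved
  towards \<open>y\<close>, precisely these \<open>k\<close> coordinates are negative.\<close>

lemma h_positive: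
  assumes K: "K \<in> S" and k: "k \<le> n - card K"
  shows "h K k \<ge> 1"
proof -
  obtain I1 where I1: "I1 \<in> star K" using star_nonempty[OF K] by blast
  have "card (I1 - K) = n - card K"
    using starD[OF I1] topsD(2,3)[OF starD(1)[OF I1]] by (simp add: card_Diff_subset)
  then obtain B where B: "B \<subseteq> I1 - K" "card B = k"
    using k by (metis obtain_subset_with_card_n)
  define K' where "K' = I1 - B"
  have K': "K \<subseteq> K'" "K' \<in> S" "card K' = n - k"
  proof -
    have I1': "K \<subseteq> I1" "I1 \<in> S" "finite I1" "card I1 = n"
      using starD[OF I1] topsD(1-3)[OF starD(1)[OF I1]] by auto
    show "K \<subseteq> K'" "K' \<in> S" using B I1' subset_closed by (auto simp: K'_def)
    have "finite B" "B \<subseteq> I1" using B I1' by (auto intro: finite_subset)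
    then show "card K' = n - k" using B I1' by (simp add: K'_def card_Diff_subset)
  qed
  have kn: "k \<le> n" using k by simp
  obtain y where y: "regular y" using exists_regular by blast
  obtain I where I: "I \<in> star K'" "\<forall>i\<in>I - K'. d I i \<bullet> y < 0"
    using link_degree_one[OF K'(2) regular_uminus[OF y]] by (auto simp: card_1_singleton_iff)
  obtain x where x: "regular x" "\<forall>I\<in>star K'. \<forall>i\<in>K'. d I i \<bullet> x > 0"
      "\<forall>I\<in>star K'. \<forall>i\<in>I - K'. d I i \<bullet> x < 0 \<longleftrightarrow> d I i \<bullet> y < 0"
    using near_face[OF K'(2) y] by blast
  have "{i \<in> I - K. d I i \<bullet> x < 0} = I - K'"
  proof -
    have "d I i \<bullet> x < 0" if "i \<in> I - K'" for i using x(3) I that by blast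
    moreover have "\<not> d I i \<bullet> x < 0" if "i \<in> K'" for i using x(2) I(1) that by fastforce
    ultimately show ?thesis using K'(1) by blast
  qed
  then have "neg K x I = k"
    using I(1) K'(3) kn starD[OF I(1)] topsD(2,3)[OF starD(1)[OF I(1)]] by (simp add: neg_def card_Diff_subset)
  then have "I \<in> {I \<in> star K. neg K x I = k}"
    using I(1) K'(1) by (auto simp: star_def)
  then show ?thesis
  proof -
    have "finite {I \<in> star K. neg K x I = k}" using finite_star by simp
    with \<open>I \<in> {I \<in> star K. neg K x I = k}\<close> have "card {I \<in> star K. neg K x I = k} \<noteq> 0"
      unfolding card_0_eq[OF \<open>finite {I \<in> star K. neg K x I = k}\<close>] by blast
    then show ?thesis unfolding h_eq[OF K x(1)] by simp
  qed
qed

section \<open>Vertex counts and h-numbers\<close>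

definition V :: "'i set" where "V = {i. {i} \<in> S}"

lemma finite_V: "finite V"
proof -
  have "V \<subseteq> \<Union> S" by (auto simp: V_def)
  then show ?thesis using finite_S finite_simplex by (meson finite_Union finite_subset)
qed

lemma subset_V: "I \<in> S \<Longrightarrow> I \<subseteq> V"
  using subset_closed by (auto simp: V_def)

lemma neg_le: "I \<in> tops \<Longrightarrow> neg {} x I \<le> n"
  using topsD(2,3)[of I] by (metis (no_types, lifting) card_mono neg_def Diff_empty mem_Collect_eq subsetI)

lemma neg_singleton:
  assumes "I \<in> tops" "i \<in> I"
  shows "neg {} x I = neg {i} x I + of_bool (d I i \<bullet> x < 0)"
proof -
  have "{j \<in> I. d I j \<bullet> x < 0} = {j \<in> I - {i}. d I j \<bullet> x < 0} \<union> (if d I i \<bullet> x < 0 then {i} else {})"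
    using assms by auto
  then show ?thesis
    using topsD(2)[OF assms(1)] by (simp add: neg_def)
qed

text \<open>Both sides count the pairs \<open>i \<in> I\<close> with \<open>neg {i} x I = k\<close> for a fixed regular \<open>x\<close>.\<close>

lemma sum_h_vertices: "(\<Sum>i\<in>V. h {i} k) = (k + 1) * h {} (k + 1) + (n - k) * h {} k"
proof -
  obtain x where x: "regular x" using exists_regular by blast
  have "(\<Sum>i\<in>V. h {i} k) = (\<Sum>i\<in>V. \<Sum>I\<in>tops. of_bool (i \<in> I \<and> neg {i} x I = k))"
  proof (rule sum.cong)
    fix i assume "i \<in> V"
    then have "h {i} k = card {I \<in> tops. i \<in> I \<and> neg {i} x I = k}"
      using x by (simp add: V_def h_eq star_def conj_assoc)
    then show "h {i} k = (\<Sum>I\<in>tops. of_bool (i \<in> I \<and> neg {i} x I = k))"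
      using finite_tops by (simp add: of_bool_def sum.If_cases Int_def)
  qed simp
  also have "\<dots> = (\<Sum>I\<in>tops. \<Sum>i\<in>V. of_bool (i \<in> I \<and> neg {i} x I = k))"
    by (rule sum.swap)
  also have "\<dots> = (\<Sum>I\<in>tops. (k + 1) * of_bool (neg {} x I = k + 1) + (n - k) * of_bool (neg {} x I = k))"
  proof (rule sum.cong)
    fix I assume I: "I \<in> tops"
    let ?N = "{i \<in> I. d I i \<bullet> x < 0}"
    have sub: "I \<subseteq> V" using subset_V topsD(1)[OF I] .
    have cardN: "card ?N = neg {} x I" by (simp add: neg_def)
    have cardP: "card (I - ?N) = n - neg {} x I"
      using topsD(2,3)[OF I] cardN by (simp add: card_Diff_subset)
    have "(\<Sum>i\<in>V. of_bool (i \<in> I \<and> neg {i} x I = k)) = card {i \<in> I. neg {i} x I = k}"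
    proof -
      have "V \<inter> {i. i \<in> I \<and> neg {i} x I = k} = {i \<in> I. neg {i} x I = k}" using sub by blast
      then show ?thesis using finite_V by (simp add: of_bool_def sum.If_cases)
    qed
    also have "{i \<in> I. neg {i} x I = k} = (if neg {} x I = k + 1 then ?N else {}) \<union> (if neg {} x I = k then I - ?N else {})"
    proof (rule set_eqI)
      fix i
      show "i \<in> {i \<in> I. neg {i} x I = k} \<longleftrightarrow>
        i \<in> (if neg {} x I = k + 1 then ?N else {}) \<union> (if neg {} x I = k then I - ?N else {})"
        using neg_singleton[OF I, of i x] by (cases "i \<in> I"; cases "d I i \<bullet> x < 0") auto
    qed
    also have "card \<dots> = (k + 1) * of_bool (neg {} x I = k + 1) + (n - k) * of_bool (neg {} x I = k)"
      using cardN cardP by auto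
    finally show "(\<Sum>i\<in>V. of_bool (i \<in> I \<and> neg {i} x I = k)) =
      (k + 1) * of_bool (neg {} x I = k + 1) + (n - k) * of_bool (neg {} x I = k)" .
  qed simp
  also have "\<dots> = (k + 1) * h {} (k + 1) + (n - k) * h {} k"
    using finite_tops x empty_in_S
    by (simp add: sum.distrib sum_distrib_left[symmetric] h_eq of_bool_def sum.If_cases Int_def)
  finally show ?thesis .
qed

text \<open>The case \<open>k = 0\<close> of the count of pairs: each vertex link has
  \<open>h {i} 0 = 1\<close>.\<close>

lemma card_V: "card V = n + h {} 1"
proof -
  have "(\<Sum>i\<in>V. h {i} 0) = card V" using h_0 by (simp add: V_def)
  then show ?thesis using sum_h_vertices[of 0] h_0[OF empty_in_S] by simp
qed

text \<open>For \<open>x\<close> near the ray of \<open>i\<close> the coordinate at \<open>i\<close>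
  is positive throughout the star, so removing it changes no count of negative coordinates.\<close>

lemma h_vertex_le:
  assumes "i \<in> V"
  shows "h {i} k \<le> h {} k"
proof -
  have i: "{i} \<in> S" using assms by (simp add: V_def)
  obtain y where "regular y" using exists_regular by blast
  then obtain x where x: "regular x" "\<forall>I\<in>star {i}. d I i \<bullet> x > 0"
    using near_face[OF i] by blast
  have "neg {i} x I = neg {} x I" if "I \<in> star {i}" for I
    using neg_singleton[of I i x] that x(2) starD[OF that] by fastforce
  then have "{I \<in> star {i}. neg {i} x I = k} \<subseteq> {I \<in> star {}. neg {} x I = k}"
    using starD by auto
  then show ?thesis
    unfolding h_eq[OF i x(1)] h_eq[OF empty_in_S x(1)] by (rule card_mono[rotated]) (simp add: finite_tops)
qed

text \<open>
  If \<open>h {} k = 1\<close>, then all vertex links have \<open>h {i} k = 1\<close> as well, and the count above would make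
  \<open>k + 2\<close> a multiple of \<open>k + 1\<close>.
\<close>

lemma h_ge_2:
  assumes "card V = n + 2" "1 \<le> k" "k < n"
  shows "h {} k \<ge> 2"
proof (rule ccontr)
  assume "\<not> h {} k \<ge> 2"
  moreover have "h {} k \<ge> 1" using h_positive[OF empty_in_S] assms by simp
  ultimately have hk: "h {} k = 1" by simp
  have "h {i} k = 1" if "i \<in> V" for i
    using h_vertex_le[OF that, of k] h_positive[of "{i}" k] that assms hk by (auto simp: V_def)
  then have "n + 2 = (k + 1) * h {} (k + 1) + (n - k)"
    using sum_h_vertices[of k] assms(1) hk by simp
  then have eq: "(k + 1) * h {} (k + 1) = (k + 1) + 1" using assms by simp
  then have "(k + 1) dvd (k + 1) + 1" by (metis dvd_triv_left)
  then have "(k + 1) dvd 1" by (simp only: dvd_add_right_iff dvd_refl)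
  then show False using assms(2) by simp
qed

lemma sum_h: "(\<Sum>k\<le>n. h {} k) = card tops"
proof -
  obtain x where x: "regular x" using exists_regular by blast
  have "card tops = (\<Sum>k\<in>{..n}. card {I \<in> tops. neg {} x I = k})"
    using neg_le by (subst card_eq_sum, subst sum.group[symmetric, where T="{..n}" and g="neg {} x"]) (auto simp: finite_tops)
  then show ?thesis using h_eq[OF empty_in_S x] by simp
qed

text \<open>There are \<open>n + 1\<close> subsets of size \<open>n\<close> available and
  \<open>n + 1\<close> h-numbers, each at least 1, that add up to the number of maximal simplices;
  equality must hold throughout.\<close>

lemma simplex_boundary:
  assumes "card V = n + 1"
  shows "tops = {I. I \<subseteq> V \<and> card I = n}" and "k \<le> n \<Longrightarrow> h {} k = 1"
proof -
  have sub: "tops \<subseteq> {I. I \<subseteq> V \<and> card I = n}"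
    using subset_V topsD(1,3) by blast
  have fin: "finite {I. I \<subseteq> V \<and> card I = n}" using finite_V by simp
  have cardB: "card {I. I \<subseteq> V \<and> card I = n} = n + 1"
    using n_subsets[OF finite_V, of n] assms by simp
  have ge: "h {} k \<ge> 1" if "k \<le> n" for k using h_positive[OF empty_in_S] that by simp
  have "(\<Sum>k\<le>n. 1) \<le> (\<Sum>k\<le>n. h {} k)" using ge by (intro sum_mono) simp
  then have le: "n + 1 \<le> card tops" by (simp add: sum_h)
  show eq: "tops = {I. I \<subseteq> V \<and> card I = n}"
    by (rule card_seteq[OF fin sub]) (use le cardB in linarith)
  have total: "(\<Sum>j\<le>n. h {} j) = n + 1" using cardB sum_h eq by simp
  assume k: "k \<le> n"
  have "(\<Sum>j\<in>{..n} - {k}. 1) \<le> (\<Sum>j\<in>{..n} - {k}. h {} j)" using ge by (intro sum_mono) simp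
  then have "n \<le> (\<Sum>j\<in>{..n} - {k}. h {} j)" using k by simp
  then have "h {} k \<le> 1" using total k by (simp add: sum.remove[of "{..n}" k])
  then show "h {} k = 1" using ge[OF k] by simp
qed

end

section \<open>Equidistribution of the box points\<close>

lemma unit_char_mult_nat: "unit_char (real r * x) = unit_char x ^ r"
  by (induction r) (simp_all add: unit_char_add distrib_right)

lemma sum_unit_char_roots:
  assumes "n \<ge> 1"
  shows "(\<Sum>r<n. unit_char (real r * (of_int m / real n))) = (if int n dvd m then of_nat n else 0)"
proof -
  define z where "z = unit_char (of_int m / real n)"
  have sum: "(\<Sum>r<n. unit_char (real r * (of_int m / real n))) = (\<Sum>r<n. z ^ r)"
    unfolding unit_char_mult_nat z_def ..
  have one: "z = 1 \<longleftrightarrow> int n dvd m"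
  proof
    assume "z = 1"
    then obtain k :: int where "of_int m / real n = of_int k"
      unfolding z_def unit_char_eq_1_iff by (auto elim: Ints_cases)
    then have "real_of_int m = of_int (int n * k)" using assms by (simp add: field_simps)
    then have "m = int n * k" by (simp only: of_int_eq_iff)
    then show "int n dvd m" by simp
  next
    assume "int n dvd m"
    then obtain k where "m = int n * k" by blast
    then show "z = 1" using assms by (simp add: z_def unit_char_eq_1_iff)
  qed
  have "z ^ n = unit_char (of_int m)"
    unfolding z_def unit_char_mult_nat[symmetric] using assms by simp
  also have "\<dots> = 1" by (simp add: unit_char_eq_1_iff)
  finally have "(\<Sum>r<n. z ^ r) = (if z = 1 then of_nat n else 0)"
    by (simp add: geometric_sum)
  then show ?thesis using sum one by simp
qed

text \<open>Fourier inversion on the integers modulo \<open>n\<close>: of the \<open>n\<close>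
  characters only the trivial one contributes.\<close>

lemma equidistributed:
  fixes \<psi> :: "'p \<Rightarrow> nat"
  assumes "finite P" "k < n"
    and zero: "\<And>r. 0 < r \<Longrightarrow> r < n \<Longrightarrow> (\<Sum>p\<in>P. unit_char (real r * (real (\<psi> p) / real n))) = 0"
  shows "n * card {p \<in> P. \<psi> p mod n = k} = card P"
proof -
  have n: "n \<ge> 1" using assms(2) by simp
  let ?m = "\<lambda>p. int (\<psi> p) - int k"
  have dvd: "int n dvd ?m p \<longleftrightarrow> \<psi> p mod n = k" for p
    using assms(2) by (metis mod_eq_dvd_iff mod_less of_nat_eq_iff zmod_int)
  have "(\<Sum>r<n. \<Sum>p\<in>P. unit_char (real r * (of_int (?m p) / real n))) =
      (\<Sum>r<n. unit_char (- (real r * (real k / real n))) * (\<Sum>p\<in>P. unit_char (real r * (real (\<psi> p) / real n))))"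
    unfolding sum_distrib_left unit_char_add[symmetric]
    by (intro sum.cong refl) (simp add: diff_divide_distrib algebra_simps)
  also have "\<dots> = (\<Sum>r<n. if r = 0 then of_nat (card P) else 0)"
    by (intro sum.cong refl) (use zero in auto)
  also have "\<dots> = of_nat (card P)" using n by simp
  finally have "of_nat (card P) = (\<Sum>p\<in>P. \<Sum>r<n. unit_char (real r * (of_int (?m p) / real n)))"
    by (subst sum.swap) simp
  also have "\<dots> = (\<Sum>p\<in>P. if \<psi> p mod n = k then of_nat n else 0)"
    unfolding sum_unit_char_roots[OF n] dvd ..
  also have "\<dots> = of_nat (n * card {p \<in> P. \<psi> p mod n = k})"
    using assms(1) by (simp add: sum.If_cases Int_def mult.commute)
  finally show ?thesis by (simp only: of_nat_eq_iff)
qed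

text \<open>
  The operator \<open>f \<mapsto> f - \<zeta> T f\<close>, where \<open>T\<close> is the translation by \<open>v i\<close>.  It annihilates a
  character with \<open>\<kappa> (v i) = \<zeta>\<close>, and multiplies the total of a finitely supported function by
  \<open>1 - \<zeta>\<close>.
\<close>

definition shift_diff :: "('i \<Rightarrow> 'a::euclidean_space) \<Rightarrow> complex \<Rightarrow> 'i \<Rightarrow> ('a \<Rightarrow> complex) \<Rightarrow> 'a \<Rightarrow> complex" where
  "shift_diff v \<zeta> i f = (\<lambda>x. f x - \<zeta> * f (x - v i))"

abbreviation shift_diffs :: "('i \<Rightarrow> 'a::euclidean_space) \<Rightarrow> complex \<Rightarrow> 'i set \<Rightarrow> ('a \<Rightarrow> complex) \<Rightarrow> 'a \<Rightarrow> complex" where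
  "shift_diffs v \<zeta> A f \<equiv> Finite_Set.fold (shift_diff v \<zeta>) f A"

interpretation shift_diff: comp_fun_commute "shift_diff v \<zeta>" for v \<zeta>
proof
  have "x - v i - v j = x - v j - v i" for i j x by simp
  then show "shift_diff v \<zeta> j \<circ> shift_diff v \<zeta> i = shift_diff v \<zeta> i \<circ> shift_diff v \<zeta> j" for i j
    by (simp add: fun_eq_iff shift_diff_def algebra_simps)
qed

lemma shift_diffs_sum:
  assumes "finite A"
  shows "shift_diffs v \<zeta> A (\<lambda>x. \<Sum>t\<in>T. F t x) = (\<lambda>x. \<Sum>t\<in>T. shift_diffs v \<zeta> A (F t) x)"
  using assms
proof (induction A rule: finite_induct)
  case (insert i A)
  have "shift_diff v \<zeta> i (\<lambda>x. \<Sum>t\<in>T. G t x) = (\<lambda>x. \<Sum>t\<in>T. shift_diff v \<zeta> i (G t) x)" for G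
    by (simp add: shift_diff_def sum_subtractf sum_distrib_left)
  with insert show ?case by simp
qed simp

text \<open>The operators commute, so the one that annihilates \<open>f\<close> may be applied
  first.\<close>

lemma shift_diffs_vanish:
  assumes "finite A" "i \<in> A" "shift_diff v \<zeta> i f = (\<lambda>_. 0)"
  shows "shift_diffs v \<zeta> A f = (\<lambda>_. 0)"
proof -
  have zero: "shift_diffs v \<zeta> B (\<lambda>_. 0) = (\<lambda>_. 0)" if "finite B" for B
    using shift_diffs_sum[OF that, of v \<zeta> "\<lambda>_ _. 0" "{}"] by simp
  have "shift_diffs v \<zeta> (insert i (A - {i})) f = shift_diffs v \<zeta> (A - {i}) (shift_diff v \<zeta> i f)"
    by (rule shift_diff.fold_insert2) (use assms in auto)
  then show ?thesis using assms zero[of "A - {i}"] by (simp add: insert_absorb)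
qed

lemma shift_diffs_total:
  assumes "finite A" "finite {x. f x \<noteq> 0}"
  shows "finite {x. shift_diffs v \<zeta> A f x \<noteq> 0} \<and>
    (\<Sum>x | shift_diffs v \<zeta> A f x \<noteq> 0. shift_diffs v \<zeta> A f x) = (1 - \<zeta>) ^ card A * (\<Sum>x | f x \<noteq> 0. f x)"
  using assms(1)
proof (induction A rule: finite_induct)
  case empty
  then show ?case using assms(2) by simp
next
  case (insert i A)
  define g where "g = shift_diffs v \<zeta> A f"
  let ?g' = "shift_diff v \<zeta> i g"
  define B where "B = {x. g x \<noteq> 0}"
  \<comment> \<open>Contains the support of \<open>g\<close> and that of its translate, so that both
    totals can be taken over one finite set.\<close>
  define C where "C = B \<union> (\<lambda>x. x + v i) ` B"
  have fin: "finite B" "finite C" using insert.IH by (auto simp: B_def C_def g_def)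
  have sub: "{x. ?g' x \<noteq> 0} \<subseteq> C"
  proof
    fix x assume "x \<in> {x. ?g' x \<noteq> 0}"
    then have "x \<in> B \<or> x - v i \<in> B" by (auto simp: shift_diff_def B_def)
    then show "x \<in> C" unfolding C_def by (metis UnCI diff_add_cancel imageI)
  qed
  have "(\<Sum>x\<in>C. g (x - v i)) = (\<Sum>x\<in>(\<lambda>x. x + v i) ` B. g (x - v i))"
  proof (rule sum.mono_neutral_right)
    show "\<forall>x\<in>C - (\<lambda>x. x + v i) ` B. g (x - v i) = 0"
    proof
      fix x assume "x \<in> C - (\<lambda>x. x + v i) ` B"
      then have "x - v i \<notin> B" by (metis DiffD2 diff_add_cancel imageI)
      then show "g (x - v i) = 0" by (simp add: B_def)
    qed
  qed (use fin C_def in auto)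
  also have "\<dots> = (\<Sum>x\<in>B. g x)" by (simp add: sum.reindex)
  finally have shifted: "(\<Sum>x\<in>C. g (x - v i)) = (\<Sum>x\<in>B. g x)" .
  have "(\<Sum>x\<in>C. g x) = (\<Sum>x\<in>B. g x)"
    by (rule sum.mono_neutral_right) (use fin in \<open>auto simp: C_def B_def\<close>)
  then have "(\<Sum>x\<in>C. ?g' x) = (1 - \<zeta>) * (\<Sum>x\<in>B. g x)"
    using shifted by (simp add: shift_diff_def sum_subtractf sum_distrib_left[symmetric] algebra_simps)
  moreover have "(\<Sum>x | ?g' x \<noteq> 0. ?g' x) = (\<Sum>x\<in>C. ?g' x)"
    by (rule sum.mono_neutral_left) (use fin sub in auto)
  moreover have "(\<Sum>x\<in>B. g x) = (1 - \<zeta>) ^ card A * (\<Sum>x | f x \<noteq> 0. f x)"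
    using insert.IH unfolding B_def g_def by blast
  moreover have "shift_diffs v \<zeta> (insert i A) f = ?g'"
    using insert.hyps by (simp add: g_def)
  ultimately show ?case
    using insert.hyps finite_subset[OF sub fin(2)] by simp
qed

section \<open>Half-open cones and boxes\<close>

context lattice_fan
begin

text \<open>
  A facet \<open>d I i = 0\<close> belongs to the half-open cone over \<open>I\<close> iff \<open>x\<close> is on the same side of it as the
  cone; with this choice the half-open cones are disjoint.
\<close>

definition lower :: "'a \<Rightarrow> 'i set \<Rightarrow> 'i \<Rightarrow> 'a \<Rightarrow> bool" where
  "lower x I i l \<longleftrightarrow> (if d I i \<bullet> x > 0 then 0 \<le> d I i \<bullet> l else 0 < d I i \<bullet> l)"

definition upper :: "'a \<Rightarrow> 'i set \<Rightarrow> 'i \<Rightarrow> 'a \<Rightarrow> bool" where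
  "upper x I i l \<longleftrightarrow> (if d I i \<bullet> x > 0 then d I i \<bullet> l < 1 else d I i \<bullet> l \<le> 1)"

definition half_open_cone :: "'a \<Rightarrow> 'i set \<Rightarrow> 'a set" where
  "half_open_cone x I = {l \<in> L. \<forall>i\<in>I. lower x I i l}"

definition box :: "'a \<Rightarrow> 'i set \<Rightarrow> 'a set" where
  "box x I = {l \<in> L. \<forall>i\<in>I. lower x I i l \<and> upper x I i l}"

lemma finite_box: "I \<in> tops \<Longrightarrow> finite (box x I)"
  by (rule finite_subset[OF _ finite_bounded_coords[of I 1]])
    (auto simp: box_def lower_def upper_def split: if_splits)

text \<open>Each operator subtracts the translate of the current set by \<open>v j\<close>, with
  matching character values, and so imposes the upper bound on coordinate \<open>j\<close>.\<close>

lemma shift_diffs_cone: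
  assumes I: "I \<in> tops" and \<kappa>: "\<And>i y. i \<in> I \<Longrightarrow> \<zeta> * \<kappa> (y - v i) = \<kappa> y"
  shows "shift_diffs v \<zeta> I (\<lambda>y. if y \<in> half_open_cone x I then \<kappa> y else 0) =
    (\<lambda>y. if y \<in> box x I then \<kappa> y else 0)"
proof -
  let ?E = "\<lambda>J y. if y \<in> L \<and> (\<forall>i\<in>I. lower x I i y) \<and> (\<forall>i\<in>J. upper x I i y) then \<kappa> y else 0"
  have "shift_diffs v \<zeta> J (?E {}) = ?E J" if "J \<subseteq> I" for J
  proof -
    have "finite J" using that topsD(2)[OF I] finite_subset by blast
    then show ?thesis using that
    proof (induction J rule: finite_induct)
      case (insert j J)
      then have j: "j \<in> I" "j \<notin> J" "J \<subseteq> I" by auto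
      have "?E J y - \<zeta> * ?E J (y - v j) = ?E (insert j J) y" for y
      proof -
        have L: "y - v j \<in> L \<longleftrightarrow> y \<in> L"
          using diff_mem[of y "v j"] add_mem[of "y - v j" "v j"] edge_mem[OF topsD(1)[OF I] j(1)] by auto
        have coord: "d I i \<bullet> (y - v j) = d I i \<bullet> y - (if i = j then 1 else 0)" if "i \<in> I" for i
          using dual_inner[OF I that j(1)] by (auto simp: inner_diff_right)
        have other: "lower x I i (y - v j) = lower x I i y" "upper x I i (y - v j) = upper x I i y"
          if "i \<in> I" "i \<noteq> j" for i
          using coord[OF that(1)] that(2) by (simp_all add: lower_def upper_def)
        \<comment> \<open>The half-open conventions fit: the translated lower bound is exactly the
          failure of the upper bound, whichever end is closed.\<close>
        have own: "lower x I j (y - v j) \<longleftrightarrow> \<not> upper x I j y" "\<not> upper x I j y \<Longrightarrow> lower x I j y"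
          using coord[OF j(1)] by (auto simp: lower_def upper_def split: if_splits)
        let ?C = "y \<in> L \<and> (\<forall>i\<in>I - {j}. lower x I i y) \<and> (\<forall>i\<in>J. upper x I i y)"
        have split: "(\<forall>i\<in>I. P i) \<longleftrightarrow> (\<forall>i\<in>I - {j}. P i) \<and> P j" for P using j(1) by blast
        have "?E J y = (if ?C \<and> lower x I j y then \<kappa> y else 0)"
          by (subst split) (rule if_cong, blast, auto)
        moreover have "\<zeta> * ?E J (y - v j) = (if ?C \<and> \<not> upper x I j y then \<kappa> y else 0)"
        proof -
          have "(\<forall>i\<in>I - {j}. lower x I i (y - v j)) \<longleftrightarrow> (\<forall>i\<in>I - {j}. lower x I i y)"
            using other(1) by blast
          moreover have "(\<forall>i\<in>J. upper x I i (y - v j)) \<longleftrightarrow> (\<forall>i\<in>J. upper x I i y)"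
            using other(2) j by (metis subsetD)
          ultimately show ?thesis
            using L own(1) \<kappa>[OF j(1), of y] by (subst split) auto
        qed
        moreover have "?E (insert j J) y = (if ?C \<and> lower x I j y \<and> upper x I j y then \<kappa> y else 0)"
          by (subst split) (rule if_cong, blast, auto)
        ultimately show ?thesis using own(2) by auto
      qed
      then show ?case
        using insert by simp (simp add: shift_diff_def)
    qed simp
  qed
  from this[OF order_refl] show ?thesis
    by (simp add: half_open_cone_def box_def ball_conj_distrib)
qed

end

context unit_fan
begin

text \<open>Moving \<open>l\<close> slightly towards \<open>x\<close> gives a regular vector, which
  lies in exactly one maximal cone; the half-open conditions on \<open>l\<close> record which
  one.\<close>

lemma half_open_tiling:
  assumes "regular x" "l \<in> L"
  shows "card {I \<in> tops. l \<in> half_open_cone x I} = 1"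
proof -
  obtain z where z: "regular z"
    "\<forall>I\<in>tops. \<forall>i\<in>I. sgn (d I i \<bullet> z) = (if d I i \<bullet> l \<noteq> 0 then sgn (d I i \<bullet> l) else sgn (d I i \<bullet> x))"
    using perturb_regular[OF span_base[OF assms(2)] assms(1), of "{}"] by blast
  have "d I i \<bullet> z > 0 \<longleftrightarrow> lower x I i l" if "I \<in> tops" "i \<in> I" for I i
  proof -
    have "d I i \<bullet> x \<noteq> 0" using assms(1) that by (auto simp: regular_def)
    moreover have "d I i \<bullet> z > 0 \<longleftrightarrow> sgn (d I i \<bullet> z) > 0" by simp
    ultimately show ?thesis
      using z(2) that unfolding lower_def by (auto simp del: sgn_greater simp: sgn_if split: if_splits)
  qed
  then have "{I \<in> tops. l \<in> half_open_cone x I} = {I \<in> tops. \<forall>i\<in>I. d I i \<bullet> z > 0}"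
    using assms(2) by (auto simp: half_open_cone_def)
  then show ?thesis using degree_one[OF z(1)] by simp
qed

text \<open>For a cone \<open>I\<close> the operators of its own edge vectors leave the box, and the
  remaining \<open>card V - n\<close> multiply the finite total by \<open>1 - \<zeta>\<close> each.
  This nonzero power is common to all cones, hence can be cancelled.\<close>

lemma box_character_sum:
  fixes \<zeta> :: complex
  assumes x: "regular x" and \<zeta>: "\<zeta> \<noteq> 1"
    and \<kappa>: "\<And>i y. i \<in> V \<Longrightarrow> \<zeta> * \<kappa> (y - v i) = \<kappa> y"
  shows "(\<Sum>I\<in>tops. \<Sum>b\<in>box x I. \<kappa> b) = 0"
proof -
  let ?e = "\<lambda>I y. if y \<in> half_open_cone x I then \<kappa> y else 0"
  let ?b = "\<lambda>I y. if y \<in> box x I then \<kappa> y else 0"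
  let ?D = "\<lambda>I. shift_diffs v \<zeta> V (?e I)"
  have D: "finite {y. ?D I y \<noteq> 0} \<and>
      (\<Sum>y | ?D I y \<noteq> 0. ?D I y) = (1 - \<zeta>) ^ (card V - n) * (\<Sum>b\<in>box x I. \<kappa> b)" if I: "I \<in> tops" for I
  proof -
    have sub: "I \<subseteq> V" "finite I" using subset_V topsD[OF I] by auto
    have "?D I = shift_diffs v \<zeta> (V - I) (shift_diffs v \<zeta> I (?e I))"
      using shift_diff.fold_set_union_disj[of I "V - I" v \<zeta> "?e I"]
        sub finite_V by (simp add: Un_absorb1)
    also have "shift_diffs v \<zeta> I (?e I) = ?b I"
      by (rule shift_diffs_cone[OF I]) (use \<kappa> sub in auto)
    finally have eq: "?D I = shift_diffs v \<zeta> (V - I) (?b I)" .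
    have fin: "finite {y. ?b I y \<noteq> 0}"
      by (rule finite_subset[OF _ finite_box[OF I]]) auto
    have "(\<Sum>y | ?b I y \<noteq> 0. ?b I y) = (\<Sum>b\<in>box x I. ?b I b)"
      by (rule sum.mono_neutral_left) (auto simp: finite_box[OF I])
    also have "\<dots> = (\<Sum>b\<in>box x I. \<kappa> b)" by simp
    finally show ?thesis
      using shift_diffs_total[OF _ fin, of "V - I" v \<zeta>] sub topsD(3)[OF I] finite_V
      unfolding eq by (simp add: card_Diff_subset)
  qed
  \<comment> \<open>One vertex is enough to annihilate the character on the lattice;
    \<open>n \<ge> 1\<close> provides it.\<close>
  obtain i where i: "i \<in> V"
    using star_nonempty[OF empty_in_S] subset_V topsD n_pos by (metis card.empty not_one_le_zero starD(1) subset_empty subsetI)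
  have "(\<lambda>y. \<Sum>I\<in>tops. ?e I y) = (\<lambda>y. if y \<in> L then \<kappa> y else 0)"
  proof
    fix y
    have "(\<Sum>I\<in>tops. ?e I y) = of_nat (card {I \<in> tops. y \<in> half_open_cone x I}) * \<kappa> y"
      using finite_tops by (simp add: sum.If_cases Int_def)
    then show "(\<Sum>I\<in>tops. ?e I y) = (if y \<in> L then \<kappa> y else 0)"
      using half_open_tiling[OF x, of y] by (auto simp: half_open_cone_def)
  qed
  moreover have "shift_diff v \<zeta> i (\<lambda>y. if y \<in> L then \<kappa> y else 0) = (\<lambda>_. 0)"
  proof
    fix y
    have "v i \<in> L" using i edge_mem by (auto simp: V_def)
    then have "y - v i \<in> L \<longleftrightarrow> y \<in> L"
      using diff_mem[of y "v i"] add_mem[of "y - v i" "v i"] by auto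
    then show "shift_diff v \<zeta> i (\<lambda>y. if y \<in> L then \<kappa> y else 0) y = 0"
      using \<kappa>[OF i] by (simp add: shift_diff_def)
  qed
  ultimately have "shift_diffs v \<zeta> V (\<lambda>y. \<Sum>I\<in>tops. ?e I y) = (\<lambda>_. 0)"
    using shift_diffs_vanish[OF finite_V i] by metis
  then have zero: "(\<Sum>I\<in>tops. ?D I y) = 0" for y
    unfolding shift_diffs_sum[OF finite_V] by metis
  let ?U = "\<Union>I\<in>tops. {y. ?D I y \<noteq> 0}"
  have finU: "finite ?U" using D finite_tops by blast
  have "0 = (\<Sum>y\<in>?U. \<Sum>I\<in>tops. ?D I y)" by (simp only: zero sum.neutral_const)
  also have "\<dots> = (\<Sum>I\<in>tops. \<Sum>y\<in>?U. ?D I y)" by (rule sum.swap)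
  also have "\<dots> = (\<Sum>I\<in>tops. \<Sum>y | ?D I y \<noteq> 0. ?D I y)"
    by (intro sum.cong refl sum.mono_neutral_right finU) auto
  also have "\<dots> = (\<Sum>I\<in>tops. (1 - \<zeta>) ^ (card V - n) * (\<Sum>b\<in>box x I. \<kappa> b))"
    by (intro sum.cong refl) (use D in blast)
  also have "\<dots> = (1 - \<zeta>) ^ (card V - n) * (\<Sum>I\<in>tops. \<Sum>b\<in>box x I. \<kappa> b)"
    by (rule sum_distrib_left[symmetric])
  finally show ?thesis using \<zeta> by simp
qed

end

section \<open>Fans with divisible first Chern class\<close>

lemma half_not_Ints: "(1 / 2 :: real) \<notin> \<int>"
proof
  assume "(1 / 2 :: real) \<in> \<int>"
  then obtain m :: int where m: "(1 / 2 :: real) = of_int m" by (auto elim: Ints_cases)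
  then have "of_int (2 * m) = (1 :: real)" by simp
  then have "2 * m = 1" by (simp only: of_int_eq_1_iff)
  then show False by presburger
qed

text \<open>The defects \<open>1 - 1 / M i\<close> are zero or at least one half, and always less
  than 1. A total of 1 therefore needs exactly two defects equal to one half.\<close>

lemma sum_unit_fractions:
  fixes M :: "'i \<Rightarrow> int"
  assumes "finite A" "\<And>i. i \<in> A \<Longrightarrow> M i \<ge> 1" "(\<Sum>i\<in>A. 1 - 1 / real_of_int (M i)) = 1"
  shows "\<exists>a b. a \<in> A \<and> b \<in> A \<and> a \<noteq> b \<and> M a = 2 \<and> M b = 2 \<and> (\<forall>i\<in>A - {a, b}. M i = 1)"
proof -
  let ?t = "\<lambda>i. 1 - 1 / real_of_int (M i)"
  have nonneg: "?t i \<ge> 0" and lt1: "?t i < 1" if "i \<in> A" for i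
    using assms(2)[OF that] by (auto simp: field_simps)
  have half: "?t i \<ge> 1 / 2" if "i \<in> A" "?t i > 0" for i
  proof -
    have "M i \<noteq> 1" using that(2) by auto
    then have "M i \<ge> 2" using assms(2)[OF that(1)] by linarith
    then show ?thesis by (simp add: field_simps)
  qed
  have ex: "\<exists>i\<in>B. ?t i > 0" if "B \<subseteq> A" "(\<Sum>i\<in>B. ?t i) > 0" for B
    using that(2) sum_nonpos[of B ?t] by (meson linorder_not_le)
  obtain a where a: "a \<in> A" "?t a > 0" using ex[of A] assms(3) by auto
  have rest: "(\<Sum>i\<in>A - {a}. ?t i) = 1 - ?t a"
    using assms(1,3) a(1) by (simp add: sum.remove[of A a])
  have "(\<Sum>i\<in>A - {a}. ?t i) > 0" using rest lt1[OF a(1)] by linarith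
  then obtain b where b: "b \<in> A - {a}" "?t b > 0" using ex[of "A - {a}"] by blast
  have rest2: "(\<Sum>i\<in>A - {a} - {b}. ?t i) = 1 - ?t a - ?t b"
    using rest assms(1) b(1) by (simp add: sum.remove[of "A - {a}" b])
  have "?t a \<ge> 1 / 2" "?t b \<ge> 1 / 2" using half a b by auto
  moreover have "(\<Sum>i\<in>A - {a} - {b}. ?t i) \<ge> 0" by (rule sum_nonneg) (use nonneg in auto)
  ultimately have ab: "?t a = 1 / 2" "?t b = 1 / 2" and zero: "(\<Sum>i\<in>A - {a} - {b}. ?t i) = 0"
    using rest2 by linarith+
  have "?t i = 0" if "i \<in> A - {a} - {b}" for i
    using zero that assms(1) nonneg by (subst (asm) sum_nonneg_eq_0_iff) auto
  then have "M i = 1" if "i \<in> A - {a, b}" for i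
    using that assms(2)[of i] by fastforce
  moreover have "M a = 2" "M b = 2"
    using ab assms(2)[OF a(1)] assms(2)[of b] b(1) by (auto simp: field_simps)
  ultimately show ?thesis using a b by blast
qed

text \<open>Restricting \<open>c1 = n x + u\<close> to a maximal simplex expresses the sum of the
  dual vectors as \<open>n\<close> times a vector of the dual lattice plus \<open>u\<close>;
  \<open>coord_sum_cong\<close> is this identity paired with \<open>l\<close>.\<close>

locale gorenstein_fan = unit_fan L S n v w
  for L :: "'a::euclidean_space set" and S :: "'i set set" and n and v :: "'i \<Rightarrow> 'a" and w +
  fixes u :: 'a
  assumes u_int: "l \<in> L \<Longrightarrow> u \<bullet> l \<in> \<int>"
    and coord_sum_cong: "I \<in> tops \<Longrightarrow> l \<in> L \<Longrightarrow> \<exists>m::int. (\<Sum>i\<in>I. d I i \<bullet> l) = u \<bullet> l + real n * of_int m"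
begin

text \<open>In a simplex containing \<open>i\<close> the coordinates of \<open>v i\<close> add up to
  1.\<close>

lemma u_edge:
  assumes "i \<in> V"
  shows "\<exists>m::int. u \<bullet> v i = 1 + real n * of_int m"
proof -
  obtain I where I: "I \<in> tops" "i \<in> I"
    using star_nonempty[of "{i}"] assms starD(1,2) by (fastforce simp: V_def)
  have "(\<Sum>j\<in>I. d I j \<bullet> v i) = (\<Sum>j\<in>I. if j = i then 1 else 0)"
    by (rule sum.cong) (use dual_inner[OF I(1)] I(2) in auto)
  then have "(\<Sum>j\<in>I. d I j \<bullet> v i) = 1" using topsD(2)[OF I(1)] I(2) by simp
  moreover obtain m :: int where "(\<Sum>j\<in>I. d I j \<bullet> v i) = u \<bullet> v i + real n * of_int m"
    using coord_sum_cong[OF I(1)] edge_mem[OF topsD(1)[OF I(1)] I(2)] by blast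
  ultimately have "u \<bullet> v i = 1 + real n * of_int (- m)" by simp
  then show ?thesis ..
qed

text \<open>The half-open cones are disjoint for regular \<open>x\<close>, so \<open>b\<close>
  determines \<open>I\<close>; the simplex is carried along because coordinates refer to it.\<close>

definition pairs :: "'a \<Rightarrow> ('i set \<times> 'a) set" where
  "pairs x = (SIGMA I:tops. box x I)"

text \<open>
  \<open>\<psi>\<close> is the piecewise linear function with value \<open>1\<close> on all edge vectors, evaluated at a box point; it
  takes integral values by divisibility of the first Chern class.
\<close>

definition \<psi> :: "'i set \<times> 'a \<Rightarrow> nat" where
  "\<psi> p = nat \<lfloor>\<Sum>i\<in>fst p. d (fst p) i \<bullet> snd p\<rfloor>"

definition integral_coords :: "'i set \<times> 'a \<Rightarrow> bool" where
  "integral_coords p \<longleftrightarrow> (\<forall>i\<in>fst p. d (fst p) i \<bullet> snd p \<in> \<int>)"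

lemma finite_pairs: "finite (pairs x)"
  using finite_tops finite_box by (auto simp: pairs_def)

lemma pairs_coords:
  assumes "(I, b) \<in> pairs x" "i \<in> I"
  shows "0 \<le> d I i \<bullet> b" "d I i \<bullet> b \<le> 1"
proof -
  have "lower x I i b" "upper x I i b" using assms by (auto simp: pairs_def box_def)
  then show "0 \<le> d I i \<bullet> b" "d I i \<bullet> b \<le> 1"
    by (simp_all add: lower_def upper_def split: if_splits)
qed

text \<open>The coordinate sum is an integer by divisibility and nonnegative on the box, so
  \<open>nat\<close> and the floor in \<psi> lose nothing.\<close>

lemma psi_eq:
  assumes "(I, b) \<in> pairs x"
  shows "real (\<psi> (I, b)) = (\<Sum>i\<in>I. d I i \<bullet> b)"
proof -
  have I: "I \<in> tops" "b \<in> L" using assms by (auto simp: pairs_def box_def)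
  obtain m :: int where "(\<Sum>i\<in>I. d I i \<bullet> b) = u \<bullet> b + real n * of_int m"
    using coord_sum_cong[OF I] by blast
  then have "(\<Sum>i\<in>I. d I i \<bullet> b) \<in> \<int>" using u_int[OF I(2)] by simp
  moreover have "(\<Sum>i\<in>I. d I i \<bullet> b) \<ge> 0"
    by (rule sum_nonneg) (use pairs_coords[OF assms] in auto)
  ultimately show ?thesis by (auto simp: \<psi>_def elim!: Ints_cases)
qed

lemma psi_le: "p \<in> pairs x \<Longrightarrow> \<psi> p \<le> n"
proof -
  assume p: "p \<in> pairs x"
  obtain I b where Ib: "p = (I, b)" by (cases p)
  have "(\<Sum>i\<in>I. d I i \<bullet> b) \<le> (\<Sum>i\<in>I. 1)"
    by (rule sum_mono) (use pairs_coords p Ib in auto)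
  moreover have "card I = n" using p Ib topsD(3) by (auto simp: pairs_def)
  ultimately have "real (\<psi> p) \<le> real n" using psi_eq p Ib by simp
  then show ?thesis by simp
qed

lemma psi_extreme:
  assumes p: "(I, b) \<in> pairs x" and "\<psi> (I, b) = 0 \<or> \<psi> (I, b) = n"
  shows "integral_coords (I, b)"
  using assms(2)
proof
  have I: "finite I" "card I = n" using p topsD by (auto simp: pairs_def)
  {
    assume "\<psi> (I, b) = 0"
    then have "(\<Sum>i\<in>I. d I i \<bullet> b) = 0" using psi_eq[OF p] by simp
    then have "\<forall>i\<in>I. d I i \<bullet> b = 0"
      using sum_nonneg_eq_0_iff[OF I(1), of "\<lambda>i. d I i \<bullet> b"] pairs_coords(1)[OF p] by blast
    then show ?thesis by (simp add: integral_coords_def)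
  next
    assume "\<psi> (I, b) = n"
    then have "(\<Sum>i\<in>I. 1 - d I i \<bullet> b) = 0" using psi_eq[OF p] I by (simp add: sum_subtractf)
    then have "\<forall>i\<in>I. 1 - d I i \<bullet> b = 0"
      using sum_nonneg_eq_0_iff[OF I(1), of "\<lambda>i. 1 - d I i \<bullet> b"] pairs_coords(2)[OF p] by simp
    then show ?thesis by (simp add: integral_coords_def)
  }
qed

lemma character_sum_pairs:
  assumes x: "regular x" and r: "0 < r" "r < n"
  shows "(\<Sum>p\<in>pairs x. unit_char (real r * (real (\<psi> p) / real n))) = 0"
proof -
  \<comment> \<open>On lattice points, \<open>u\<close> agrees modulo \<open>n\<close> with the
    coordinate sum, but it is linear on the whole space. This makes \<kappa> a character with value
    \<zeta> on every edge vector.\<close>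
  define \<kappa> where "\<kappa> y = unit_char (real r * ((u \<bullet> y) / real n))" for y
  define \<zeta> where "\<zeta> = unit_char (real r / real n)"
  have shift: "unit_char (a + real r * of_int m) = unit_char a" for a and m :: int
    by (simp add: unit_char_add unit_char_eq_1_iff[THEN iffD2])
  have "(\<Sum>p\<in>pairs x. unit_char (real r * (real (\<psi> p) / real n))) = (\<Sum>(I, b)\<in>pairs x. \<kappa> b)"
  proof (rule sum.cong)
    fix p assume p: "p \<in> pairs x"
    obtain I b where Ib: "p = (I, b)" by (cases p)
    then have "I \<in> tops" "b \<in> L" using p by (auto simp: pairs_def box_def)
    then obtain m :: int where "(\<Sum>i\<in>I. d I i \<bullet> b) = u \<bullet> b + real n * of_int m"
      using coord_sum_cong by blast
    then have "real r * (real (\<psi> p) / real n) = real r * ((u \<bullet> b) / real n) + real r * of_int m"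
      using psi_eq p Ib n_pos by (simp add: field_simps)
    then show "unit_char (real r * (real (\<psi> p) / real n)) = (case p of (I, b) \<Rightarrow> \<kappa> b)"
      using Ib by (simp add: \<kappa>_def shift)
  qed simp
  also have "\<dots> = (\<Sum>I\<in>tops. \<Sum>b\<in>box x I. \<kappa> b)"
    unfolding pairs_def by (rule sum.Sigma[symmetric]) (use finite_tops finite_box in auto)
  also have "\<dots> = 0"
  proof (rule box_character_sum[OF x, of \<zeta>])
    show "\<zeta> \<noteq> 1"
    proof
      assume "\<zeta> = 1"
      then obtain k :: int where k: "real r / real n = of_int k"
        unfolding \<zeta>_def unit_char_eq_1_iff by (auto elim: Ints_cases)
      have "0 < real r / real n" "real r / real n < 1" using r by (auto simp: field_simps)
      then show False unfolding k by simp
    qed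
    fix i y assume "i \<in> V"
    then obtain m :: int where "u \<bullet> v i = 1 + real n * of_int m" using u_edge by blast
    then have "real r / real n + real r * ((u \<bullet> (y - v i)) / real n) = real r * ((u \<bullet> y) / real n) + real r * of_int (- m)"
      using n_pos by (simp add: inner_diff_right field_simps)
    then show "\<zeta> * \<kappa> (y - v i) = \<kappa> y"
      unfolding \<zeta>_def \<kappa>_def unit_char_add[symmetric] by (simp only: shift)
  qed
  finally show ?thesis .
qed

text \<open>The half-open conventions turn an integral coordinate into 1 where \<open>x\<close> is
  negative and 0 where it is positive. Each maximal simplex thus has one integral box point, with
  coordinate sum \<open>neg {} x I\<close>.\<close>

lemma card_integral_pairs:
  assumes x: "regular x"
  shows "card {p \<in> pairs x. integral_coords p \<and> \<psi> p = k} = h {} k"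
proof -
  let ?N = "\<lambda>I. {i \<in> I. d I i \<bullet> x < 0}"
  let ?b = "\<lambda>I. \<Sum>i\<in>?N I. v i"
  have coord: "d I i \<bullet> ?b I = of_bool (d I i \<bullet> x < 0)" if "I \<in> tops" "i \<in> I" for I i
    using dual_inner_edges[OF that, of "?N I"] that by auto
  have mem: "(I, ?b I) \<in> pairs x" if I: "I \<in> tops" for I
  proof -
    have "?b I \<in> L" by (rule sum_mem) (use edge_mem topsD(1)[OF I] in auto)
    moreover have "lower x I i (?b I)" "upper x I i (?b I)" if "i \<in> I" for i
      unfolding lower_def upper_def coord[OF I that] using regular_pos_iff[OF x I that] by auto
    ultimately show ?thesis using I by (simp add: pairs_def box_def)
  qed
  have psi: "\<psi> (I, ?b I) = neg {} x I" if I: "I \<in> tops" for I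
  proof -
    have "real (\<psi> (I, ?b I)) = (\<Sum>i\<in>I. of_bool (d I i \<bullet> x < 0))"
      unfolding psi_eq[OF mem[OF I]] by (rule sum.cong) (use coord[OF I] in auto)
    also have "\<dots> = real (neg {} x I)"
      using topsD(2)[OF I] by (simp add: of_bool_def sum.If_cases neg_def Int_def)
    finally show ?thesis by simp
  qed
  have "{p \<in> pairs x. integral_coords p \<and> \<psi> p = k} = (\<lambda>I. (I, ?b I)) ` {I \<in> star {}. neg {} x I = k}"
  proof (intro equalityI subsetI)
    fix p assume "p \<in> {p \<in> pairs x. integral_coords p \<and> \<psi> p = k}"
    moreover obtain I b where Ib: "p = (I, b)" by (cases p)
    ultimately have p: "(I, b) \<in> pairs x" "integral_coords (I, b)" "\<psi> (I, b) = k" by auto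
    then have I: "I \<in> tops" "b \<in> L" "b \<in> box x I" by (auto simp: pairs_def box_def)
    have "b = ?b I"
    proof (rule coords_eqI[OF I(1)])
      show "b \<in> span L" using I(2) by (rule span_base)
      show "?b I \<in> span L" by (rule edges_in_span[OF topsD(1)[OF I(1)]]) auto
      fix i assume i: "i \<in> I"
      obtain m :: int where m: "d I i \<bullet> b = of_int m"
        using p(2) i by (auto simp: integral_coords_def elim: Ints_cases)
      have "lower x I i b" "upper x I i b" using I(3) i by (auto simp: box_def)
      then have "m = (if d I i \<bullet> x < 0 then 1 else 0)"
        using regular_pos_iff[OF x I(1) i] unfolding lower_def upper_def m by (auto split: if_splits)
      then show "d I i \<bullet> b = d I i \<bullet> ?b I" using coord[OF I(1) i] m by auto
    qed
    then show "p \<in> (\<lambda>I. (I, ?b I)) ` {I \<in> star {}. neg {} x I = k}"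
      using Ib p(3) I(1) psi[OF I(1)] by auto
  next
    fix p assume "p \<in> (\<lambda>I. (I, ?b I)) ` {I \<in> star {}. neg {} x I = k}"
    then show "p \<in> {p \<in> pairs x. integral_coords p \<and> \<psi> p = k}"
      using mem psi coord by (auto simp: integral_coords_def)
  qed
  moreover have "inj_on (\<lambda>I. (I, ?b I)) A" for A by (rule inj_onI) simp
  ultimately show ?thesis
    using h_eq[OF empty_in_S x] by (simp add: card_image)
qed

text \<open>Passing to \<open>- x\<close> exchanges positive and negative coordinates.\<close>

lemma h_n: "h {} n = 1"
proof -
  obtain x where x: "regular x" using exists_regular by blast
  have "neg {} x I = n \<longleftrightarrow> neg {} (- x) I = 0" if I: "I \<in> tops" for I
  proof -
    have "{i \<in> I. d I i \<bullet> (- x) < 0} = I - {i \<in> I. d I i \<bullet> x < 0}"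
      using regular_pos_iff[OF x I] by auto
    then have "neg {} (- x) I = n - neg {} x I"
      using topsD(2,3)[OF I] by (simp add: neg_def card_Diff_subset)
    then show ?thesis using neg_le[OF I, of x] by auto
  qed
  then have "{I \<in> star {}. neg {} x I = n} = {I \<in> star {}. neg {} (- x) I = 0}" by auto
  then have "h {} n = h {} 0"
    unfolding h_eq[OF empty_in_S x, of n] h_eq[OF empty_in_S regular_uminus[OF x], of 0] by (rule arg_cong)
  then show ?thesis using h_0[OF empty_in_S] by simp
qed

lemma card_pairs_split:
  assumes "regular x"
  shows "card {p \<in> pairs x. \<psi> p = k} = h {} k + card {p \<in> pairs x. \<not> integral_coords p \<and> \<psi> p = k}"
proof -
  have "{p \<in> pairs x. \<psi> p = k} = {p \<in> pairs x. integral_coords p \<and> \<psi> p = k} \<union>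
      {p \<in> pairs x. \<not> integral_coords p \<and> \<psi> p = k}" by blast
  then have "card {p \<in> pairs x. \<psi> p = k} = card {p \<in> pairs x. integral_coords p \<and> \<psi> p = k} +
      card {p \<in> pairs x. \<not> integral_coords p \<and> \<psi> p = k}"
    by (simp only:) (rule card_Un_disjoint, use finite_pairs in auto)
  then show ?thesis by (simp add: card_integral_pairs[OF assms])
qed

lemma nonintegral_extreme:
  assumes "p \<in> pairs x" "\<not> integral_coords p"
  shows "0 < \<psi> p" "\<psi> p < n"
  using psi_extreme[of "fst p" "snd p" x] psi_le[OF assms(1)] assms by (auto simp: le_less intro: gr0I)

text \<open>The residue class of 0 modulo \<open>n\<close> consists of the sums 0 and
  \<open>n\<close>, whose box points are integral and number \<open>h {} 0 + h {} n = 2\<close>.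
  Every other class consists of a single sum and has the same size.\<close>

lemma card_pairs:
  assumes x: "regular x" and k: "0 < k" "k < n"
  shows "card {p \<in> pairs x. \<psi> p = k} = 2"
proof -
  have extreme: "card {p \<in> pairs x. \<psi> p = j} = 1" if "j = 0 \<or> j = n" for j
  proof -
    have "{p \<in> pairs x. \<not> integral_coords p \<and> \<psi> p = j} = {}"
      using nonintegral_extreme that by fastforce
    then have "card {p \<in> pairs x. \<psi> p = j} = h {} j"
      using card_pairs_split[OF x, of j] by (simp only: card.empty add_0_right)
    then show ?thesis using h_0[OF empty_in_S] h_n that by auto
  qed
  have eq: "n * card {p \<in> pairs x. \<psi> p mod n = j} = card (pairs x)" if "j < n" for j
    by (rule equidistributed[OF finite_pairs that]) (rule character_sum_pairs[OF x])
  have "{p \<in> pairs x. \<psi> p mod n = 0} = {p \<in> pairs x. \<psi> p = 0} \<union> {p \<in> pairs x. \<psi> p = n}"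
    using psi_le by (fastforce dest: dvd_imp_le simp: mod_eq_0_iff_dvd)
  then have "card {p \<in> pairs x. \<psi> p mod n = 0} = 2"
    using extreme[of 0] extreme[of n] n_pos finite_pairs by (simp add: card_Un_disjoint disjoint_iff)
  moreover have "{p \<in> pairs x. \<psi> p mod n = k} = {p \<in> pairs x. \<psi> p = k}"
    using k psi_le by (fastforce simp: le_less)
  ultimately have "n * card {p \<in> pairs x. \<psi> p = k} = n * 2"
    using eq[of 0] eq[of k] k by simp
  then show ?thesis using n_pos by simp
qed

lemma reduce_to_box:
  assumes x: "regular x" and I: "I \<in> tops" and l: "l \<in> L"
  shows "\<exists>b\<in>box x I. \<forall>i\<in>I. d I i \<bullet> l - d I i \<bullet> b \<in> \<int>"
proof -
  \<comment> \<open>The floor leaves a remainder in \<open>[0, 1)\<close>, the ceiling minus one a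
    remainder in \<open>(0, 1]\<close>, as the box requires.\<close>
  define m where "m i = (if d I i \<bullet> x > 0 then \<lfloor>d I i \<bullet> l\<rfloor> else \<lceil>d I i \<bullet> l\<rceil> - 1)" for i
  define b where "b = l - (\<Sum>i\<in>I. of_int (m i) *\<^sub>R v i)"
  have coord: "d I i \<bullet> b = d I i \<bullet> l - of_int (m i)" if "i \<in> I" for i
    using dual_inner_sum[OF I that order_refl] that by (simp add: b_def inner_diff_right)
  have "b \<in> L" unfolding b_def
    by (intro diff_mem l int_span_mem_L[OF topsD(1)[OF I]]) simp
  moreover have "lower x I i b" "upper x I i b" if "i \<in> I" for i
    unfolding lower_def upper_def coord[OF that] m_def by (simp; linarith)+
  ultimately have "b \<in> box x I" by (simp add: box_def)
  then show ?thesis using coord by (intro bexI[of _ b]) auto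
qed

text \<open>
  For \<open>n + 1\<close> vertices, write \<open>\<Sum> q\<^sub>i v\<^sub>i = 0\<close>.  Evaluating the coordinate sum of \<open>V - {i}\<close> on this
  relation gives \<open>q\<^sub>i = Q / (n M\<^sub>i)\<close> with \<open>Q = \<Sum> q\<^sub>i\<close> and integers \<open>M\<^sub>i \<ge> 1\<close>, hence
  \<open>\<Sum> 1 / M\<^sub>i = n\<close>, so that exactly two of the \<open>M\<^sub>i\<close> are \<open>2\<close> and the others are \<open>1\<close>.
\<close>

lemma half_sum_in_lattice:
  assumes V: "card V = n + 1"
  shows "\<exists>a b. a \<in> V \<and> b \<in> V \<and> a \<noteq> b \<and> (1 / 2) *\<^sub>R (v a + v b) \<in> L"
proof -
  have top: "V - {i} \<in> tops" if "i \<in> V" for i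
    using simplex_boundary(1)[OF V] V that finite_V by simp
  obtain i0 where i0: "i0 \<in> V" using V by (metis card.empty empty_iff equals0I Suc_eq_plus1 nat.distinct(1))
  define I0 where "I0 = V - {i0}"
  have I0: "I0 \<in> tops" "I0 \<subseteq> V" using top[OF i0] by (auto simp: I0_def)
  obtain x where x: "regular x" using exists_regular by blast
  \<comment> \<open>The negative of an interior point of the cone over \<open>I0\<close> lies in
    some closed maximal cone \<open>I1\<close>; adding the two expressions gives a linear relation
    with nonnegative coefficients.\<close>
  define p where "p = - (\<Sum>i\<in>I0. v i)"
  have p_span: "p \<in> span L"
    unfolding p_def by (intro span_neg edges_in_span[OF topsD(1)[OF I0(1)] order_refl])
  obtain z where z: "regular z"
    "\<forall>I\<in>tops. \<forall>i\<in>I. sgn (d I i \<bullet> z) = (if d I i \<bullet> p \<noteq> 0 then sgn (d I i \<bullet> p) else sgn (d I i \<bullet> x))"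
    using perturb_regular[OF p_span x, of "{}"] by blast
  obtain I1 where I1: "I1 \<in> tops" "\<forall>i\<in>I1. d I1 i \<bullet> z > 0"
    using degree_one[OF z(1)] by (auto simp: card_1_singleton_iff)
  have c_nonneg: "d I1 i \<bullet> p \<ge> 0" if "i \<in> I1" for i
  proof (rule ccontr)
    assume "\<not> d I1 i \<bullet> p \<ge> 0"
    then have "sgn (d I1 i \<bullet> z) = - 1" using z(2) I1(1) that by (auto simp: sgn_if)
    then show False using I1(2) that by (auto simp: sgn_if split: if_splits)
  qed
  have sub1: "I1 \<subseteq> V" using subset_V topsD(1)[OF I1(1)] .
  define q where "q i = of_bool (i \<in> I0) + (if i \<in> I1 then d I1 i \<bullet> p else 0)" for i
  have "(\<Sum>i\<in>V. q i *\<^sub>R v i) = (\<Sum>i\<in>V. of_bool (i \<in> I0) *\<^sub>R v i) + (\<Sum>i\<in>V. (if i \<in> I1 then d I1 i \<bullet> p else 0) *\<^sub>R v i)"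
    by (simp only: q_def scaleR_add_left sum.distrib)
  also have "(\<Sum>i\<in>V. of_bool (i \<in> I0) *\<^sub>R v i) = (\<Sum>i\<in>I0. v i)"
    by (rule sum.mono_neutral_cong_right) (use finite_V I0 in auto)
  also have "(\<Sum>i\<in>V. (if i \<in> I1 then d I1 i \<bullet> p else 0) *\<^sub>R v i) = (\<Sum>i\<in>I1. (d I1 i \<bullet> p) *\<^sub>R v i)"
    by (rule sum.mono_neutral_cong_right) (use finite_V sub1 in auto)
  also have "\<dots> = p"
    using dual_basis_expansion[OF topsD(4)[OF I1(1)], of p] p_span topsD(5)[OF I1(1)] by simp
  finally have relation: "(\<Sum>i\<in>V. q i *\<^sub>R v i) = 0" by (simp add: p_def)
  have q_pos0: "q i > 0" if "i \<in> I0" for i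
    using that c_nonneg[of i] by (auto simp: q_def)
  have q_nonneg: "q i \<ge> 0" for i
    using c_nonneg[of i] by (auto simp: q_def)
  define Q where "Q = (\<Sum>i\<in>V. q i)"
  have "I0 \<noteq> {}" using topsD(3)[OF I0(1)] n_pos by auto
  then obtain i1 where "i1 \<in> I0" by blast
  then have "i1 \<in> V" "q i1 > 0" using q_pos0 I0(2) by auto
  then have Q: "Q > 0" unfolding Q_def by (intro sum_pos2[OF finite_V]) (use q_nonneg in auto)
  have "\<exists>m::int. Q = real n * of_int m * q i" if i: "i \<in> V" for i
  proof -
    let ?I = "V - {i}"
    let ?s = "\<Sum>k\<in>?I. d ?I k"
    have I: "?I \<in> tops" by (rule top[OF i])
    obtain k1 :: int where "u \<bullet> v i = 1 + real n * of_int k1" using u_edge[OF i] by blast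
    moreover obtain k2 :: int where "(\<Sum>k\<in>?I. d ?I k \<bullet> v i) = u \<bullet> v i + real n * of_int k2"
      using coord_sum_cong[OF I, of "v i"] edge_mem[of "{i}" i] i by (auto simp: V_def)
    ultimately have own: "?s \<bullet> v i = 1 + real n * of_int (k1 + k2)"
      by (simp add: inner_sum_left algebra_simps)
    have other: "?s \<bullet> v j = 1" if "j \<in> ?I" for j
    proof -
      have "?s \<bullet> v j = (\<Sum>k\<in>?I. if k = j then 1 else 0)"
        unfolding inner_sum_left by (rule sum.cong) (use dual_inner[OF I] that in auto)
      then show ?thesis using that finite_V by simp
    qed
    have "0 = ?s \<bullet> (\<Sum>j\<in>V. q j *\<^sub>R v j)" by (simp add: relation)
    also have "\<dots> = (\<Sum>j\<in>V. q j * (?s \<bullet> v j))" by (simp add: inner_sum_right)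
    also have "\<dots> = q i * (?s \<bullet> v i) + (\<Sum>j\<in>?I. q j * (?s \<bullet> v j))"
      using finite_V i by (simp add: sum.remove)
    also have "(\<Sum>j\<in>?I. q j * (?s \<bullet> v j)) = Q - q i"
      using other finite_V i by (simp add: Q_def sum.remove)
    finally have "Q = real n * of_int (- (k1 + k2)) * q i"
      unfolding own by (simp add: algebra_simps)
    then show ?thesis ..
  qed
  then obtain M :: "'i \<Rightarrow> int" where M: "\<And>i. i \<in> V \<Longrightarrow> Q = real n * of_int (M i) * q i" by metis
  have M_pos: "M i \<ge> 1" if "i \<in> V" for i
  proof (rule ccontr)
    assume "\<not> M i \<ge> 1"
    then have "real_of_int (M i) \<le> 0" by simp
    then have "real n * of_int (M i) * q i \<le> 0"
      using q_nonneg[of i] by (simp add: mult_nonneg_nonpos mult_nonpos_nonneg)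
    then show False using Q M[OF that] by simp
  qed
  have qM: "q i = Q / real n * (1 / of_int (M i))" if "i \<in> V" for i
    using M[OF that] M_pos[OF that] n_pos by (simp add: field_simps)
  have "Q = (\<Sum>i\<in>V. Q / real n * (1 / of_int (M i)))"
    unfolding Q_def[of] by (rule sum.cong) (use qM Q_def in auto)
  also have "\<dots> = Q / real n * (\<Sum>i\<in>V. 1 / of_int (M i))" by (rule sum_distrib_left[symmetric])
  finally have "(\<Sum>i\<in>V. 1 / real_of_int (M i)) = real n"
    using Q n_pos by (simp add: field_simps)
  then have "(\<Sum>i\<in>V. 1 - 1 / real_of_int (M i)) = 1"
    using V by (simp add: sum_subtractf)
  from sum_unit_fractions[OF finite_V M_pos this] obtain a b where ab: "a \<in> V" "b \<in> V" "a \<noteq> b"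
    "M a = 2" "M b = 2" "\<forall>i\<in>V - {a, b}. M i = 1" by blast
  have "(\<Sum>i\<in>V. q i *\<^sub>R v i) = (Q / real n) *\<^sub>R (\<Sum>i\<in>V. (1 / of_int (M i)) *\<^sub>R v i)"
    unfolding scaleR_sum_right by (rule sum.cong) (use qM in auto)
  then have "(\<Sum>i\<in>V. (1 / real_of_int (M i)) *\<^sub>R v i) = 0"
    using relation Q n_pos by simp
  moreover have "(\<Sum>i\<in>V. (1 / real_of_int (M i)) *\<^sub>R v i) =
      (1 / 2) *\<^sub>R v a + ((1 / 2) *\<^sub>R v b + (\<Sum>i\<in>V - {a} - {b}. (1 / real_of_int (M i)) *\<^sub>R v i))"
    using finite_V ab by (simp add: sum.remove[of V a] sum.remove[of "V - {a}" b])
  moreover have "(\<Sum>i\<in>V - {a} - {b}. (1 / real_of_int (M i)) *\<^sub>R v i) = (\<Sum>i\<in>V - {a} - {b}. v i)"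
    by (rule sum.cong) (use ab(6) in auto)
  ultimately have "(1 / 2) *\<^sub>R (v a + v b) = - (\<Sum>i\<in>V - {a} - {b}. v i)"
    by (simp add: scaleR_add_right add.assoc eq_neg_iff_add_eq_0)
  moreover have "(\<Sum>i\<in>V - {a} - {b}. v i) \<in> L"
    by (rule sum_mem) (use edge_mem in \<open>auto simp: V_def\<close>)
  ultimately have "(1 / 2) *\<^sub>R (v a + v b) \<in> L" using uminus_mem by simp
  then show ?thesis using ab by blast
qed

text \<open>A non-integral box point takes one of the two places with its coordinate sum, so the
  h-number there is 1. This excludes \<open>n + 2\<close> vertices, while
  \<open>h {} 1 \<le> 2\<close> leaves only \<open>n + 1\<close> or \<open>n + 2\<close>.\<close>

lemma nonintegral_pairs_unique:
  assumes x: "regular x" and nontriv: "p0 \<in> pairs x" "\<not> integral_coords p0"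
  shows "2 \<le> n" "card V = n + 1"
proof -
  have psi0: "0 < \<psi> p0" "\<psi> p0 < n" using nonintegral_extreme[OF nontriv] by auto
  then show n2: "2 \<le> n" by simp
  have h_le: "h {} k \<le> 2" if "0 < k" "k < n" for k
    using card_pairs_split[OF x, of k] card_pairs[OF x that] by simp
  have fin: "finite {p \<in> pairs x. \<not> integral_coords p \<and> \<psi> p = \<psi> p0}" using finite_pairs by simp
  have "p0 \<in> {p \<in> pairs x. \<not> integral_coords p \<and> \<psi> p = \<psi> p0}" using nontriv by simp
  then have "card {p \<in> pairs x. \<not> integral_coords p \<and> \<psi> p = \<psi> p0} \<noteq> 0"
    unfolding card_0_eq[OF fin] by blast
  then have "h {} (\<psi> p0) < 2"
    using card_pairs_split[OF x, of "\<psi> p0"] card_pairs[OF x psi0] by simp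
  then have "card V \<noteq> n + 2" using h_ge_2[of "\<psi> p0"] psi0 by auto
  moreover have "h {} 1 \<ge> 1" by (rule h_positive[OF empty_in_S]) (use n_pos in simp)
  ultimately show "card V = n + 1" using card_V h_le[of 1] n2 by auto
qed

text \<open>
  The box points in the class of \<open>(v\<^sub>a + v\<^sub>b) / 2\<close> already account for all non-integral ones.
\<close>

lemma nonintegral_pairs_half:
  assumes x: "regular x" and V: "card V = n + 1" and n2: "2 \<le> n"
    and ab: "a \<in> V" "b \<in> V" "a \<noteq> b" "(1 / 2) *\<^sub>R (v a + v b) \<in> L"
  shows "{a, b} \<in> S" "k \<le> n - 2 \<Longrightarrow> h {a, b} k = 1"
    "(I, c) \<in> pairs x \<Longrightarrow> \<not> integral_coords (I, c) \<Longrightarrow>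
      {a, b} \<subseteq> I \<and> (\<forall>i\<in>I. d I i \<bullet> c - (if i \<in> {a, b} then 1 / 2 else 0) \<in> \<int>)"
proof -
  let ?K = "{a, b}"
  have "card (V - ?K) \<ge> 1" using V n2 ab finite_V by (simp add: card_Diff_subset)
  \<comment> \<open>Since \<open>n \<ge> 2\<close> there is a third vertex, and removing it leaves a
    maximal simplex containing \<open>a\<close> and \<open>b\<close>.\<close>
  then obtain j where j: "j \<in> V - ?K" by (metis card.empty ex_in_conv not_one_le_zero)
  then have "V - {j} \<in> tops"
    using simplex_boundary(1)[OF V] V finite_V by simp
  then show K: "?K \<in> S" using topsD(1) subset_closed[of "V - {j}" ?K] ab j by auto
  \<comment> \<open>The representative of the class of \<open>(v a + v b) / 2\<close> in the box of
    \<open>I\<close>: one half at \<open>a\<close> and \<open>b\<close>, and elsewhere 0 or 1 as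
    \<open>x\<close> dictates. The two halves shift its coordinate sum to
    \<open>1 + neg ?K x I\<close>.\<close>
  let ?c = "\<lambda>I. (1 / 2) *\<^sub>R (v a + v b) + (\<Sum>i\<in>{i \<in> I - ?K. d I i \<bullet> x < 0}. v i)"
  have coord: "d I i \<bullet> ?c I = (if i \<in> ?K then 1 / 2 else if d I i \<bullet> x < 0 then 1 else 0)"
    if I: "I \<in> star ?K" and i: "i \<in> I" for I i
  proof -
    have "a \<in> I" "b \<in> I" "I \<in> tops" using starD(1,2)[OF I] by auto
    then show ?thesis
      using dual_inner_edges[OF \<open>I \<in> tops\<close> i, of "{i \<in> I - ?K. d I i \<bullet> x < 0}"]
        dual_inner[OF \<open>I \<in> tops\<close> i, of a] dual_inner[OF \<open>I \<in> tops\<close> i, of b] i ab(3)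
      by (auto simp: inner_add_right)
  qed
  have mem: "(I, ?c I) \<in> pairs x" if I: "I \<in> star ?K" for I
  proof -
    note I' = starD(1)[OF I]
    have "(\<Sum>i\<in>{i \<in> I - ?K. d I i \<bullet> x < 0}. v i) \<in> L"
      by (rule sum_mem) (use edge_mem topsD(1)[OF I'] in auto)
    then have "?c I \<in> L" using ab(4) by (rule add_mem[rotated])
    moreover have "lower x I i (?c I)" "upper x I i (?c I)" if "i \<in> I" for i
      unfolding lower_def upper_def coord[OF I that] using regular_pos_iff[OF x I' that] by auto
    ultimately show ?thesis using I' by (simp add: pairs_def box_def)
  qed
  have nonint: "\<not> integral_coords (I, ?c I)" if I: "I \<in> star ?K" for I
  proof
    assume "integral_coords (I, ?c I)"
    moreover have "a \<in> I" using starD(2)[OF I] by simp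
    ultimately have "d I a \<bullet> ?c I \<in> \<int>" unfolding integral_coords_def by simp
    moreover have "d I a \<bullet> ?c I = 1 / 2"
      unfolding coord[OF I \<open>a \<in> I\<close>] by simp
    ultimately show False using half_not_Ints by (simp only:)
  qed
  have psi: "\<psi> (I, ?c I) = 1 + neg ?K x I" if I: "I \<in> star ?K" for I
  proof -
    have I': "finite I" "?K \<subseteq> I" using starD(1,2)[OF I] topsD(2) by auto
    have "real (\<psi> (I, ?c I)) = (\<Sum>i\<in>I. if i \<in> ?K then 1 / 2 else if d I i \<bullet> x < 0 then 1 else 0)"
      unfolding psi_eq[OF mem[OF I]] by (rule sum.cong) (use coord[OF I] in auto)
    also have "\<dots> = (\<Sum>i\<in>?K. 1 / 2) + (\<Sum>i\<in>I - ?K. if d I i \<bullet> x < 0 then 1 else 0)"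
      unfolding sum.subset_diff[OF I'(2) I'(1)] by (subst add.commute) (auto intro!: arg_cong2[where f="(+)"] sum.cong)
    also have "(\<Sum>i\<in>I - ?K. if d I i \<bullet> x < 0 then 1 else 0) = real (neg ?K x I)"
      using I'(1) by (simp add: sum.If_cases neg_def Int_def)
    finally show ?thesis using ab(3) by simp
  qed
  let ?N = "\<lambda>k. {p \<in> pairs x. \<not> integral_coords p \<and> \<psi> p = k}"
  have image: "(\<lambda>I. (I, ?c I)) ` {I \<in> star ?K. neg ?K x I = k} \<subseteq> ?N (k + 1)" for k
    using mem nonint psi by auto
  have inj: "card ((\<lambda>I. (I, ?c I)) ` {I \<in> star ?K. neg ?K x I = k}) = h ?K k" for k
    unfolding h_eq[OF K x] by (rule card_image, rule inj_onI) simp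
  \<comment> \<open>Of the two box points with a given intermediate sum one is integral, which
    leaves room for a single non-integral one.\<close>
  have cardN: "card (?N (k + 1)) = 1" if "k \<le> n - 2" for k
  proof -
    have "0 < k + 1" "k + 1 < n" using that n2 by auto
    then show ?thesis
      using card_pairs_split[OF x, of "k + 1"] card_pairs[OF x, of "k + 1"] simplex_boundary(2)[OF V, of "k + 1"] by simp
  qed
  have card_K: "n - card ?K = n - 2" using ab(3) by simp
  have finN: "finite (?N k)" for k using finite_pairs by simp
  have h1: "h ?K k = 1" and full: "(\<lambda>I. (I, ?c I)) ` {I \<in> star ?K. neg ?K x I = k} = ?N (k + 1)"
    if "k \<le> n - 2" for k
  proof -
    have "h ?K k \<ge> 1" using h_positive[OF K] card_K that by simp
    moreover have "h ?K k \<le> card (?N (k + 1))"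
      using card_mono[OF finN image[of k]] inj[of k] by simp
    ultimately show "h ?K k = 1" using cardN[OF that] by simp
    then show "(\<lambda>I. (I, ?c I)) ` {I \<in> star ?K. neg ?K x I = k} = ?N (k + 1)"
      using card_subset_eq[OF finN image[of k]] inj[of k] cardN[OF that] by simp
  qed
  show "h {a, b} k = 1" if "k \<le> n - 2" using h1[OF that] .
  assume p: "(I, c) \<in> pairs x" "\<not> integral_coords (I, c)"
  define k where "k = \<psi> (I, c) - 1"
  have "\<psi> (I, c) = k + 1" "k \<le> n - 2" using nonintegral_extreme[OF p] by (auto simp: k_def)
  then have "(I, c) \<in> ?N (k + 1)" using p by simp
  then have "(I, c) \<in> (\<lambda>I. (I, ?c I)) ` {I \<in> star ?K. neg ?K x I = k}"
    unfolding full[OF \<open>k \<le> n - 2\<close>] .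
  then have I: "I \<in> star ?K" and c: "c = ?c I" by auto
  have "d I i \<bullet> c - (if i \<in> ?K then 1 / 2 else 0) \<in> \<int>" if "i \<in> I" for i
    unfolding c coord[OF I that] by simp
  then show "{a, b} \<subseteq> I \<and> (\<forall>i\<in>I. d I i \<bullet> c - (if i \<in> {a, b} then 1 / 2 else 0) \<in> \<int>)"
    using starD(2)[OF I] by blast
qed

text \<open>The last clause is the uniqueness of the simplex with non-empty \<open>H_hat\<close> in
  coordinates: an element of \<open>H_hat\<close> at \<open>K\<close> is represented by a lattice
  point over \<open>K\<close> none of whose coefficients is integral.\<close>

theorem classification:
  "(\<forall>I\<in>tops. \<forall>l\<in>L. \<forall>i\<in>I. d I i \<bullet> l \<in> \<int>) \<and> (\<forall>k. 0 < k \<and> k < n \<longrightarrow> h {} k = 2) \<or>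
   2 \<le> n \<and> (\<forall>k\<le>n. h {} k = 1) \<and>
   (\<exists>a b. a \<noteq> b \<and> {a, b} \<in> S \<and> (1 / 2) *\<^sub>R (v a + v b) \<in> L \<and> (\<forall>k\<le>n - 2. h {a, b} k = 1) \<and>
     (\<forall>K c. K \<in> S \<longrightarrow> K \<noteq> {} \<longrightarrow> (\<Sum>i\<in>K. c i *\<^sub>R v i) \<in> L \<longrightarrow> (\<forall>i\<in>K. c i \<notin> \<int>) \<longrightarrow>
        K = {a, b} \<and> (\<forall>i\<in>K. c i - 1 / 2 \<in> \<int>)))"
proof -
  obtain x where x: "regular x" using exists_regular by blast
  show ?thesis
  proof (cases "\<forall>p\<in>pairs x. integral_coords p")
    case True
    have "d I i \<bullet> l \<in> \<int>" if I: "I \<in> tops" and l: "l \<in> L" and i: "i \<in> I" for I l i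
    proof -
      obtain b where b: "b \<in> box x I" "d I i \<bullet> l - d I i \<bullet> b \<in> \<int>"
        using reduce_to_box[OF x I l] i by blast
      then have "d I i \<bullet> b \<in> \<int>" using True I i by (force simp: pairs_def integral_coords_def)
      with b(2) have "(d I i \<bullet> l - d I i \<bullet> b) + d I i \<bullet> b \<in> \<int>" by (rule Ints_add)
      then show ?thesis by simp
    qed
    moreover have "h {} k = 2" if "0 < k" "k < n" for k
    proof -
      have "{p \<in> pairs x. \<not> integral_coords p \<and> \<psi> p = k} = {}" using True by blast
      then show ?thesis
        using card_pairs_split[OF x, of k] card_pairs[OF x that] by (simp only: card.empty add_0_right)
    qed
    ultimately show ?thesis by (intro disjI1 conjI allI ballI impI) auto
  next
    case False
    then obtain p0 where "p0 \<in> pairs x" "\<not> integral_coords p0" by blast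
    note n2 = nonintegral_pairs_unique(1)[OF x this] and V = nonintegral_pairs_unique(2)[OF x this]
    obtain a b where ab: "a \<in> V" "b \<in> V" "a \<noteq> b" "(1 / 2) *\<^sub>R (v a + v b) \<in> L"
      using half_sum_in_lattice[OF V] by (elim exE conjE)
    note half = nonintegral_pairs_half[OF x V n2 ab]
    have "K = {a, b} \<and> (\<forall>i\<in>K. c i - 1 / 2 \<in> \<int>)"
      if K: "K \<in> S" "K \<noteq> {}" and l: "(\<Sum>i\<in>K. c i *\<^sub>R v i) \<in> L" and c: "\<forall>i\<in>K. c i \<notin> \<int>" for K c
    proof -
      obtain I where I: "I \<in> star K" using star_nonempty[OF K(1)] by blast
      note I' = starD(1,2)[OF I]
      let ?l = "\<Sum>i\<in>K. c i *\<^sub>R v i"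
      have coord: "d I i \<bullet> ?l = (if i \<in> K then c i else 0)" if "i \<in> I" for i
        using dual_inner_sum[OF I'(1) that I'(2)] .
      obtain e where e: "e \<in> box x I" "\<forall>i\<in>I. d I i \<bullet> ?l - d I i \<bullet> e \<in> \<int>"
        using reduce_to_box[OF x I'(1) l] by blast
      have p: "(I, e) \<in> pairs x" using e(1) I'(1) by (simp add: pairs_def)
      have int_iff: "d I i \<bullet> e \<in> \<int> \<longleftrightarrow> i \<notin> K" if "i \<in> I" for i
      proof -
        have "d I i \<bullet> ?l - d I i \<bullet> e \<in> \<int>" using e(2) that by blast
        then have "d I i \<bullet> e \<in> \<int> \<longleftrightarrow> d I i \<bullet> ?l \<in> \<int>"
          by (metis Ints_diff Ints_add diff_add_cancel diff_diff_eq2 add_diff_cancel_left' add_diff_cancel_right')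
        then show ?thesis using coord[OF that] c by auto
      qed
      have "\<not> integral_coords (I, e)"
        using K(2) I'(2) int_iff unfolding integral_coords_def by fastforce
      from half(3)[OF p this] have he: "{a, b} \<subseteq> I"
        "\<And>i. i \<in> I \<Longrightarrow> d I i \<bullet> e - (if i \<in> {a, b} then 1 / 2 else 0) \<in> \<int>" by auto
      have "i \<in> K \<longleftrightarrow> i \<in> {a, b}" if "i \<in> I" for i
      proof (cases "i \<in> {a, b}")
        case True
        have "d I i \<bullet> e \<notin> \<int>"
        proof
          assume "d I i \<bullet> e \<in> \<int>"
          then have "d I i \<bullet> e - (d I i \<bullet> e - 1 / 2) \<in> \<int>" using he(2)[OF that] True by (intro Ints_diff) auto
          then show False using half_not_Ints by simp
        qed
        then show ?thesis using int_iff[OF that] True by blast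
      next
        case False
        then show ?thesis using he(2)[OF that] int_iff[OF that] by simp
      qed
      then have Kab: "K = {a, b}" using I'(2) he(1) by blast
      have "c i - 1 / 2 \<in> \<int>" if "i \<in> K" for i
      proof -
        have "i \<in> I" using that I'(2) by blast
        then have "d I i \<bullet> ?l - d I i \<bullet> e \<in> \<int>" "d I i \<bullet> e - 1 / 2 \<in> \<int>"
          using e(2) he(2)[of i] that Kab by auto
        then have "(d I i \<bullet> ?l - d I i \<bullet> e) + (d I i \<bullet> e - 1 / 2) \<in> \<int>" by (rule Ints_add)
        then show ?thesis using coord[OF \<open>i \<in> I\<close>] that by simp
      qed
      then show ?thesis using Kab by blast
    qed
    note uniq = this
    show ?thesis
    proof (rule disjI2, intro conjI allI impI, rule n2, rule simplex_boundary(2)[OF V], assumption,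
        rule exI[of _ a], rule exI[of _ b], intro conjI allI impI)
      show "a \<noteq> b" "{a, b} \<in> S" "(1 / 2) *\<^sub>R (v a + v b) \<in> L"
        using ab(3,4) half(1) by simp_all
      show "h {a, b} k = 1" if "k \<le> n - 2" for k using half(2)[OF that] .
    next
      fix K c
      assume "K \<in> S" "K \<noteq> {}" "(\<Sum>i\<in>K. c i *\<^sub>R v i) \<in> L" "\<forall>i\<in>K. c i \<notin> \<int>"
      note u = uniq[OF this]
      show "K = {a, b}" using u by (rule conjunct1)
      show "\<forall>i\<in>K. c i - 1 / 2 \<in> \<int>" using u by (rule conjunct2)
    qed
  qed
qed

end

section \<open>Lattices, rays and cones\<close>

lemma is_lattice_discrete_subgroup:
  fixes L :: "'a::euclidean_space set"
  assumes "is_lattice L"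
  shows "discrete_subgroup L"
proof -
  obtain B where B: "independent B" "int_span B = L"
    using assms by (auto simp: is_lattice_def lattice_basis_def)
  have finB: "finite B" using B(1) by (rule independent_imp_finite)
  have fam: "indep_family (\<lambda>b. b) B" using B(1) finB by (simp add: indep_family_def)
  let ?e = "dual_basis_vec (\<lambda>b. b) B"
  have "finite (L \<inter> X)" if bdd: "bounded X" for X
  proof -
    obtain M where M: "\<And>x. x \<in> X \<Longrightarrow> norm x \<le> M" using bdd by (auto simp: bounded_iff)
    define N where "N b = \<lceil>norm (?e b) * M\<rceil>" for b
    have "L \<inter> X \<subseteq> (\<lambda>c. \<Sum>b\<in>B. of_int (c b) *\<^sub>R b) ` (PiE B (\<lambda>b. {- N b..N b}))"
    proof
      fix l assume l: "l \<in> L \<inter> X"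
      then obtain c :: "'a \<Rightarrow> int" where c: "l = (\<Sum>b\<in>B. of_int (c b) *\<^sub>R b)"
        using B(2) by (auto simp: int_span_def)
      have "c b \<in> {- N b..N b}" if b: "b \<in> B" for b
      proof -
        have "of_int (c b) = ?e b \<bullet> l"
          unfolding c using inner_dual_sum[OF fam b order_refl, of "\<lambda>b. of_int (c b)"] b by simp
        then have "\<bar>real_of_int (c b)\<bar> \<le> norm (?e b) * norm l"
          using Cauchy_Schwarz_ineq2[of "?e b" l] by simp
        also have "\<dots> \<le> norm (?e b) * M" using M l by (intro mult_left_mono) auto
        also have "\<dots> \<le> of_int (N b)" by (simp add: N_def)
        finally show ?thesis by (auto simp: abs_le_iff)
      qed
      then have "restrict c B \<in> PiE B (\<lambda>b. {- N b..N b})" by auto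
      moreover have "l = (\<Sum>b\<in>B. of_int (restrict c B b) *\<^sub>R b)" unfolding c by (rule sum.cong) auto
      ultimately show "l \<in> (\<lambda>c. \<Sum>b\<in>B. of_int (c b) *\<^sub>R b) ` (PiE B (\<lambda>b. {- N b..N b}))" by blast
    qed
    moreover have "finite (PiE B (\<lambda>b. {- N b..N b}))" by (intro finite_PiE finB) auto
    ultimately show ?thesis by (meson finite_surj)
  qed
  then show ?thesis
    using int_span_subgroup[where A = B] B(2) by (auto simp: discrete_subgroup_def)
qed

section \<open>Rays, primitive generators and orthogonal quotients\<close>

definition ray :: "'a::euclidean_space \<Rightarrow> 'a set" where
  "ray s = {r *\<^sub>R s | r. r \<ge> 0}"

text \<open>Discreteness gives a smallest factor in \<open>(0, 1]\<close>. A non-integral multiple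
  in \<open>L\<close> would have a fractional part leading to a smaller one.\<close>

lemma ray_primitive_exists:
  fixes s :: "'a::euclidean_space"
  assumes L: "discrete_subgroup L" and s: "s \<in> L" "s \<noteq> 0"
  shows "\<exists>r>0. primitive L (r *\<^sub>R s)"
proof -
  define R where "R = {r. 0 < r \<and> r \<le> 1 \<and> r *\<^sub>R s \<in> L}"
  have "(\<lambda>r. r *\<^sub>R s) ` R \<subseteq> L \<inter> cball 0 (norm s)"
    by (auto simp: R_def mult_left_le_one_le)
  moreover have "finite (L \<inter> cball 0 (norm s))" using L by (simp add: discrete_subgroup_def)
  ultimately have "finite ((\<lambda>r. r *\<^sub>R s) ` R)" by (rule finite_subset)
  then have fin: "finite R" by (rule finite_imageD) (use s in \<open>auto intro: inj_onI\<close>)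
  have one: "1 \<in> R" using s by (simp add: R_def)
  define r where "r = Min R"
  have r: "r \<in> R" "\<And>r'. r' \<in> R \<Longrightarrow> r \<le> r'"
    using fin one by (auto simp: r_def intro: Min_in)
  have "c \<in> \<int>" if c: "c *\<^sub>R r *\<^sub>R s \<in> L" for c
  proof (rule ccontr)
    assume "c \<notin> \<int>"
    have "c *\<^sub>R r *\<^sub>R s - of_int \<lfloor>c\<rfloor> *\<^sub>R (r *\<^sub>R s) \<in> L"
      using L c discrete_subgroup_mult[OF L, of "r *\<^sub>R s"] r(1) by (auto simp: discrete_subgroup_def R_def)
    moreover have "c *\<^sub>R r *\<^sub>R s - of_int \<lfloor>c\<rfloor> *\<^sub>R (r *\<^sub>R s) = (frac c * r) *\<^sub>R s"
      by (simp add: frac_def algebra_simps)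
    moreover have f: "0 < frac c" "frac c < 1" using \<open>c \<notin> \<int>\<close> by (auto simp: frac_lt_1 frac_gt_0_iff)
    moreover have "0 < r" "r \<le> 1" using r(1) by (auto simp: R_def)
    moreover have "frac c * r < r" using f \<open>0 < r\<close> by simp
    moreover from this have "frac c * r \<le> 1" using \<open>r \<le> 1\<close> by linarith
    ultimately have "frac c * r \<in> R" by (simp add: R_def)
    then show False using r(2) \<open>frac c * r < r\<close> by force
  qed
  moreover have "0 < r" "r *\<^sub>R s \<in> L" using r(1) by (auto simp: R_def)
  ultimately show ?thesis using s(2) by (auto simp: primitive_def)
qed

text \<open>Two primitive vectors on one ray are integral multiples of each other with positive
  factors, hence equal; this makes the definite description in \<open>edge_vec\<close>
  meaningful.\<close>

lemma edge_vec_ray: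
  assumes L: "discrete_subgroup (lat M)" and s: "s \<in> lat M" "s \<noteq> 0" and C: "cone_of M {i} = ray s"
  shows "edge_vec M i \<in> lat M \<and> (\<exists>r>0. edge_vec M i = r *\<^sub>R s)"
proof -
  obtain r where r: "r > 0" "primitive (lat M) (r *\<^sub>R s)"
    using ray_primitive_exists[OF L s] by blast
  have "edge_vec M i = r *\<^sub>R s"
    unfolding edge_vec_def C
  proof (rule the_equality)
    show "r *\<^sub>R s \<in> ray s \<and> primitive (lat M) (r *\<^sub>R s)" using r by (auto simp: ray_def)
    fix v assume v: "v \<in> ray s \<and> primitive (lat M) v"
    then obtain q where q: "v = q *\<^sub>R s" "q \<ge> 0" by (auto simp: ray_def)
    have "q > 0" using v q by (auto simp: primitive_def le_less)
    have "(q / r) *\<^sub>R (r *\<^sub>R s) \<in> lat M" "(r / q) *\<^sub>R v \<in> lat M"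
      using v r q \<open>q > 0\<close> by (auto simp: primitive_def)
    then have "q / r \<in> \<int>" "r / q \<in> \<int>" using v r(2) by (auto simp: primitive_def)
    moreover have "q / r > 0" "r / q > 0" using \<open>q > 0\<close> r(1) by auto
    ultimately have "q / r \<ge> 1" "r / q \<ge> 1" by (auto elim!: Ints_cases)
    then have "q = r" using \<open>q > 0\<close> r(1) by (simp add: field_simps)
    then show "v = r *\<^sub>R s" using q by simp
  qed
  then show ?thesis using r by (auto simp: primitive_def)
qed

text \<open>Dimension one confines the cone to a line, and strong convexity excludes the opposite
  half of it.\<close>

lemma one_dim_cone_is_ray:
  fixes C :: "'a::euclidean_space set"
  assumes "rational_polyhedral_cone L C" "strongly_convex C" "dim C = 1"
  shows "\<exists>s\<in>L. s \<noteq> 0 \<and> C = ray s"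
proof -
  obtain S where S: "S \<subseteq> L" "C = convex_cone hull S"
    using assms(1) by (auto simp: rational_polyhedral_cone_def)
  have "\<exists>s\<in>S. s \<noteq> 0"
  proof (rule ccontr)
    assume "\<not> (\<exists>s\<in>S. s \<noteq> 0)"
    then have "C \<subseteq> {0}" unfolding S(2) by (intro hull_minimal) (auto simp: convex_cone_iff)
    then have "dim C = 0" by simp
    then show False using assms(3) by simp
  qed
  then obtain s where s: "s \<in> S" "s \<noteq> 0" by blast
  have cc: "convex_cone C" unfolding S(2) by (rule convex_cone_convex_cone_hull)
  have sC: "s \<in> C" unfolding S(2) using s(1) by (rule hull_inc)
  have "span {s} = span C"
    by (rule dim_eq_span) (use sC s assms(3) in auto)
  have "C = ray s"
  proof (intro equalityI subsetI)
    fix x assume x: "x \<in> C"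
    then have "x \<in> span {s}" using \<open>span {s} = span C\<close> span_base by blast
    then obtain r where r: "x = r *\<^sub>R s" by (auto simp: span_singleton)
    have "r \<ge> 0"
    proof (rule ccontr)
      assume "\<not> r \<ge> 0"
      then have "1 / - r \<ge> 0" by simp
      then have "(1 / - r) *\<^sub>R x \<in> C" using cc x unfolding convex_cone_iff by blast
      then have "- s \<in> C" using \<open>\<not> r \<ge> 0\<close> r by simp
      then have "s \<in> C \<inter> uminus ` C" using sC by (auto intro: image_eqI[of _ _ "- s"])
      then show False using assms(2) s(2) by (auto simp: strongly_convex_def)
    qed
    then show "x \<in> ray s" using r by (auto simp: ray_def)
  next
    fix x assume "x \<in> ray s"
    then show "x \<in> C" using cc sC by (auto simp: ray_def convex_cone_iff)
  qed
  then show ?thesis using s S(1) by blast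
qed

lemma ray_scale: "r > 0 \<Longrightarrow> ray (r *\<^sub>R s) = ray s"
proof (intro equalityI subsetI)
  assume r: "r > 0"
  fix x
  show "x \<in> ray s" if "x \<in> ray (r *\<^sub>R s)"
  proof -
    obtain q where "x = q *\<^sub>R r *\<^sub>R s" "q \<ge> 0" using \<open>x \<in> ray (r *\<^sub>R s)\<close> by (auto simp: ray_def)
    then show ?thesis using r unfolding ray_def by (intro CollectI exI[of _ "q * r"]) simp
  qed
  show "x \<in> ray (r *\<^sub>R s)" if "x \<in> ray s"
  proof -
    obtain q where "x = q *\<^sub>R s" "q \<ge> 0" using \<open>x \<in> ray s\<close> by (auto simp: ray_def)
    then show ?thesis using r by (auto simp: ray_def intro!: exI[of _ "q / r"])
  qed
qed

lemma cone_over_rays: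
  fixes v :: "'i \<Rightarrow> 'a::euclidean_space"
  assumes "finite I"
  shows "convex_cone hull (\<Union>i\<in>I. ray (v i)) = {\<Sum>i\<in>I. c i *\<^sub>R v i | c. \<forall>i\<in>I. c i \<ge> 0}" (is "_ = ?R")
proof
  show "convex_cone hull (\<Union>i\<in>I. ray (v i)) \<subseteq> ?R"
  proof (rule hull_minimal)
    show "(\<Union>i\<in>I. ray (v i)) \<subseteq> ?R"
    proof
      fix x assume "x \<in> (\<Union>i\<in>I. ray (v i))"
      then obtain j r where "j \<in> I" "x = r *\<^sub>R v j" "r \<ge> 0" by (auto simp: ray_def)
      then have "x = (\<Sum>i\<in>I. (if i = j then r else 0) *\<^sub>R v i)" "\<forall>i\<in>I. (if i = j then r else 0) \<ge> 0"
        using assms by (auto simp: if_distrib[of "\<lambda>r. r *\<^sub>R _"] cong: if_cong)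
      then show "x \<in> ?R" by (intro CollectI exI[of _ "\<lambda>i. if i = j then r else 0"] conjI)
    qed
    show "convex_cone ?R"
      unfolding convex_cone_iff
    proof (intro conjI ballI allI impI)
      show "0 \<in> ?R" by (intro CollectI exI[of _ "\<lambda>_. 0"]) auto
    next
      fix x y assume "x \<in> ?R" "y \<in> ?R"
      then obtain c e where c: "x = (\<Sum>i\<in>I. c i *\<^sub>R v i)" "\<forall>i\<in>I. c i \<ge> 0"
        and e: "y = (\<Sum>i\<in>I. e i *\<^sub>R v i)" "\<forall>i\<in>I. e i \<ge> 0" by auto
      then show "x + y \<in> ?R"
        by (intro CollectI exI[of _ "\<lambda>i. c i + e i"]) (simp add: scaleR_add_left sum.distrib)
    next
      fix x and r :: real assume "x \<in> ?R" "r \<ge> 0"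
      then obtain c where c: "x = (\<Sum>i\<in>I. c i *\<^sub>R v i)" "\<forall>i\<in>I. c i \<ge> 0" by auto
      then show "r *\<^sub>R x \<in> ?R" using \<open>r \<ge> 0\<close>
        by (intro CollectI exI[of _ "\<lambda>i. r * c i"]) (simp add: scaleR_sum_right)
    qed
  qed
next
  let ?C = "convex_cone hull (\<Union>i\<in>I. ray (v i))"
  show "?R \<subseteq> ?C"
  proof clarify
    fix c :: "'i \<Rightarrow> real" assume c: "\<forall>i\<in>I. c i \<ge> 0"
    have mem: "c i *\<^sub>R v i \<in> ?C" if "i \<in> I" for i
      by (rule hull_inc) (use that c in \<open>auto simp: ray_def\<close>)
    have "(\<Sum>i\<in>J. c i *\<^sub>R v i) \<in> ?C" if "J \<subseteq> I" for J
      using finite_subset[OF that assms] that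
      by (induction J rule: finite_induct) (auto simp: convex_cone_hull_contains_0 intro: convex_cone_hull_add mem)
    then show "(\<Sum>i\<in>I. c i *\<^sub>R v i) \<in> ?C" by blast
  qed
qed

lemma quot_map:
  fixes U :: "'a::euclidean_space set"
  assumes "subspace U"
  shows quot_map_orth: "y \<in> U \<Longrightarrow> quot_map U x \<bullet> y = 0"
    and quot_map_diff: "x - quot_map U x \<in> U"
    and quot_map_eqI: "(\<And>y. y \<in> U \<Longrightarrow> z \<bullet> y = 0) \<Longrightarrow> x - z \<in> U \<Longrightarrow> quot_map U x = z"
proof -
  have comp: "z \<in> orthogonal_comp U \<longleftrightarrow> (\<forall>y\<in>U. z \<bullet> y = 0)" for z
    by (auto simp: orthogonal_comp_def orthogonal_def inner_commute)
  have unique: "y = z" if "y \<in> orthogonal_comp U \<and> x - y \<in> U" "z \<in> orthogonal_comp U \<and> x - z \<in> U" for y z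
  proof -
    have "(x - z) - (x - y) \<in> U" using that assms by (blast intro: subspace_diff)
    then have "y - z \<in> U" by simp
    then have "(y - z) \<bullet> (y - z) = 0" using that by (simp add: comp inner_diff_left)
    then show ?thesis by simp
  qed
  obtain p q where pq: "p \<in> span U" "\<And>w. w \<in> span U \<Longrightarrow> orthogonal q w" "x = p + q"
    using orthogonal_subspace_decomp_exists[of U x] by metis
  have "q \<in> orthogonal_comp U" using pq(2) by (simp add: comp orthogonal_def span_base)
  moreover have "x - q \<in> U" using pq(1,3) assms by (simp add: span_eq_iff[THEN iffD2])
  ultimately have ex: "\<exists>!y. y \<in> orthogonal_comp U \<and> x - y \<in> U"
    using unique by blast
  have props: "quot_map U x \<in> orthogonal_comp U \<and> x - quot_map U x \<in> U"
    unfolding quot_map_def by (rule theI'[OF ex])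
  then show "y \<in> U \<Longrightarrow> quot_map U x \<bullet> y = 0" "x - quot_map U x \<in> U" by (auto simp: comp)
  show "quot_map U x = z" if "\<And>y. y \<in> U \<Longrightarrow> z \<bullet> y = 0" "x - z \<in> U"
    by (rule unique[OF props]) (use that comp in auto)
qed

lemma quot_map_linear:
  fixes U :: "'a::euclidean_space set"
  assumes "subspace U"
  shows "linear (quot_map U)"
proof (rule linearI)
  note q = quot_map_orth[OF assms] quot_map_diff[OF assms]
  fix x y and c :: real
  have "x + y - (quot_map U x + quot_map U y) = (x - quot_map U x) + (y - quot_map U y)" by simp
  also have "\<dots> \<in> U" using q(2) assms by (blast intro: subspace_add)
  finally show "quot_map U (x + y) = quot_map U x + quot_map U y"
    by (intro quot_map_eqI[OF assms]) (auto simp: inner_add_left q(1))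
  have "c *\<^sub>R x - c *\<^sub>R quot_map U x = c *\<^sub>R (x - quot_map U x)" by (simp add: scaleR_diff_right)
  also have "\<dots> \<in> U" using q(2) assms by (blast intro: subspace_scale)
  finally show "quot_map U (c *\<^sub>R x) = c *\<^sub>R quot_map U x"
    by (intro quot_map_eqI[OF assms]) (auto simp: q(1))
qed

section \<open>Multi-fans and projected multi-fans\<close>

locale multi_fan =
  fixes \<Delta> :: "('i, 'a::euclidean_space) multi_fan" and n :: nat
  assumes smf: "simplicial_multi_fan n \<Delta>"
begin

lemma lat_discrete: "discrete_subgroup (lat \<Delta>)"
  using smf is_lattice_discrete_subgroup by (auto simp: simplicial_multi_fan_def)

lemma simplex:
  assumes "I \<in> splx \<Delta>"
  shows simplex_finite: "finite I" and simplex_subset: "J \<subseteq> I \<Longrightarrow> J \<in> splx \<Delta>"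
    and simplex_top: "\<exists>I'\<in>splx \<Delta>. I \<subseteq> I' \<and> card I' = n"
    and simplex_dim: "dim (cone_of \<Delta> I) = card I"
    and simplex_hull: "cone_of \<Delta> I = convex_cone hull (\<Union>i\<in>I. cone_of \<Delta> {i})"
    and simplex_rational: "rational_polyhedral_cone (lat \<Delta>) (cone_of \<Delta> I)"
    and simplex_strongly_convex: "strongly_convex (cone_of \<Delta> I)"
proof -
  note S = smf[unfolded simplicial_multi_fan_def]
  have "\<forall>I\<in>splx \<Delta>. finite I \<and> card I \<le> n" using S by (elim conjE)
  from bspec[OF this assms] show "finite I" by (rule conjunct1)
  have "\<forall>I\<in>splx \<Delta>. \<forall>J. J \<subseteq> I \<longrightarrow> J \<in> splx \<Delta>" using S by (elim conjE)
  then show "J \<in> splx \<Delta>" if "J \<subseteq> I" using assms that by blast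
  have "\<forall>J\<in>splx \<Delta>. \<exists>I\<in>splx_of \<Delta> n. J \<subseteq> I" using S by (elim conjE)
  from bspec[OF this assms] show "\<exists>I'\<in>splx \<Delta>. I \<subseteq> I' \<and> card I' = n" unfolding splx_of_def by blast
  have "\<forall>I\<in>splx \<Delta>. rational_polyhedral_cone (lat \<Delta>) (cone_of \<Delta> I) \<and> strongly_convex (cone_of \<Delta> I) \<and>
      dim (cone_of \<Delta> I) = card I \<and> (\<forall>J. J \<subseteq> I \<longrightarrow> cone_of \<Delta> J face_of cone_of \<Delta> I) \<and>
      cone_of \<Delta> I = convex_cone hull (\<Union>i\<in>I. cone_of \<Delta> {i})"
    using S by (elim conjE)
  from bspec[OF this assms]
  show "dim (cone_of \<Delta> I) = card I" "cone_of \<Delta> I = convex_cone hull (\<Union>i\<in>I. cone_of \<Delta> {i})"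
    "rational_polyhedral_cone (lat \<Delta>) (cone_of \<Delta> I)" "strongly_convex (cone_of \<Delta> I)"
    by blast+
qed

lemma finite_splx: "finite (splx \<Delta>)"
  using smf unfolding simplicial_multi_fan_def by (elim conjE)

lemma edge:
  assumes "{i} \<in> splx \<Delta>"
  shows edge_vec_mem: "edge_vec \<Delta> i \<in> lat \<Delta>" and cone_singleton: "cone_of \<Delta> {i} = ray (edge_vec \<Delta> i)"
proof -
  obtain s where s: "s \<in> lat \<Delta>" "s \<noteq> 0" "cone_of \<Delta> {i} = ray s"
    using one_dim_cone_is_ray[OF simplex_rational[OF assms] simplex_strongly_convex[OF assms]] simplex_dim[OF assms] by auto
  obtain r where r: "r > 0" "edge_vec \<Delta> i = r *\<^sub>R s" "edge_vec \<Delta> i \<in> lat \<Delta>"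
    using edge_vec_ray[OF lat_discrete s] by blast
  show "edge_vec \<Delta> i \<in> lat \<Delta>" by (rule r(3))
  show "cone_of \<Delta> {i} = ray (edge_vec \<Delta> i)" unfolding s(3) r(2) ray_scale[OF r(1)] ..
qed

lemma vertex_of_simplex: "I \<in> splx \<Delta> \<Longrightarrow> i \<in> I \<Longrightarrow> {i} \<in> splx \<Delta>"
  by (rule simplex_subset) auto

lemma cone_eq:
  assumes "I \<in> splx \<Delta>"
  shows "cone_of \<Delta> I = {\<Sum>i\<in>I. c i *\<^sub>R edge_vec \<Delta> i | c. \<forall>i\<in>I. c i \<ge> 0}"
proof -
  have "(\<Union>i\<in>I. cone_of \<Delta> {i}) = (\<Union>i\<in>I. ray (edge_vec \<Delta> i))"
    by (rule SUP_cong) (use cone_singleton vertex_of_simplex[OF assms] in auto)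
  then show ?thesis
    unfolding simplex_hull[OF assms] using cone_over_rays[OF simplex_finite[OF assms], of "edge_vec \<Delta>"] by simp
qed

lemma span_cone:
  assumes I: "I \<in> splx \<Delta>"
  shows "span (cone_of \<Delta> I) = span (edge_vec \<Delta> ` I)"
proof (rule span_eq[THEN iffD2], intro conjI subsetI)
  fix x assume "x \<in> cone_of \<Delta> I"
  then show "x \<in> span (edge_vec \<Delta> ` I)"
    unfolding cone_eq[OF I] span_family[OF simplex_finite[OF I]] by blast
next
  fix x assume "x \<in> edge_vec \<Delta> ` I"
  then obtain j where j: "j \<in> I" "x = edge_vec \<Delta> j" by blast
  have "x = (\<Sum>i\<in>I. of_bool (i = j) *\<^sub>R edge_vec \<Delta> i)"
    using j simplex_finite[OF I] by (simp add: of_bool_def if_distrib[of "\<lambda>r. r *\<^sub>R _"] cong: if_cong)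
  then have "x \<in> cone_of \<Delta> I"
    unfolding cone_eq[OF I] by (intro CollectI exI[of _ "\<lambda>i. of_bool (i = j)"]) auto
  then show "x \<in> span (cone_of \<Delta> I)" by (rule span_base)
qed

text \<open>The cone has dimension \<open>card I\<close> and is spanned by the edge vectors, so
  these are distinct and independent.\<close>

lemma indep_edges:
  assumes I: "I \<in> splx \<Delta>"
  shows "indep_family (edge_vec \<Delta>) I"
proof -
  have fin: "finite I" by (rule simplex_finite[OF I])
  have dim: "dim (edge_vec \<Delta> ` I) = card I"
    using simplex_dim[OF I] span_cone[OF I] by (metis dim_span)
  have le: "card (edge_vec \<Delta> ` I) \<le> card I" by (rule card_image_le[OF fin])
  have "dim (edge_vec \<Delta> ` I) \<le> card (edge_vec \<Delta> ` I)"
    by (rule dim_le_card) (use fin in \<open>auto intro: span_base\<close>)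
  then have card: "card (edge_vec \<Delta> ` I) = card I" using dim le by simp
  have "independent (edge_vec \<Delta> ` I)"
    by (rule card_le_dim_spanning[OF order_refl]) (use fin dim card in \<open>auto intro: span_base\<close>)
  then show ?thesis using fin card by (simp add: indep_family_def eq_card_imp_inj_on)
qed

lemma dual_vec_eq: "K \<in> splx \<Delta> \<Longrightarrow> dual_vec \<Delta> K i = dual_basis_vec (edge_vec \<Delta>) K i"
  unfolding dual_vec_def dual_basis_vec_def by (simp add: span_cone)

sublocale lattice_fan "lat \<Delta>" "splx \<Delta>" n "edge_vec \<Delta>" "weight \<Delta>"
proof
  show "span (edge_vec \<Delta> ` I) = span (lat \<Delta>)" if I: "I \<in> splx \<Delta>" "card I = n" for I
  proof (rule subspace_dim_equal)
    show "span (edge_vec \<Delta> ` I) \<subseteq> span (lat \<Delta>)"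
      by (rule span_mono) (use edge_vec_mem vertex_of_simplex[OF I(1)] in auto)
    have "dim (lat \<Delta>) = n" using smf by (simp add: simplicial_multi_fan_def)
    moreover have "dim (span (edge_vec \<Delta> ` I)) = n"
      using simplex_dim[OF I(1)] span_cone[OF I(1)] I(2) by (metis dim_span)
    ultimately show "dim (span (lat \<Delta>)) \<le> dim (span (edge_vec \<Delta> ` I))" by simp
  qed auto
  show "edge_vec \<Delta> i \<in> lat \<Delta>" if "I \<in> splx \<Delta>" "i \<in> I" for I i
    using edge_vec_mem vertex_of_simplex that by blast
qed (use lat_discrete in \<open>auto intro: simplex_finite simplex_subset simplex_top indep_edges finite_splx\<close>)

lemma mf_dim_eq: "mf_dim \<Delta> = n"
  using smf by (simp add: simplicial_multi_fan_def mf_dim_def)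

lemma tops_eq: "tops = top_splx \<Delta>"
  by (simp add: tops_def splx_of_def mf_dim_eq)

end

section \<open>The projected multi-fan along a simplex\<close>

locale projected_fan = multi_fan +
  fixes K :: "'a set"
  assumes K: "K \<in> splx \<Delta>"
begin

abbreviation \<pi> :: "'b \<Rightarrow> 'b" where "\<pi> \<equiv> quot_map (span (cone_of \<Delta> K))"
abbreviation P :: "('a, 'b) multi_fan" where "P \<equiv> projected \<Delta> K"
abbreviation e :: "'a \<Rightarrow> 'b" where "e \<equiv> edge_vec \<Delta>"

lemma linear_proj: "linear \<pi>"
  by (rule quot_map_linear) simp

lemma proj_edge: "i \<in> K \<Longrightarrow> \<pi> (e i) = 0"
  by (rule quot_map_eqI) (auto simp: span_cone[OF K] span_base)

text \<open>Hence the dual vectors outside \<open>K\<close> already lie in the orthogonal complement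
  that realises the quotient, and they serve there as coordinates up to scaling.\<close>

lemma dual_vanishes:
  assumes "I \<in> star K" "i \<in> I - K" "y \<in> span (cone_of \<Delta> K)"
  shows "d I i \<bullet> y = 0"
proof -
  obtain c where "y = (\<Sum>j\<in>K. c j *\<^sub>R e j)"
    using assms(3) unfolding span_cone[OF K] span_family[OF simplex_finite[OF K]] by blast
  then show ?thesis
    using dual_inner_sum[OF starD(1)[OF assms(1)] _ starD(2)[OF assms(1)], of i c] assms(2) by auto
qed

lemma dual_proj:
  assumes "I \<in> star K" "i \<in> I - K"
  shows "d I i \<bullet> \<pi> y = d I i \<bullet> y"
  using dual_vanishes[OF assms quot_map_diff[of "span (cone_of \<Delta> K)" y]] by (simp add: inner_diff_right)

lemma proj_dual:
  assumes "I \<in> star K" "i \<in> I - K"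
  shows "\<pi> (d I i) = d I i"
  by (rule quot_map_eqI) (use dual_vanishes[OF assms] in \<open>auto simp: span_zero\<close>)

lemma splx_P: "J \<in> splx P \<longleftrightarrow> J \<inter> K = {} \<and> J \<union> K \<in> splx \<Delta>"
  by (simp add: projected_def)

lemma lat_P: "lat P = \<pi> ` lat \<Delta>"
  by (simp add: projected_def)

lemma weight_P: "weight P J = weight \<Delta> (J \<union> K)"
  by (simp add: projected_def weight_def)

lemma proj_sum:
  assumes "J \<inter> K = {}" "finite J"
  shows "\<pi> (\<Sum>i\<in>J \<union> K. c i *\<^sub>R e i) = (\<Sum>i\<in>J. c i *\<^sub>R \<pi> (e i))"
proof -
  have "\<pi> (\<Sum>i\<in>J \<union> K. c i *\<^sub>R e i) = (\<Sum>i\<in>J \<union> K. c i *\<^sub>R \<pi> (e i))"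
    by (simp add: linear_sum[OF linear_proj] linear_cmul[OF linear_proj])
  also have "\<dots> = (\<Sum>i\<in>J. c i *\<^sub>R \<pi> (e i))"
    by (rule sum.mono_neutral_right) (use assms simplex_finite[OF K] proj_edge in auto)
  finally show ?thesis .
qed

lemma splx_P_finite: "J \<in> splx P \<Longrightarrow> finite J"
  using simplex_finite by (auto simp: splx_P)

lemma cone_P:
  assumes J: "J \<in> splx P"
  shows "cone_of P J = {\<Sum>i\<in>J. c i *\<^sub>R \<pi> (e i) | c. \<forall>i\<in>J. c i \<ge> 0}"
proof -
  have JK: "J \<inter> K = {}" "J \<union> K \<in> splx \<Delta>" using J by (auto simp: splx_P)
  have "cone_of P J = \<pi> ` {\<Sum>i\<in>J \<union> K. c i *\<^sub>R e i | c. \<forall>i\<in>J \<union> K. c i \<ge> 0}"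
    by (simp add: projected_def cone_eq[OF JK(2)])
  also have "\<dots> = {\<Sum>i\<in>J. c i *\<^sub>R \<pi> (e i) | c. \<forall>i\<in>J. c i \<ge> 0}"
  proof (intro equalityI subsetI)
    fix x assume "x \<in> \<pi> ` {\<Sum>i\<in>J \<union> K. c i *\<^sub>R e i | c. \<forall>i\<in>J \<union> K. c i \<ge> 0}"
    then obtain c where "x = \<pi> (\<Sum>i\<in>J \<union> K. c i *\<^sub>R e i)" "\<forall>i\<in>J \<union> K. c i \<ge> 0" by blast
    then show "x \<in> {\<Sum>i\<in>J. c i *\<^sub>R \<pi> (e i) | c. \<forall>i\<in>J. c i \<ge> 0}"
      unfolding proj_sum[OF JK(1) splx_P_finite[OF J]] by blast
  next
    fix x assume "x \<in> {\<Sum>i\<in>J. c i *\<^sub>R \<pi> (e i) | c. \<forall>i\<in>J. c i \<ge> 0}"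
    then obtain c where c: "x = (\<Sum>i\<in>J. c i *\<^sub>R \<pi> (e i))" "\<forall>i\<in>J. c i \<ge> 0" by blast
    define c' where "c' i = (if i \<in> J then c i else 0)" for i
    have "x = (\<Sum>i\<in>J. c' i *\<^sub>R \<pi> (e i))" unfolding c(1) by (rule sum.cong) (auto simp: c'_def)
    then have "x = \<pi> (\<Sum>i\<in>J \<union> K. c' i *\<^sub>R e i)"
      unfolding proj_sum[OF JK(1) splx_P_finite[OF J]] .
    moreover have "\<forall>i\<in>J \<union> K. c' i \<ge> 0" using c(2) by (simp add: c'_def)
    ultimately show "x \<in> \<pi> ` {\<Sum>i\<in>J \<union> K. c i *\<^sub>R e i | c. \<forall>i\<in>J \<union> K. c i \<ge> 0}" by blast
  qed
  finally show ?thesis .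
qed

lemma star_P: "I \<in> star K \<Longrightarrow> I - K \<in> splx P" "I \<in> star K \<Longrightarrow> card (I - K) = n - card K"
  "I \<in> star K \<Longrightarrow> (I - K) \<union> K = I"
  using starD[of I K] topsD(1-3)[of I] by (auto simp: splx_P card_Diff_subset Un_absorb2)

lemma star_of_P:
  assumes "J \<in> splx P" "card J = n - card K"
  shows "J \<union> K \<in> star K" "J \<union> K - K = J"
proof -
  obtain I where I: "I \<in> star K" using star_nonempty[OF K] by blast
  then have "card K \<le> n" using starD[OF I] topsD(2,3)[OF starD(1)[OF I]] by (metis card_mono)
  moreover have "card (J \<union> K) = card J + card K"
    using assms splx_P_finite simplex_finite[OF K] by (intro card_Un_disjoint) (auto simp: splx_P)
  ultimately show "J \<union> K \<in> star K" using assms by (auto simp: star_def tops_def splx_P)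
  show "J \<union> K - K = J" using assms by (auto simp: splx_P)
qed

lemma star_of_splx_P:
  assumes "J \<in> splx P"
  obtains I where "I \<in> star K" "J \<subseteq> I - K"
proof -
  have J: "J \<inter> K = {}" "J \<union> K \<in> splx \<Delta>" using assms by (auto simp: splx_P)
  obtain I where "I \<in> star (J \<union> K)" using star_nonempty[OF J(2)] by blast
  then show ?thesis using J(1) by (intro that[of I]) (auto simp: star_def)
qed

text \<open>Lift a bounded point of the projected lattice. The coordinates outside \<open>K\<close>
  are determined by the point and bounded; those in \<open>K\<close> are reduced to
  \<open>[0, 1)\<close> by subtracting integral multiples of edge vectors, which the projection
  kills.\<close>

lemma discrete_P: "discrete_subgroup (lat P)"
  unfolding discrete_subgroup_def
proof (intro conjI ballI allI impI)
  show "0 \<in> lat P" unfolding lat_P using zero_mem linear_0[OF linear_proj] by (metis imageI)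
  show "x - y \<in> lat P" if "x \<in> lat P" "y \<in> lat P" for x y
  proof -
    obtain a b where "a \<in> lat \<Delta>" "x = \<pi> a" "b \<in> lat \<Delta>" "y = \<pi> b"
      using \<open>x \<in> lat P\<close> \<open>y \<in> lat P\<close> unfolding lat_P by blast
    then have "x - y = \<pi> (a - b)" "a - b \<in> lat \<Delta>"
      using diff_mem by (simp_all add: linear_diff[OF linear_proj])
    then show ?thesis unfolding lat_P by blast
  qed
  fix B :: "'b set" assume "bounded B"
  then obtain M where M: "\<And>x. x \<in> B \<Longrightarrow> norm x \<le> M" by (auto simp: bounded_iff)
  obtain I where I: "I \<in> star K" using star_nonempty[OF K] by blast
  note I' = starD(1,2)[OF I]
  define N where "N = Max (insert 1 ((\<lambda>i. norm (d I i) * M) ` (I - K)))"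
  have finI: "finite I" using topsD(2)[OF I'(1)] .
  have N: "1 \<le> N" "i \<in> I - K \<Longrightarrow> norm (d I i) * M \<le> N" for i
    using finI by (auto simp: N_def intro!: Max_ge)
  have "lat P \<inter> B \<subseteq> \<pi> ` {l \<in> lat \<Delta>. \<forall>i\<in>I. \<bar>d I i \<bullet> l\<bar> \<le> N}"
  proof
    fix y assume y: "y \<in> lat P \<inter> B"
    then obtain l where l: "l \<in> lat \<Delta>" "y = \<pi> l" unfolding lat_P by blast
    define s where "s = (\<Sum>j\<in>K. of_int \<lfloor>d I j \<bullet> l\<rfloor> *\<^sub>R e j)"
    have s_mem: "s \<in> lat \<Delta>" unfolding s_def by (rule int_span_mem_L[OF K order_refl])
    have "\<pi> s = 0"
      using proj_edge by (simp add: s_def linear_sum[OF linear_proj] linear_cmul[OF linear_proj])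
    then have "y = \<pi> (l - s)" using l by (simp add: linear_diff[OF linear_proj])
    moreover have "\<bar>d I i \<bullet> (l - s)\<bar> \<le> N" if i: "i \<in> I" for i
    proof -
      have s: "d I i \<bullet> s = (if i \<in> K then of_int \<lfloor>d I i \<bullet> l\<rfloor> else 0)"
        unfolding s_def by (rule dual_inner_sum[OF I'(1) i I'(2)])
      show ?thesis
      proof (cases "i \<in> K")
        case True
        have "d I i \<bullet> (l - s) = frac (d I i \<bullet> l)" using s True by (simp add: inner_diff_right frac_def)
        then show ?thesis using N(1) frac_ge_0[of "d I i \<bullet> l"] frac_lt_1[of "d I i \<bullet> l"] by simp
      next
        case False
        then have "d I i \<bullet> (l - s) = d I i \<bullet> y"
          using s l i dual_proj[OF I, of i l] by (simp add: inner_diff_right)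
        then have "\<bar>d I i \<bullet> (l - s)\<bar> \<le> norm (d I i) * norm y" using Cauchy_Schwarz_ineq2 by simp
        also have "\<dots> \<le> norm (d I i) * M" using M y by (intro mult_left_mono) auto
        also have "\<dots> \<le> N" using N(2) False i by blast
        finally show ?thesis .
      qed
    qed
    ultimately show "y \<in> \<pi> ` {l \<in> lat \<Delta>. \<forall>i\<in>I. \<bar>d I i \<bullet> l\<bar> \<le> N}"
      using diff_mem[OF l(1) s_mem] by blast
  qed
  then show "finite (lat P \<inter> B)" using finite_bounded_coords[OF I'(1)] by (meson finite_surj)
qed

lemma edge_vec_P:
  assumes "{i} \<in> splx P"
  shows "edge_vec P i \<in> lat P \<and> (\<exists>r>0. edge_vec P i = r *\<^sub>R \<pi> (e i))"
proof (rule edge_vec_ray[OF discrete_P])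
  obtain I where I: "I \<in> star K" "{i} \<subseteq> I - K" using star_of_splx_P[OF assms] .
  have "{i} \<in> splx \<Delta>" using assms simplex_subset[of "{i} \<union> K" "{i}"] by (auto simp: splx_P)
  then show "\<pi> (e i) \<in> lat P" unfolding lat_P using edge_vec_mem by blast
  have "d I i \<bullet> \<pi> (e i) = 1"
    using dual_proj[OF I(1), of i "e i"] dual_inner[OF starD(1)[OF I(1)], of i i] I(2) by simp
  then show "\<pi> (e i) \<noteq> 0" by auto
  show "cone_of P {i} = ray (\<pi> (e i))"
  proof (intro equalityI subsetI)
    show "x \<in> ray (\<pi> (e i))" if "x \<in> cone_of P {i}" for x
      using that unfolding cone_P[OF assms] ray_def by auto
    fix x assume "x \<in> ray (\<pi> (e i))"
    then obtain r where "x = r *\<^sub>R \<pi> (e i)" "r \<ge> 0" by (auto simp: ray_def)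
    then show "x \<in> cone_of P {i}"
      unfolding cone_P[OF assms] by (intro CollectI exI[of _ "\<lambda>_. r"]) auto
  qed
qed

text \<open>The projection of a primitive vector can be a proper multiple of a primitive one. The
  correcting factor is positive, so the signs of coordinates are unaffected.\<close>

definition scale :: "'a \<Rightarrow> real" where
  "scale i = (SOME r. r > 0 \<and> edge_vec P i = r *\<^sub>R \<pi> (e i))"

lemma scale:
  assumes "J \<in> splx P" "i \<in> J"
  shows "scale i > 0" "edge_vec P i = scale i *\<^sub>R \<pi> (e i)" "edge_vec P i \<in> lat P"
proof -
  have "{i} \<union> K \<in> splx \<Delta>"
    by (rule simplex_subset[of "J \<union> K"]) (use assms in \<open>auto simp: splx_P\<close>)
  then have "{i} \<in> splx P" using assms by (auto simp: splx_P)
  from edge_vec_P[OF this] have ex: "\<exists>r. r > 0 \<and> edge_vec P i = r *\<^sub>R \<pi> (e i)" and "edge_vec P i \<in> lat P" by auto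
  then show "edge_vec P i \<in> lat P" by simp
  from someI_ex[OF ex] show "scale i > 0" "edge_vec P i = scale i *\<^sub>R \<pi> (e i)"
    unfolding scale_def by auto
qed

lemma dual_P_inner:
  assumes I: "I \<in> star K" and ij: "i \<in> I - K" "j \<in> I - K"
  shows "((1 / scale i) *\<^sub>R d I i) \<bullet> edge_vec P j = (if j = i then 1 else 0)"
proof -
  note s = scale[OF star_P(1)[OF I] ij(1)] scale[OF star_P(1)[OF I] ij(2)]
  have "d I i \<bullet> \<pi> (e j) = (if j = i then 1 else 0)"
    using dual_proj[OF I ij(1), of "e j"] dual_inner[OF starD(1)[OF I], of i j] ij by simp
  then show ?thesis using s by auto
qed

lemma indep_family_P: "I \<in> star K \<Longrightarrow> indep_family (edge_vec P) (I - K)"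
  by (rule indep_familyI[where d = "\<lambda>i. (1 / scale i) *\<^sub>R d I i"])
    (use topsD(2) starD(1) dual_P_inner in auto)

lemma proj_in_span_P:
  assumes I: "I \<in> star K" and y: "y \<in> span (lat \<Delta>)"
  shows "\<pi> y \<in> span (edge_vec P ` (I - K))"
proof -
  have "y \<in> span (e ` I)" using y topsD(5)[OF starD(1)[OF I]] by simp
  then obtain c where c: "y = (\<Sum>i\<in>I. c i *\<^sub>R e i)"
    using span_family[OF topsD(2)[OF starD(1)[OF I]]] by blast
  have "\<pi> y = (\<Sum>i\<in>I - K. c i *\<^sub>R \<pi> (e i))"
    using proj_sum[of "I - K" c] star_P(3)[OF I] topsD(2)[OF starD(1)[OF I]] c by auto
  also have "\<dots> \<in> span (edge_vec P ` (I - K))"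
  proof (intro span_sum span_scale)
    fix i assume i: "i \<in> I - K"
    have "\<pi> (e i) = (1 / scale i) *\<^sub>R edge_vec P i"
      using scale[OF star_P(1)[OF I] i] by simp
    then show "\<pi> (e i) \<in> span (edge_vec P ` (I - K))" using i by (simp add: span_scale span_base)
  qed
  finally show ?thesis .
qed

lemma span_P:
  assumes I: "I \<in> star K"
  shows "span (edge_vec P ` (I - K)) = span (lat P)"
proof (rule span_eq[THEN iffD2], intro conjI subsetI)
  show "x \<in> span (lat P)" if "x \<in> edge_vec P ` (I - K)" for x
    using that scale(3)[OF star_P(1)[OF I]] by (auto intro: span_base)
  show "x \<in> span (edge_vec P ` (I - K))" if "x \<in> lat P" for x
    using that proj_in_span_P[OF I] unfolding lat_P by (auto intro: span_base)
qed

lemma dual_P: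
  assumes I: "I \<in> star K" and i: "i \<in> I - K"
  shows "dual_basis_vec (edge_vec P) (I - K) i = (1 / scale i) *\<^sub>R d I i"
proof (rule dual_basis_vec_unique)
  show "(1 / scale i) *\<^sub>R d I i \<in> span (edge_vec P ` (I - K))"
    using proj_in_span_P[OF I, of "d I i"] proj_dual[OF I i] dual_in_span[OF starD(1)[OF I], of i] i
    by (simp add: span_scale)
qed (rule dual_P_inner[OF I i])

sublocale P: lattice_fan "lat P" "splx P" "n - card K" "edge_vec P" "weight P"
proof
  show "discrete_subgroup (lat P)" by (rule discrete_P)
  have "inj_on (\<lambda>J. J \<union> K) (splx P)" by (rule inj_onI) (auto simp: splx_P)
  moreover have "(\<lambda>J. J \<union> K) ` splx P \<subseteq> splx \<Delta>" by (auto simp: splx_P)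
  ultimately show "finite (splx P)" using finite_splx by (meson finite_imageD finite_subset)
  show "finite J" if "J \<in> splx P" for J using splx_P_finite that .
  show "J' \<in> splx P" if "J \<in> splx P" "J' \<subseteq> J" for J J'
    using that simplex_subset[of "J \<union> K" "J' \<union> K"] by (auto simp: splx_P)
  show "\<exists>I\<in>splx P. J \<subseteq> I \<and> card I = n - card K" if J: "J \<in> splx P" for J
    using star_of_splx_P[OF J] star_P by metis
  show "edge_vec P i \<in> lat P" if "J \<in> splx P" "i \<in> J" for J i using scale(3)[OF that] .
  show "indep_family (edge_vec P) J" "span (edge_vec P ` J) = span (lat P)" if "J \<in> splx P" "card J = n - card K" for J
    using indep_family_P span_P star_of_P[OF that] by metis+
qed

lemma P_tops: "P.tops = (\<lambda>I. I - K) ` star K"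
proof (intro equalityI subsetI)
  fix J assume "J \<in> P.tops"
  then have "J \<in> splx P" "card J = n - card K" by (auto simp: P.tops_def)
  from star_of_P[OF this] show "J \<in> (\<lambda>I. I - K) ` star K" by (metis image_eqI)
next
  fix J assume "J \<in> (\<lambda>I. I - K) ` star K"
  then show "J \<in> P.tops" using star_P by (auto simp: P.tops_def)
qed

lemma inj_star: "inj_on (\<lambda>I. I - K) (star K)"
  by (rule inj_onI) (metis star_P(3))

lemma mf_dim_P: "mf_dim P = n - card K"
proof -
  obtain I where I: "I \<in> star K" using star_nonempty[OF K] by blast
  have "dim (lat P) = dim (edge_vec P ` (I - K))" using span_P[OF I] by (metis dim_span)
  also have "\<dots> = card (I - K)"
    using indep_family_P[OF I] by (simp add: indep_family_def dim_eq_card_independent card_image)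
  finally show ?thesis using star_P(2)[OF I] by (simp add: mf_dim_def)
qed

lemma P_tops_eq: "P.tops = top_splx P"
  by (simp add: P.tops_def splx_of_def mf_dim_P)

lemma span_cone_P:
  assumes I: "I \<in> star K"
  shows "span (cone_of P (I - K)) = span (edge_vec P ` (I - K))"
proof (rule span_eq[THEN iffD2], intro conjI subsetI)
  note J = star_P(1)[OF I]
  fix x
  show "x \<in> span (edge_vec P ` (I - K))" if "x \<in> cone_of P (I - K)"
  proof -
    obtain c where "x = (\<Sum>i\<in>I - K. c i *\<^sub>R \<pi> (e i))" using \<open>x \<in> cone_of P (I - K)\<close> unfolding cone_P[OF J] by blast
    moreover have "\<pi> (e i) \<in> span (edge_vec P ` (I - K))" if "i \<in> I - K" for i
      using proj_in_span_P[OF I] edge_in_span[OF topsD(1)[OF starD(1)[OF I]]] that by blast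
    ultimately show ?thesis by (auto intro!: span_sum span_scale)
  qed
  show "x \<in> span (cone_of P (I - K))" if "x \<in> edge_vec P ` (I - K)"
  proof -
    obtain j where j: "j \<in> I - K" "x = edge_vec P j" using \<open>x \<in> edge_vec P ` (I - K)\<close> by blast
    have "x = (\<Sum>i\<in>I - K. (if i = j then scale j else 0) *\<^sub>R \<pi> (e i))"
      using j scale(2)[OF J j(1)] splx_P_finite[OF J] by (simp add: if_distrib[of "\<lambda>r. r *\<^sub>R _"] cong: if_cong)
    then have "x \<in> cone_of P (I - K)"
      unfolding cone_P[OF J] using scale(1)[OF J j(1)]
      by (intro CollectI exI[of _ "\<lambda>i. if i = j then scale j else 0"]) auto
    then show ?thesis by (rule span_base)
  qed
qed

lemma proj_mem_cone_P:
  assumes I: "I \<in> star K" and x: "regular x"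
  shows "\<pi> x \<in> cone_of P (I - K) \<longleftrightarrow> (\<forall>i\<in>I - K. d I i \<bullet> x > 0)"
proof
  note J = star_P(1)[OF I]
  note I' = starD(1,2)[OF I]
  {
    assume "\<pi> x \<in> cone_of P (I - K)"
    then obtain c where c: "\<pi> x = (\<Sum>i\<in>I - K. c i *\<^sub>R \<pi> (e i))" "\<forall>i\<in>I - K. c i \<ge> 0"
      unfolding cone_P[OF J] by blast
    show "\<forall>i\<in>I - K. d I i \<bullet> x > 0"
    proof
      fix i assume i: "i \<in> I - K"
      have "d I i \<bullet> x = d I i \<bullet> (\<Sum>i\<in>I - K. c i *\<^sub>R e i)"
        using c(1) dual_proj[OF I i, of x] dual_proj[OF I i, of "\<Sum>i\<in>I - K. c i *\<^sub>R e i"]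
        by (simp add: linear_sum[OF linear_proj] linear_cmul[OF linear_proj])
      also have "\<dots> = c i" using dual_inner_sum[OF I'(1), of i "I - K" c] i by auto
      finally have "d I i \<bullet> x \<ge> 0" using c(2) i by simp
      then show "d I i \<bullet> x > 0" using x I'(1) i by (force simp: regular_def)
    qed
  next
    assume pos: "\<forall>i\<in>I - K. d I i \<bullet> x > 0"
    have "(\<Sum>i\<in>I. (d I i \<bullet> x) *\<^sub>R e i) = x"
      using dual_basis_expansion[OF topsD(4)[OF I'(1)]] topsD(5)[OF I'(1)] x by (simp add: regular_def)
    then have "\<pi> x = (\<Sum>i\<in>I - K. (d I i \<bullet> x) *\<^sub>R \<pi> (e i))"
      using proj_sum[of "I - K" "\<lambda>i. d I i \<bullet> x"] star_P(3)[OF I] topsD(2)[OF I'(1)] by auto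
    then show "\<pi> x \<in> cone_of P (I - K)"
      unfolding cone_P[OF J] using pos less_imp_le by (intro CollectI exI[of _ "\<lambda>i. d I i \<bullet> x"]) auto
  }
qed

text \<open>A cone of smaller dimension misses some \<open>i\<close> of a maximal simplex above it,
  and \<open>d I i\<close> vanishes on its span but not at \<open>x\<close>.\<close>

lemma generic_proj:
  assumes x: "regular x"
  shows "generic P (\<pi> x)"
  unfolding generic_def
proof (intro conjI ballI impI notI)
  obtain I where I: "I \<in> star K" using star_nonempty[OF K] by blast
  show "\<pi> x \<in> span (lat P)"
    using proj_in_span_P[OF I] x span_P[OF I] by (auto simp: regular_def)
  fix J assume J: "J \<in> splx P" and dim: "dim (cone_of P J) < mf_dim P" and mem: "\<pi> x \<in> span (cone_of P J)"
  obtain I where I: "I \<in> star K" "J \<subseteq> I - K" using star_of_splx_P[OF J] .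
  have "J \<noteq> I - K"
  proof
    assume "J = I - K"
    then have "span (cone_of P J) = span (lat P)" using span_cone_P[OF I(1)] span_P[OF I(1)] by simp
    then have "dim (cone_of P J) = mf_dim P" unfolding mf_dim_def by (metis dim_span)
    then show False using dim by simp
  qed
  then obtain i where i: "i \<in> I - K" "i \<notin> J" using I(2) by blast
  have "d I i \<bullet> y = 0" if y: "y \<in> cone_of P J" for y
  proof -
    obtain c where c: "y = (\<Sum>j\<in>J. c j *\<^sub>R \<pi> (e j))" using y unfolding cone_P[OF J] by blast
    have "d I i \<bullet> \<pi> (e j) = 0" if "j \<in> J" for j
      using dual_proj[OF I(1) i(1)] dual_inner[OF starD(1)[OF I(1)], of i j] that i I(2) by auto
    then show ?thesis unfolding c by (simp add: inner_sum_right)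
  qed
  then have "orthogonal (d I i) (\<pi> x)"
    by (intro orthogonal_to_span[OF mem]) (simp add: orthogonal_def)
  then have "d I i \<bullet> x = 0" using dual_proj[OF I(1) i(1)] by (simp add: orthogonal_def)
  then show False using x starD(1)[OF I(1)] i(1) by (auto simp: regular_def)
qed

lemma pre_complete_sum:
  assumes x: "regular x"
  shows "(\<Sum>J | J \<in> top_splx P \<and> \<pi> x \<in> cone_of P J. weight P J) =
    (\<Sum>I | I \<in> star K \<and> (\<forall>i\<in>I - K. d I i \<bullet> x > 0). weight \<Delta> I)"
proof (rule sum.reindex_bij_witness[of _ "\<lambda>I. I - K" "\<lambda>J. J \<union> K"])
  fix J assume "J \<in> {J. J \<in> top_splx P \<and> \<pi> x \<in> cone_of P J}"
  then have J: "J \<in> splx P" "card J = n - card K" "\<pi> x \<in> cone_of P J"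
    by (auto simp: splx_of_def mf_dim_P)
  note s = star_of_P[OF J(1,2)]
  show "J \<union> K - K = J" by (rule s(2))
  show "J \<union> K \<in> {I. I \<in> star K \<and> (\<forall>i\<in>I - K. d I i \<bullet> x > 0)}"
    using proj_mem_cone_P[OF s(1) x] s J(3) by simp
  show "weight \<Delta> (J \<union> K) = weight P J" by (simp add: weight_P)
next
  fix I assume "I \<in> {I. I \<in> star K \<and> (\<forall>i\<in>I - K. d I i \<bullet> x > 0)}"
  then have I: "I \<in> star K" "\<forall>i\<in>I - K. d I i \<bullet> x > 0" by auto
  show "I - K \<union> K = I" by (rule star_P(3)[OF I(1)])
  show "I - K \<in> {J. J \<in> top_splx P \<and> \<pi> x \<in> cone_of P J}"
    using I proj_mem_cone_P[OF I(1) x] P_tops P_tops_eq by auto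
qed

end

locale complete_fan = multi_fan +
  assumes complete_fan: "complete_multi_fan \<Delta>"

sublocale complete_fan \<subseteq> complete_lattice_fan "lat \<Delta>" "splx \<Delta>" n "edge_vec \<Delta>" "weight \<Delta>"
proof
  fix K x y assume K: "K \<in> splx \<Delta>" and xy: "regular x" "regular y"
  interpret projected_fan \<Delta> n K by unfold_locales (rule K)
  obtain c where "\<forall>v. generic P v \<longrightarrow> (\<Sum>J | J \<in> top_splx P \<and> v \<in> cone_of P J. weight P J) = c"
    using complete_fan K by (auto simp: complete_multi_fan_def pre_complete_def)
  then have "(\<Sum>J | J \<in> top_splx P \<and> \<pi> x \<in> cone_of P J. weight P J) =
      (\<Sum>J | J \<in> top_splx P \<and> \<pi> y \<in> cone_of P J. weight P J)"
    using generic_proj[OF xy(1)] generic_proj[OF xy(2)] by simp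
  then show "(\<Sum>I | I \<in> star K \<and> (\<forall>i\<in>I - K. d I i \<bullet> x > 0). weight \<Delta> I) =
      (\<Sum>I | I \<in> star K \<and> (\<forall>i\<in>I - K. d I i \<bullet> y > 0). weight \<Delta> I)"
    using pre_complete_sum xy by simp
qed

locale projected_complete_fan = complete_fan + projected_fan
begin

lemma P_dual_inner:
  assumes "I \<in> star K" "i \<in> I - K"
  shows "P.d (I - K) i \<bullet> x = (1 / scale i) * (d I i \<bullet> x)" "scale i > 0"
  using dual_P[OF assms] scale(1)[OF star_P(1)[OF assms(1)] assms(2)] by auto

text \<open>The quotient is realised inside \<open>span (lat \<Delta>)\<close>, but
  \<open>x'\<close> may lie on hyperplanes that are invisible in the link; a perturbation avoids
  them and keeps the signs in the link.\<close>

lemma P_lift_regular: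
  assumes "P.regular x'"
  shows "\<exists>x. regular x \<and> (\<forall>I\<in>star K. \<forall>i\<in>I - K.
    (d I i \<bullet> x > 0 \<longleftrightarrow> P.d (I - K) i \<bullet> x' > 0) \<and> (d I i \<bullet> x < 0 \<longleftrightarrow> P.d (I - K) i \<bullet> x' < 0))"
proof -
  obtain y where y: "regular y" using exists_regular by blast
  have "lat P \<subseteq> span (lat \<Delta>)"
  proof
    fix z assume "z \<in> lat P"
    then obtain l where l: "l \<in> lat \<Delta>" "z = \<pi> l" unfolding lat_P by blast
    have "l - \<pi> l \<in> span (cone_of \<Delta> K)" by (rule quot_map_diff) simp
    moreover have "span (cone_of \<Delta> K) \<subseteq> span (lat \<Delta>)"
      unfolding span_cone[OF K] by (rule span_mono) (use edge_mem[OF K] in auto)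
    ultimately have "l - (l - \<pi> l) \<in> span (lat \<Delta>)" using l(1) by (blast intro: span_diff span_base)
    then show "z \<in> span (lat \<Delta>)" using l(2) by simp
  qed
  then have "span (lat P) \<subseteq> span (lat \<Delta>)" by (simp add: span_minimal)
  then have "x' \<in> span (lat \<Delta>)" using assms by (auto simp: P.regular_def)
  from perturb_regular[OF this y, of "{}"] obtain x where x: "regular x"
    "\<forall>I\<in>tops. \<forall>i\<in>I. sgn (d I i \<bullet> x) = (if d I i \<bullet> x' \<noteq> 0 then sgn (d I i \<bullet> x') else sgn (d I i \<bullet> y))"
    by blast
  have "(d I i \<bullet> x > 0 \<longleftrightarrow> P.d (I - K) i \<bullet> x' > 0) \<and> (d I i \<bullet> x < 0 \<longleftrightarrow> P.d (I - K) i \<bullet> x' < 0)"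
    if I: "I \<in> star K" and i: "i \<in> I - K" for I i
  proof -
    note P_dual_inner[OF I i]
    moreover have "P.d (I - K) i \<bullet> x' \<noteq> 0"
      using assms I i P_tops unfolding P.regular_def by blast
    ultimately have sg: "d I i \<bullet> x' \<noteq> 0" "d I i \<bullet> x' > 0 \<longleftrightarrow> P.d (I - K) i \<bullet> x' > 0"
      "d I i \<bullet> x' < 0 \<longleftrightarrow> P.d (I - K) i \<bullet> x' < 0"
      by (auto simp: zero_less_divide_iff divide_less_0_iff)
    have "sgn (d I i \<bullet> x) = sgn (d I i \<bullet> x')" using x(2) starD(1)[OF I] i sg(1) by auto
    then show ?thesis using sg by (metis sgn_greater sgn_less)
  qed
  then show ?thesis using x(1) by blast
qed

text \<open>The link of \<open>J\<close> in the projection is the link of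
  \<open>J \<union> K\<close> in the multi-fan, so completeness there is inherited.\<close>

sublocale P: complete_lattice_fan "lat P" "splx P" "n - card K" "edge_vec P" "weight P"
proof
  fix J x' y' assume J: "J \<in> splx P" and xy: "P.regular x'" "P.regular y'"
  have JK: "J \<union> K \<in> splx \<Delta>" "J \<inter> K = {}" using J by (auto simp: splx_P)
  have sum: "\<exists>x. regular x \<and> (\<Sum>I | I \<in> P.star J \<and> (\<forall>i\<in>I - J. P.d I i \<bullet> x' > 0). weight P I) =
      (\<Sum>I | I \<in> star (J \<union> K) \<and> (\<forall>i\<in>I - (J \<union> K). d I i \<bullet> x > 0). weight \<Delta> I)"
    if x': "P.regular x'" for x'
  proof -
    obtain x where x: "regular x" "\<forall>I\<in>star K. \<forall>i\<in>I - K. d I i \<bullet> x > 0 \<longleftrightarrow> P.d (I - K) i \<bullet> x' > 0"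
      using P_lift_regular[OF x'] by blast
    have "(\<Sum>I | I \<in> P.star J \<and> (\<forall>i\<in>I - J. P.d I i \<bullet> x' > 0). weight P I) =
      (\<Sum>I | I \<in> star (J \<union> K) \<and> (\<forall>i\<in>I - (J \<union> K). d I i \<bullet> x > 0). weight \<Delta> I)"
    proof (rule sum.reindex_bij_witness[of _ "\<lambda>I. I - K" "\<lambda>I. I \<union> K"])
      fix I' assume "I' \<in> {I. I \<in> P.star J \<and> (\<forall>i\<in>I - J. P.d I i \<bullet> x' > 0)}"
      then have I': "I' \<in> P.tops" "J \<subseteq> I'" "\<forall>i\<in>I' - J. P.d I' i \<bullet> x' > 0" by (auto simp: P.star_def)
      then obtain I where I: "I \<in> star K" "I' = I - K" using P_tops by blast
      have IK: "I' \<union> K = I" unfolding I(2) by (rule star_P(3)[OF I(1)])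
      then show "I' \<union> K - K = I'" using I(2) by simp
      show "weight \<Delta> (I' \<union> K) = weight P I'" by (simp add: weight_P)
      have "I \<in> star (J \<union> K)" using I I'(2) by (auto simp: star_def)
      moreover have "d I i \<bullet> x > 0" if "i \<in> I - (J \<union> K)" for i
        using x(2) I(1) I'(3) I(2) that by auto
      ultimately show "I' \<union> K \<in> {I. I \<in> star (J \<union> K) \<and> (\<forall>i\<in>I - (J \<union> K). d I i \<bullet> x > 0)}"
        unfolding IK by blast
    next
      fix I assume "I \<in> {I. I \<in> star (J \<union> K) \<and> (\<forall>i\<in>I - (J \<union> K). d I i \<bullet> x > 0)}"
      then have I: "I \<in> star K" "J \<subseteq> I" "\<forall>i\<in>I - (J \<union> K). d I i \<bullet> x > 0" by (auto simp: star_def)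
      show "I - K \<union> K = I" by (rule star_P(3)[OF I(1)])
      have "I - K \<in> P.star J" using I(1,2) JK(2) P_tops by (auto simp: P.star_def)
      moreover have "P.d (I - K) i \<bullet> x' > 0" if "i \<in> I - K - J" for i
        using x(2) I(1,3) that by blast
      ultimately show "I - K \<in> {I. I \<in> P.star J \<and> (\<forall>i\<in>I - J. P.d I i \<bullet> x' > 0)}" by blast
    qed
    then show ?thesis using x(1) by blast
  qed
  show "(\<Sum>I | I \<in> P.star J \<and> (\<forall>i\<in>I - J. P.d I i \<bullet> x' > 0). weight P I) =
      (\<Sum>I | I \<in> P.star J \<and> (\<forall>i\<in>I - J. P.d I i \<bullet> y' > 0). weight P I)"
  proof -
    obtain x where x: "regular x" "(\<Sum>I | I \<in> P.star J \<and> (\<forall>i\<in>I - J. P.d I i \<bullet> x' > 0). weight P I) =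
      (\<Sum>I | I \<in> star (J \<union> K) \<and> (\<forall>i\<in>I - (J \<union> K). d I i \<bullet> x > 0). weight \<Delta> I)"
      using sum[OF xy(1)] by (elim exE conjE)
    obtain y where y: "regular y" "(\<Sum>I | I \<in> P.star J \<and> (\<forall>i\<in>I - J. P.d I i \<bullet> y' > 0). weight P I) =
      (\<Sum>I | I \<in> star (J \<union> K) \<and> (\<forall>i\<in>I - (J \<union> K). d I i \<bullet> y > 0). weight \<Delta> I)"
      using sum[OF xy(2)] by (elim exE conjE)
    show ?thesis unfolding x(2) y(2) by (rule complete[OF JK(1) x(1) y(1)])
  qed
qed

end

section \<open>Genera in terms of h-numbers\<close>

theorem T_genus_at_eq:
  fixes M :: "('i, 'a::euclidean_space) multi_fan"
  assumes fan: "complete_lattice_fan (lat M) (splx M) (mf_dim M) (edge_vec M) (weight M)"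
    and span: "\<And>I. I \<in> top_splx M \<Longrightarrow> span (cone_of M I) = span (lat M)"
    and y: "lattice_fan.regular (lat M) (splx M) (mf_dim M) (edge_vec M) y"
  shows "T_genus_at M (Fract (Poly_Mapping.single 0 \<rho>) 1) =
    Fract (Poly_Mapping.single 0 (\<Sum>I\<in>top_splx M. of_int (weight M I) * (- \<rho>) ^ lattice_fan.neg (edge_vec M) {} y I)) 1"
proof -
  interpret complete_lattice_fan "lat M" "splx M" "mf_dim M" "edge_vec M" "weight M" by (rule fan)
  have tops: "top_splx M = tops" by (simp add: tops_def splx_of_def)
  have dual: "dual_vec M I i = d I i" if "I \<in> tops" for I i
    using span[of I] topsD(5)[OF that] that
    unfolding dual_vec_def dual_basis_vec_def tops by simp
  have H: "H_grp M I = H I" if "I \<in> tops" for I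
  proof -
    have "sublat M I = lat M"
      using span[of I] that span_superset[of "lat M"] by (auto simp: sublat_def tops)
    then show ?thesis by (simp add: H_grp_def H_def H_rel_def edge_sublat_def)
  qed
  show ?thesis
    unfolding T_genus_at_def tops genus_sum[OF y, symmetric]
    by (intro sum.cong refl arg_cong2[where f="(*)"] arg_cong2[where f="(/)"] prod.cong)
      (simp_all add: dual H)
qed

context complete_fan
begin

lemma genus_Delta:
  assumes "regular y"
  shows "T_genus_at \<Delta> (Fract (Poly_Mapping.single 0 \<rho>) 1) =
    Fract (Poly_Mapping.single 0 (\<Sum>I\<in>tops. of_int (weight \<Delta> I) * (- \<rho>) ^ neg {} y I)) 1"
  unfolding tops_eq
proof (rule T_genus_at_eq)
  show "complete_lattice_fan (lat \<Delta>) (splx \<Delta>) (mf_dim \<Delta>) (edge_vec \<Delta>) (weight \<Delta>)"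
    unfolding mf_dim_eq by unfold_locales
  show "span (cone_of \<Delta> I) = span (lat \<Delta>)" if "I \<in> top_splx \<Delta>" for I
    using that topsD(1,5)[of I] span_cone by (simp add: tops_eq)
qed (use assms in \<open>simp add: mf_dim_eq\<close>)

end

context projected_complete_fan
begin

lemma genus_P:
  "\<exists>x. regular x \<and> T_genus_at P (Fract (Poly_Mapping.single 0 \<rho>) 1) =
    Fract (Poly_Mapping.single 0 (\<Sum>I\<in>star K. of_int (weight \<Delta> I) * (- \<rho>) ^ neg K x I)) 1"
proof -
  obtain x' where x': "P.regular x'" using P.exists_regular by blast
  obtain x where x: "regular x" "\<forall>I\<in>star K. \<forall>i\<in>I - K. d I i \<bullet> x < 0 \<longleftrightarrow> P.d (I - K) i \<bullet> x' < 0"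
    using P_lift_regular[OF x'] by blast
  have "T_genus_at P (Fract (Poly_Mapping.single 0 \<rho>) 1) =
    Fract (Poly_Mapping.single 0 (\<Sum>J\<in>top_splx P. of_int (weight P J) * (- \<rho>) ^ P.neg {} x' J)) 1"
  proof (rule T_genus_at_eq)
    show "complete_lattice_fan (lat P) (splx P) (mf_dim P) (edge_vec P) (weight P)"
      unfolding mf_dim_P by unfold_locales
    show "span (cone_of P J) = span (lat P)" if "J \<in> top_splx P" for J
      using that span_cone_P span_P P_tops unfolding P_tops_eq[symmetric] by auto
  qed (use x' in \<open>simp add: mf_dim_P\<close>)
  also have "(\<Sum>J\<in>top_splx P. of_int (weight P J) * (- \<rho>) ^ P.neg {} x' J) =
      (\<Sum>I\<in>star K. of_int (weight \<Delta> I) * (- \<rho>) ^ neg K x I)"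
    unfolding P_tops_eq[symmetric] P_tops sum.reindex[OF inj_star]
  proof (rule sum.cong)
    fix I assume I: "I \<in> star K"
    have "{i \<in> I - K - {}. P.d (I - K) i \<bullet> x' < 0} = {i \<in> I - K. d I i \<bullet> x < 0}"
      using x(2) I by blast
    then have "P.neg {} x' (I - K) = neg K x I" unfolding P.neg_def neg_def by (rule arg_cong)
    then show "((\<lambda>J. of_int (weight P J) * (- \<rho>) ^ P.neg {} x' J) \<circ> (\<lambda>I. I - K)) I =
        of_int (weight \<Delta> I) * (- \<rho>) ^ neg K x I"
      using star_P(3)[OF I] by (simp add: weight_P)
  qed simp
  finally show ?thesis using x(1) by blast
qed

end

lemma Fract_single_of_nat: "Fract (Poly_Mapping.single 0 (of_nat k)) 1 = of_nat k"
  by (simp only: single_of_nat Fract_of_nat_eq)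

lemma Fract_single_sum_powers:
  fixes s :: "'r::idom"
  shows "Fract (Poly_Mapping.single (0::'e::linordered_ab_group_add) (\<Sum>k\<in>A. of_nat (c k) * s ^ k)) 1 =
    (\<Sum>k\<in>A. of_nat (c k) * Fract (Poly_Mapping.single 0 s) 1 ^ k)"
proof -
  have add: "Fract (Poly_Mapping.single (0::'e) (a + b)) 1 =
    Fract (Poly_Mapping.single 0 a) 1 + Fract (Poly_Mapping.single 0 (b::'r)) 1" for a b
    by (simp add: Poly_Mapping.single_add)
  have mult: "Fract (Poly_Mapping.single (0::'e) (a * b)) 1 =
    Fract (Poly_Mapping.single 0 a) 1 * Fract (Poly_Mapping.single 0 (b::'r)) 1" for a b
    by (simp add: mult_single)
  have power: "Fract (Poly_Mapping.single (0::'e) (s ^ k)) 1 = Fract (Poly_Mapping.single 0 s) 1 ^ k" for k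
    by (induction k) (simp_all only: power_0 power_Suc mult single_one fract_collapse)
  show ?thesis
    by (induction A rule: infinite_finite_induct)
      (simp_all only: sum.infinite sum.empty sum.insert single_zero fract_collapse add mult power Fract_single_of_nat simp_thms if_True)
qed

section \<open>Todd genus one, and the invariants of the definitions\<close>

locale todd_one_fan = complete_fan +
  assumes n1: "n \<ge> 1" and todd: "Todd_genus \<Delta> = 1" and weights: "\<forall>I\<in>splx_of \<Delta> n. weight \<Delta> I = 1"

sublocale todd_one_fan \<subseteq> unit_fan "lat \<Delta>" "splx \<Delta>" n "edge_vec \<Delta>" "weight \<Delta>"
proof
  show weight: "weight \<Delta> I = 1" if "I \<in> tops" for I
    using weights that by (simp add: tops_def splx_of_def)
  show "1 \<le> n" by (rule n1)
  fix x assume x: "regular x"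
  have "1 = T_genus_at \<Delta> (Fract (Poly_Mapping.single 0 0) 1)"
    using todd by (simp add: Todd_genus_def fract_collapse)
  also have "\<dots> = Fract (Poly_Mapping.single 0 (\<Sum>I\<in>tops. of_int (weight \<Delta> I) * (- 0) ^ neg {} x I)) 1"
    by (rule genus_Delta[OF x])
  \<comment> \<open>At \<open>y = 0\<close> the power is 1 for \<open>neg {} x I = 0\<close> and 0
    otherwise, so only the cones containing \<open>x\<close> are counted.\<close>
  also have "(\<Sum>I\<in>tops. of_int (weight \<Delta> I) * (- 0) ^ neg {} x I) =
      (\<Sum>I\<in>tops. if \<forall>i\<in>I. d I i \<bullet> x > 0 then 1 else 0 :: real \<Rightarrow>\<^sub>0 complex)"
  proof (rule sum.cong)
    fix I assume I: "I \<in> tops"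
    have "neg {} x I = 0 \<longleftrightarrow> (\<forall>i\<in>I. d I i \<bullet> x > 0)"
      using topsD(2)[OF I] regular_pos_iff[OF x I] by (auto simp: neg_def)
    then show "of_int (weight \<Delta> I) * (- 0) ^ neg {} x I = (if \<forall>i\<in>I. d I i \<bullet> x > 0 then 1 else 0 :: real \<Rightarrow>\<^sub>0 complex)"
      using weight[OF I] by (simp add: power_0_left)
  qed simp
  also have "\<dots> = of_nat (card {I \<in> tops. \<forall>i\<in>I. d I i \<bullet> x > 0})"
    using finite_tops by (simp add: sum.If_cases Int_def)
  finally have "1 = of_nat (card {I \<in> tops. \<forall>i\<in>I. d I i \<bullet> x > 0}) * (1 :: 'b exp_field)"
    unfolding Fract_single_of_nat by simp
  then have "Fract (1 :: 'b exponent \<Rightarrow>\<^sub>0 (real \<Rightarrow>\<^sub>0 complex)) 1 = Fract (of_nat (card {I \<in> tops. \<forall>i\<in>I. d I i \<bullet> x > 0})) 1"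
    by (simp only: Fract_of_nat_eq fract_collapse mult_1_right)
  then have "of_nat (card {I \<in> tops. \<forall>i\<in>I. d I i \<bullet> x > 0}) = (of_nat 1 :: 'b exponent \<Rightarrow>\<^sub>0 (real \<Rightarrow>\<^sub>0 complex))"
    by (simp add: eq_fract)
  then show "card {I \<in> tops. \<forall>i\<in>I. d I i \<bullet> x > 0} = 1"
    by (simp only: of_nat_eq_iff)
qed

context todd_one_fan
begin

lemma neg_power_sum:
  assumes K: "K \<in> splx \<Delta>" and x: "regular x"
  shows "(\<Sum>I\<in>star K. of_int (weight \<Delta> I) * s ^ neg K x I) = (\<Sum>k\<le>n - card K. of_nat (h K k) * s ^ k)"
proof -
  have le: "neg K x I \<le> n - card K" if "I \<in> star K" for I
  proof -
    note I = starD[OF that] topsD(2,3)[OF starD(1)[OF that]]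
    have "neg K x I \<le> card (I - K)" unfolding neg_def by (rule card_mono) (use I in auto)
    then show ?thesis using I by (simp add: card_Diff_subset)
  qed
  have "(\<Sum>I\<in>star K. of_int (weight \<Delta> I) * s ^ neg K x I) = (\<Sum>I\<in>star K. s ^ neg K x I)"
    by (rule sum.cong) (use weight_one starD(1) in auto)
  also have "\<dots> = (\<Sum>k\<le>n - card K. \<Sum>I | I \<in> star K \<and> neg K x I = k. s ^ neg K x I)"
    by (rule sum.group[symmetric]) (use finite_star le in auto)
  also have "\<dots> = (\<Sum>k\<le>n - card K. of_nat (h K k) * s ^ k)"
    by (rule sum.cong) (simp_all add: h_eq[OF K x])
  finally show ?thesis .
qed

lemma var_y_eq: "var_y = Fract (Poly_Mapping.single 0 (- Poly_Mapping.single 1 1)) 1"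
  by (simp add: var_y_def neg_y_pow_def single_uminus)

lemma neg_var_y_eq: "- var_y = Fract (Poly_Mapping.single 0 (Poly_Mapping.single 1 1)) 1"
  by (simp add: var_y_def neg_y_pow_def)

lemma T_genus_h: "T_genus \<Delta> = (\<Sum>k\<le>n. of_nat (h {} k) * (- var_y) ^ k)"
proof -
  obtain x where x: "regular x" using exists_regular by blast
  show ?thesis
    unfolding T_genus_def neg_var_y_eq unfolding var_y_eq genus_Delta[OF x] minus_minus
      Fract_single_sum_powers[symmetric]
    using neg_power_sum[OF empty_in_S x, of "Poly_Mapping.single 1 1 :: real \<Rightarrow>\<^sub>0 complex"] by simp
qed

lemma T_genus_projected_h:
  assumes K: "K \<in> splx \<Delta>"
  shows "T_genus (projected \<Delta> K) = (\<Sum>k\<le>n - card K. of_nat (h K k) * (- var_y) ^ k)"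
proof -
  interpret projected_complete_fan \<Delta> n K by unfold_locales (rule K)
  obtain x where x: "regular x" "T_genus_at P (Fract (Poly_Mapping.single 0 (- Poly_Mapping.single 1 1)) 1) =
    Fract (Poly_Mapping.single 0 (\<Sum>I\<in>star K. of_int (weight \<Delta> I) * (- (- Poly_Mapping.single 1 1)) ^ neg K x I)) 1"
    using genus_P by blast
  show ?thesis
    unfolding T_genus_def neg_var_y_eq unfolding var_y_eq x(2) minus_minus
      Fract_single_sum_powers[symmetric]
    using neg_power_sum[OF K x(1), of "Poly_Mapping.single 1 1 :: real \<Rightarrow>\<^sub>0 complex"] by simp
qed

lemma H_hat_empty: "H_hat \<Delta> {} = {{0}}"
proof -
  have "span (cone_of \<Delta> {}) = {0}" using span_cone[OF empty_in_S] by simp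
  then have sub: "sublat \<Delta> {} = {0}" using zero_mem by (auto simp: sublat_def)
  have "edge_sublat \<Delta> {} = {0}" by (auto simp: edge_sublat_def int_span_def)
  then have "H_grp \<Delta> {} = {{0}}"
    unfolding H_grp_def sub by (auto simp: quotient_def)
  then show ?thesis by (auto simp: H_hat_def)
qed

lemma equiv_sublat:
  "equiv (sublat \<Delta> K) {(a, b). a \<in> sublat \<Delta> K \<and> b \<in> sublat \<Delta> K \<and> a - b \<in> edge_sublat \<Delta> K}"
  unfolding edge_sublat_def by (rule equiv_subgroup_rel) (rule int_span_subgroup; assumption)+

lemma H_grp_rep: "g \<in> H_grp \<Delta> K \<Longrightarrow> rep g \<in> g"
  unfolding H_grp_def rep_def using in_quotient_imp_non_empty[OF equiv_sublat] some_in_eq by blast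

lemma H_grp_rep_sublat: "g \<in> H_grp \<Delta> K \<Longrightarrow> rep g \<in> sublat \<Delta> K"
  using H_grp_rep[of g K] in_quotient_imp_subset[OF equiv_sublat] unfolding H_grp_def by blast

lemma sublat_expansion:
  assumes K: "K \<in> splx \<Delta>" and l: "l \<in> sublat \<Delta> K"
  shows "(\<Sum>i\<in>K. (dual_vec \<Delta> K i \<bullet> l) *\<^sub>R edge_vec \<Delta> i) = l"
  using dual_basis_expansion[OF indep_edges[OF K], of l] l by (simp add: dual_vec_eq[OF K] sublat_def span_cone[OF K])

lemma edge_sublat_iff:
  assumes K: "K \<in> splx \<Delta>"
  shows "x \<in> edge_sublat \<Delta> K \<longleftrightarrow> (\<exists>m :: 'a \<Rightarrow> int. x = (\<Sum>i\<in>K. of_int (m i) *\<^sub>R edge_vec \<Delta> i))"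
  unfolding edge_sublat_def
  by (rule int_span_family) (use indep_edges[OF K] in \<open>simp add: indep_family_def\<close>)

lemma edge_sublat_coords:
  assumes K: "K \<in> splx \<Delta>" and x: "x \<in> sublat \<Delta> K"
  shows "x \<in> edge_sublat \<Delta> K \<longleftrightarrow> (\<forall>i\<in>K. dual_vec \<Delta> K i \<bullet> x \<in> \<int>)"
proof
  assume "x \<in> edge_sublat \<Delta> K"
  then obtain m :: "'a \<Rightarrow> int" where m: "x = (\<Sum>i\<in>K. of_int (m i) *\<^sub>R edge_vec \<Delta> i)"
    unfolding edge_sublat_iff[OF K] by blast
  show "\<forall>i\<in>K. dual_vec \<Delta> K i \<bullet> x \<in> \<int>"
    unfolding m using inner_dual_sum[OF indep_edges[OF K] _ order_refl] by (simp add: dual_vec_eq[OF K])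
next
  assume int: "\<forall>i\<in>K. dual_vec \<Delta> K i \<bullet> x \<in> \<int>"
  have "of_int \<lfloor>dual_vec \<Delta> K i \<bullet> x\<rfloor> = dual_vec \<Delta> K i \<bullet> x" if "i \<in> K" for i
    using int that by (auto elim!: Ints_cases)
  then have "(\<Sum>i\<in>K. of_int \<lfloor>dual_vec \<Delta> K i \<bullet> x\<rfloor> *\<^sub>R edge_vec \<Delta> i) = (\<Sum>i\<in>K. (dual_vec \<Delta> K i \<bullet> x) *\<^sub>R edge_vec \<Delta> i)"
    by (intro sum.cong refl arg_cong2[where f="scaleR"])
  also have "\<dots> = x" by (rule sublat_expansion[OF K x])
  finally show "x \<in> edge_sublat \<Delta> K"
    unfolding edge_sublat_iff[OF K] by (intro exI[of _ "\<lambda>i. \<lfloor>dual_vec \<Delta> K i \<bullet> x\<rfloor>"]) simp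
qed

lemma sublat_diff: "x \<in> sublat \<Delta> K \<Longrightarrow> y \<in> sublat \<Delta> K \<Longrightarrow> x - y \<in> sublat \<Delta> K"
  by (auto simp: sublat_def intro: diff_mem span_diff)

text \<open>By \<open>uniq\<close> any two candidates have coordinates that differ by integers, so
  they are in one class. Its representative with coordinates in \<open>[0, 1)\<close> is the
  midpoint, whose coordinates add up to 1.\<close>

lemma H_hat_half:
  assumes ab: "a \<noteq> b" and K: "{a, b} \<in> splx \<Delta>"
    and half: "(1 / 2) *\<^sub>R (edge_vec \<Delta> a + edge_vec \<Delta> b) \<in> lat \<Delta>"
    and uniq: "\<And>l. l \<in> sublat \<Delta> {a, b} \<Longrightarrow> \<forall>i\<in>{a, b}. dual_vec \<Delta> {a, b} i \<bullet> l \<notin> \<int> \<Longrightarrow>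
      \<forall>i\<in>{a, b}. dual_vec \<Delta> {a, b} i \<bullet> l - 1 / 2 \<in> \<int>"
  shows "\<exists>g. H_hat \<Delta> {a, b} = {g} \<and> f_inv \<Delta> {a, b} g = 1"
proof -
  let ?K = "{a, b}"
  let ?e = "edge_vec \<Delta>"
  let ?R = "{(x, y). x \<in> sublat \<Delta> ?K \<and> y \<in> sublat \<Delta> ?K \<and> x - y \<in> edge_sublat \<Delta> ?K}"
  define p where "p = (1 / 2) *\<^sub>R (?e a + ?e b)"
  have p_sum: "p = (\<Sum>i\<in>?K. (1 / 2) *\<^sub>R ?e i)" using ab by (simp add: p_def scaleR_add_right)
  have p: "p \<in> sublat \<Delta> ?K"
    using half unfolding sublat_def span_cone[OF K] p_def
    by (auto intro!: span_scale span_add intro: span_base)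
  have p_coord: "dual_vec \<Delta> ?K i \<bullet> p = 1 / 2" if "i \<in> ?K" for i
    unfolding p_sum dual_vec_eq[OF K]
    using inner_dual_sum[OF indep_edges[OF K] that order_refl, of "\<lambda>_. 1 / 2"] that by simp
  define g where "g = ?R `` {p}"
  have g_iff: "x \<in> g \<longleftrightarrow> x \<in> sublat \<Delta> ?K \<and> (\<forall>i\<in>?K. dual_vec \<Delta> ?K i \<bullet> x - 1 / 2 \<in> \<int>)" for x
  proof (cases "x \<in> sublat \<Delta> ?K")
    case True
    have "dual_vec \<Delta> ?K i \<bullet> (p - x) \<in> \<int> \<longleftrightarrow> dual_vec \<Delta> ?K i \<bullet> x - 1 / 2 \<in> \<int>" if "i \<in> ?K" for i
    proof -
      have "dual_vec \<Delta> ?K i \<bullet> (p - x) = - (dual_vec \<Delta> ?K i \<bullet> x - 1 / 2)"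
        by (simp only: inner_diff_right p_coord[OF that] minus_diff_eq)
      then show ?thesis by (simp only: minus_in_Ints_iff)
    qed
    then show ?thesis
      using True p edge_sublat_coords[OF K sublat_diff[OF p True]] by (simp add: g_def)
  next
    case False
    then show ?thesis by (simp add: g_def)
  qed
  have g_mem: "g \<in> H_grp \<Delta> ?K" unfolding g_def H_grp_def using p by (rule quotientI)
  have nonint: "r \<notin> \<int>" if "r - 1 / 2 \<in> \<int>" for r :: real
  proof
    assume "r \<in> \<int>"
    from Ints_diff[OF this that] show False using half_not_Ints by simp
  qed
  have "H_hat \<Delta> ?K = {g}"
  proof (intro equalityI subsetI)
    fix g' assume g': "g' \<in> H_hat \<Delta> ?K"
    then have mem: "g' \<in> H_grp \<Delta> ?K" and ni: "\<forall>i\<in>?K. dual_vec \<Delta> ?K i \<bullet> rep g' \<notin> \<int>"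
      unfolding H_hat_def by blast+
    have "rep g' \<in> g"
      unfolding g_iff using uniq[OF H_grp_rep_sublat[OF mem] ni] H_grp_rep_sublat[OF mem] by blast
    then have "(p, rep g') \<in> ?R" by (simp add: g_def)
    then have "g = g'"
      using quotient_eqI[OF equiv_sublat, of g ?K g' p "rep g'"] g_mem mem H_grp_rep[OF mem] p
        equiv_class_self[OF equiv_sublat p]
      unfolding H_grp_def g_def by blast
    then show "g' \<in> {g}" by simp
  next
    fix g' assume "g' \<in> {g}"
    then show "g' \<in> H_hat \<Delta> ?K"
      using g_mem H_grp_rep[OF g_mem] nonint unfolding H_hat_def g_iff by blast
  qed
  moreover have "f_inv \<Delta> ?K g = 1"
  proof -
    have "frac_rep \<Delta> ?K g = p"
      unfolding frac_rep_def
    proof (rule the_equality)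
      show "p \<in> g \<and> (\<forall>i\<in>?K. 0 \<le> dual_vec \<Delta> ?K i \<bullet> p \<and> dual_vec \<Delta> ?K i \<bullet> p < 1)"
        unfolding g_iff by (intro conjI ballI p; subst p_coord, assumption, simp)
      fix x assume x: "x \<in> g \<and> (\<forall>i\<in>?K. 0 \<le> dual_vec \<Delta> ?K i \<bullet> x \<and> dual_vec \<Delta> ?K i \<bullet> x < 1)"
      have "dual_vec \<Delta> ?K i \<bullet> x = 1 / 2" if "i \<in> ?K" for i
      proof -
        have "dual_vec \<Delta> ?K i \<bullet> x - 1 / 2 \<in> \<int>" using x that unfolding g_iff by blast
        then obtain m :: int where m: "dual_vec \<Delta> ?K i \<bullet> x - 1 / 2 = of_int m" by (auto elim: Ints_cases)
        have "0 \<le> dual_vec \<Delta> ?K i \<bullet> x" "dual_vec \<Delta> ?K i \<bullet> x < 1" using x that by blast+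
        then have "real_of_int m < 1" "- 1 < real_of_int m" using m by linarith+
        then have "m = 0" by simp
        then show ?thesis using m by simp
      qed
      then have "(\<Sum>i\<in>?K. (dual_vec \<Delta> ?K i \<bullet> x) *\<^sub>R ?e i) = p" unfolding p_sum by (intro sum.cong) auto
      then show "x = p" using sublat_expansion[OF K] x unfolding g_iff by simp
    qed
    then show ?thesis using p_coord[of a] p_coord[of b] ab by (simp add: f_inv_def)
  qed
  ultimately show ?thesis by blast
qed

lemma gorenstein:
  assumes "c1_T_Cartier_divisible \<Delta> n"
  shows "\<exists>u. gorenstein_fan (lat \<Delta>) (splx \<Delta>) n (edge_vec \<Delta>) (weight \<Delta>) u"
proof -
  obtain a u where a: "T_Cartier \<Delta> a" and u: "u \<in> dual_lattice (lat \<Delta>)"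
    and eq: "\<And>i. {i} \<in> splx \<Delta> \<Longrightarrow> 1 = real n * of_int (a i) + u \<bullet> edge_vec \<Delta> i"
    using assms by (auto simp: c1_T_Cartier_divisible_def)
  have "gorenstein_fan (lat \<Delta>) (splx \<Delta>) n (edge_vec \<Delta>) (weight \<Delta>) u"
  proof unfold_locales
    show "u \<bullet> l \<in> \<int>" if "l \<in> lat \<Delta>" for l using u that by (auto simp: dual_lattice_def)
    fix I l assume I: "I \<in> tops" and l: "l \<in> lat \<Delta>"
    have "restr \<Delta> I a \<in> dual_lattice (lat \<Delta>)" using a I by (simp add: T_Cartier_def tops_eq)
    then have "restr \<Delta> I a \<bullet> l \<in> \<int>" using l by (auto simp: dual_lattice_def)
    then obtain m :: int where m: "restr \<Delta> I a \<bullet> l = of_int m" by (auto elim: Ints_cases)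
    have "u \<bullet> l = (\<Sum>i\<in>I. (d I i \<bullet> l) * (u \<bullet> edge_vec \<Delta> i))"
      using inner_eq_sum_dual[OF topsD(4)[OF I], of l u] l topsD(5)[OF I] by (simp add: span_base)
    moreover have "restr \<Delta> I a \<bullet> l = (\<Sum>i\<in>I. of_int (a i) * (d I i \<bullet> l))"
      by (simp add: restr_def inner_sum_left dual_vec_eq[OF topsD(1)[OF I]])
    ultimately have "u \<bullet> l + real n * of_int m = (\<Sum>i\<in>I. (d I i \<bullet> l) * (real n * of_int (a i) + u \<bullet> edge_vec \<Delta> i))"
      unfolding m[symmetric] by (simp add: sum_distrib_left sum.distrib[symmetric] algebra_simps)
    also have "\<dots> = (\<Sum>i\<in>I. d I i \<bullet> l)"
    proof (rule sum.cong)
      fix i assume "i \<in> I"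
      then have "{i} \<in> splx \<Delta>" using vertex_of_simplex topsD(1)[OF I] by blast
      from eq[OF this] show "(d I i \<bullet> l) * (real n * of_int (a i) + u \<bullet> edge_vec \<Delta> i) = d I i \<bullet> l" by simp
    qed simp
    finally show "\<exists>m::int. (\<Sum>i\<in>I. d I i \<bullet> l) = u \<bullet> l + real n * of_int m" by (intro exI[of _ m]) simp
  qed
  then show ?thesis ..
qed

lemma nonsingular_if_integral:
  assumes int: "\<forall>I\<in>tops. \<forall>l\<in>lat \<Delta>. \<forall>i\<in>I. d I i \<bullet> l \<in> \<int>"
  shows "nonsingular \<Delta>"
  unfolding nonsingular_def lattice_basis_def tops_eq[symmetric]
proof (intro ballI conjI)
  fix I assume I: "I \<in> tops"
  show "inj_on (edge_vec \<Delta>) I" "independent (edge_vec \<Delta> ` I)"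
    using topsD(4)[OF I] by (auto simp: indep_family_def)
  show "int_span (edge_vec \<Delta> ` I) = lat \<Delta>"
  proof (intro equalityI subsetI)
    fix x assume "x \<in> int_span (edge_vec \<Delta> ` I)"
    then show "x \<in> lat \<Delta>"
      unfolding int_span_edges_iff[OF I] using int_span_mem_L[OF topsD(1)[OF I] order_refl] by blast
  next
    fix x assume x: "x \<in> lat \<Delta>"
    have "of_int \<lfloor>d I i \<bullet> x\<rfloor> = d I i \<bullet> x" if "i \<in> I" for i
      using int I x that by (auto elim!: Ints_cases)
    then have "(\<Sum>i\<in>I. of_int \<lfloor>d I i \<bullet> x\<rfloor> *\<^sub>R edge_vec \<Delta> i) = (\<Sum>i\<in>I. (d I i \<bullet> x) *\<^sub>R edge_vec \<Delta> i)"
      by (intro sum.cong refl arg_cong2[where f="scaleR"])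
    also have "\<dots> = x"
      using dual_basis_expansion[OF topsD(4)[OF I], of x] topsD(5)[OF I] x by (simp add: span_base)
    finally show "x \<in> int_span (edge_vec \<Delta> ` I)"
      unfolding int_span_edges_iff[OF I] by (intro exI[of _ "\<lambda>i. \<lfloor>d I i \<bullet> x\<rfloor>"]) simp
  qed
qed

lemma orbifold_T_genus_eq:
  assumes K: "K \<in> splx \<Delta>" "K \<noteq> {}" and g: "H_hat \<Delta> K = {g}" "f_inv \<Delta> K g = 1"
    and uniq: "\<And>K'. K' \<in> splx \<Delta> \<Longrightarrow> K' \<noteq> {} \<Longrightarrow> H_hat \<Delta> K' \<noteq> {} \<Longrightarrow> K' = K"
  shows "orbifold_T_genus \<Delta> = T_genus \<Delta> + (- var_y) * T_genus (projected \<Delta> K)"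
proof -
  let ?t = "\<lambda>K. \<Sum>g\<in>H_hat \<Delta> K. neg_y_pow (f_inv \<Delta> K g) * T_genus (projected \<Delta> K)"
  have "orbifold_T_genus \<Delta> = (\<Sum>K\<in>splx \<Delta>. ?t K)"
    unfolding orbifold_T_genus_def splx_of_def mf_dim_eq
    by (rule sum.group) (use finite_splx smf in \<open>auto simp: simplicial_multi_fan_def\<close>)
  also have "\<dots> = (\<Sum>K'\<in>{{}, K}. ?t K')"
  proof (rule sum.mono_neutral_right)
    show "\<forall>K'\<in>splx \<Delta> - {{}, K}. ?t K' = 0"
    proof
      fix K' assume "K' \<in> splx \<Delta> - {{}, K}"
      then have "H_hat \<Delta> K' = {}" using uniq[of K'] by blast
      then show "?t K' = 0" by simp
    qed
  qed (use finite_splx K(1) empty_in_S in auto)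
  also have "\<dots> = ?t {} + ?t K" using K(2) by simp
  \<comment> \<open>The projection along the empty simplex is compared with the multi-fan through
    its h-numbers, not by an equality of records.\<close>
  also have "?t {} = T_genus \<Delta>"
    by (simp add: H_hat_empty f_inv_def T_genus_projected_h[OF empty_in_S] T_genus_h neg_y_pow_def fract_collapse)
  also have "?t K = (- var_y) * T_genus (projected \<Delta> K)"
    by (simp add: g var_y_def)
  finally show ?thesis .
qed

end

text \<open>The sequence 1, 2, ..., 2, 1 is the all-one sequence of length \<open>n\<close> added to
  its shift by one; for \<open>n = 1\<close> it is 1, 1.\<close>

lemma sum_1_2_1:
  fixes t :: "'r::comm_ring_1" and c :: "nat \<Rightarrow> nat"
  assumes "1 \<le> n" "c 0 = 1" "c n = 1" "\<And>k. 0 < k \<Longrightarrow> k < n \<Longrightarrow> c k = 2"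
  shows "(\<Sum>k\<le>n. of_nat (c k) * t ^ k) = (1 + t) * (\<Sum>k = 0..n - 1. t ^ k)"
proof -
  obtain m where m: "n = Suc m" using assms(1) by (cases n) auto
  have "(\<Sum>k\<le>n. of_nat (c k) * t ^ k) = (\<Sum>k\<le>n. (if k \<noteq> n then t ^ k else 0) + (if k \<noteq> 0 then t ^ k else 0))"
  proof (rule sum.cong)
    fix k assume "k \<in> {..n}"
    then consider "k = 0" | "k = n" | "0 < k" "k < n" by fastforce
    then show "of_nat (c k) * t ^ k = (if k \<noteq> n then t ^ k else 0) + (if k \<noteq> 0 then t ^ k else 0)"
      by cases (use assms in auto)
  qed simp
  also have "\<dots> = (\<Sum>k\<le>n. if k \<noteq> n then t ^ k else 0) + (\<Sum>k\<le>n. if k \<noteq> 0 then t ^ k else 0)"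
    by (rule sum.distrib)
  also have "(\<Sum>k\<le>n. if k \<noteq> n then t ^ k else 0) = (\<Sum>k\<le>m. t ^ k)"
    unfolding m by simp
  also have "(\<Sum>k\<le>n. if k \<noteq> 0 then t ^ k else 0) = t * (\<Sum>k\<le>m. t ^ k)"
    unfolding m sum.atMost_Suc_shift by (simp add: sum_distrib_left)
  finally show ?thesis by (simp add: m atLeast0AtMost algebra_simps)
qed

lemma sum_powers_shift:
  fixes t :: "'r::comm_ring_1"
  assumes "2 \<le> n"
  shows "(\<Sum>k = 0..n. t ^ k) + t * (\<Sum>k = 0..n - 2. t ^ k) = (1 + t) * (\<Sum>k = 0..n - 1. t ^ k)"
proof -
  obtain m where m: "n = Suc (Suc m)" using assms by (metis add_2_eq_Suc le_Suc_ex)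
  show ?thesis unfolding m by (simp add: algebra_simps)
qed

theorem proposition5p6:
  fixes \<Delta> :: "('i, 'a::euclidean_space) multi_fan" and n :: nat
  assumes "n \<ge> 1"
    and "simplicial_multi_fan n \<Delta>"
    and "complete_multi_fan \<Delta>"
    and "Todd_genus \<Delta> = 1"
    and "\<forall>I\<in>splx_of \<Delta> n. weight \<Delta> I = 1"
    and "c1_T_Cartier_divisible \<Delta> n"
  shows
    "(nonsingular \<Delta> \<and>
      T_genus \<Delta> = (1 - var_y) * (\<Sum>k = 0..n - 1. (- var_y) ^ k))
     \<or>
     (n \<ge> 2 \<and>
      (\<exists>!K. K \<in> splx \<Delta> \<and> K \<noteq> {} \<and> H_hat \<Delta> K \<noteq> {}) \<and>
      (\<forall>K. K \<in> splx \<Delta> \<and> K \<noteq> {} \<and> H_hat \<Delta> K \<noteq> {} \<longrightarrow>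
         T_genus \<Delta> = (\<Sum>k = 0..n. (- var_y) ^ k) \<and>
         T_genus (projected \<Delta> K) = (\<Sum>k = 0..n - 2. (- var_y) ^ k) \<and>
         orbifold_T_genus \<Delta> = T_genus \<Delta> + (- var_y) * T_genus (projected \<Delta> K) \<and>
         T_genus \<Delta> + (- var_y) * T_genus (projected \<Delta> K)
           = (1 - var_y) * (\<Sum>k = 0..n - 1. (- var_y) ^ k)))"
    (is "?A \<or> ?B")
proof -
  interpret todd_one_fan \<Delta> n by unfold_locales (use assms in auto)
  obtain u where "gorenstein_fan (lat \<Delta>) (splx \<Delta>) n (edge_vec \<Delta>) (weight \<Delta>) u"
    using gorenstein[OF assms(6)] by blast
  then interpret gorenstein_fan "lat \<Delta>" "splx \<Delta>" n "edge_vec \<Delta>" "weight \<Delta>" u .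
  from classification show ?thesis
  proof (elim disjE conjE exE)
    assume "\<forall>I\<in>tops. \<forall>l\<in>lat \<Delta>. \<forall>i\<in>I. d I i \<bullet> l \<in> \<int>" and h2: "\<forall>k. 0 < k \<and> k < n \<longrightarrow> h {} k = 2"
    then have "nonsingular \<Delta>" by (intro nonsingular_if_integral)
    moreover have "T_genus \<Delta> = (1 + - var_y) * (\<Sum>k = 0..n - 1. (- var_y) ^ k)"
      unfolding T_genus_h using assms(1) h_0[OF empty_in_S] h_n h2 by (intro sum_1_2_1) auto
    ultimately show ?thesis by simp
  next
    fix a b
    assume n2: "2 \<le> n" and h1: "\<forall>k\<le>n. h {} k = 1" and ab: "a \<noteq> b" "{a, b} \<in> splx \<Delta>"
      and half: "(1 / 2) *\<^sub>R (edge_vec \<Delta> a + edge_vec \<Delta> b) \<in> lat \<Delta>"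
      and hab: "\<forall>k\<le>n - 2. h {a, b} k = 1"
      and uniq: "\<forall>K c. K \<in> splx \<Delta> \<longrightarrow> K \<noteq> {} \<longrightarrow> (\<Sum>i\<in>K. c i *\<^sub>R edge_vec \<Delta> i) \<in> lat \<Delta> \<longrightarrow>
        (\<forall>i\<in>K. c i \<notin> \<int>) \<longrightarrow> K = {a, b} \<and> (\<forall>i\<in>K. c i - 1 / 2 \<in> \<int>)"
    \<comment> \<open>The coefficients \<open>c\<close> of the classification become the dual
      coordinates of a point of the sublattice over \<open>K\<close>.\<close>
    have uniq': "K = {a, b} \<and> (\<forall>i\<in>K. dual_vec \<Delta> K i \<bullet> l - 1 / 2 \<in> \<int>)"
      if "K \<in> splx \<Delta>" "K \<noteq> {}" "l \<in> sublat \<Delta> K" "\<forall>i\<in>K. dual_vec \<Delta> K i \<bullet> l \<notin> \<int>" for K l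
    proof -
      have "(\<Sum>i\<in>K. (dual_vec \<Delta> K i \<bullet> l) *\<^sub>R edge_vec \<Delta> i) \<in> lat \<Delta>"
        using sublat_expansion[OF that(1,3)] that(3) by (simp add: sublat_def)
      then show ?thesis
        using uniq[THEN spec[of _ K], THEN spec[of _ "\<lambda>i. dual_vec \<Delta> K i \<bullet> l"]] that(1,2,4) by blast
    qed
    have K_eq: "K = {a, b}" if K: "K \<in> splx \<Delta>" "K \<noteq> {}" "H_hat \<Delta> K \<noteq> {}" for K
    proof -
      obtain g where g: "g \<in> H_grp \<Delta> K" "\<forall>i\<in>K. dual_vec \<Delta> K i \<bullet> rep g \<notin> \<int>"
        using K(3) unfolding H_hat_def by blast
      from uniq'[OF K(1,2) H_grp_rep_sublat[OF g(1)] g(2)] show ?thesis ..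
    qed
    have "\<exists>g. H_hat \<Delta> {a, b} = {g} \<and> f_inv \<Delta> {a, b} g = 1"
    proof (rule H_hat_half[OF ab half])
      fix l assume "l \<in> sublat \<Delta> {a, b}" "\<forall>i\<in>{a, b}. dual_vec \<Delta> {a, b} i \<bullet> l \<notin> \<int>"
      from uniq'[OF ab(2) _ this] show "\<forall>i\<in>{a, b}. dual_vec \<Delta> {a, b} i \<bullet> l - 1 / 2 \<in> \<int>" by simp
    qed
    then obtain g where g: "H_hat \<Delta> {a, b} = {g}" "f_inv \<Delta> {a, b} g = 1" by blast
    have T: "T_genus \<Delta> = (\<Sum>k = 0..n. (- var_y) ^ k)"
      unfolding T_genus_h using h1 by (simp add: atLeast0AtMost)
    have TK: "T_genus (projected \<Delta> {a, b}) = (\<Sum>k = 0..n - 2. (- var_y) ^ k)"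
    proof -
      have "n - card {a, b} = n - 2" using ab(1) by simp
      then have "T_genus (projected \<Delta> {a, b}) = (\<Sum>k\<le>n - 2. of_nat (h {a, b} k) * (- var_y) ^ k)"
        using T_genus_projected_h[OF ab(2)] by (simp only:)
      also have "\<dots> = (\<Sum>k\<le>n - 2. (- var_y) ^ k)" by (rule sum.cong) (use hab in auto)
      finally show ?thesis by (simp only: atLeast0AtMost)
    qed
    have orb: "orbifold_T_genus \<Delta> = T_genus \<Delta> + (- var_y) * T_genus (projected \<Delta> {a, b})"
      by (rule orbifold_T_genus_eq[OF ab(2) _ g K_eq]) auto
    have "T_genus \<Delta> + (- var_y) * T_genus (projected \<Delta> {a, b}) = (1 - var_y) * (\<Sum>k = 0..n - 1. (- var_y) ^ k)"
      unfolding T TK using sum_powers_shift[OF n2, of "- var_y"] by simp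
    note all = T TK orb this
    have ex1: "\<exists>!K. K \<in> splx \<Delta> \<and> K \<noteq> {} \<and> H_hat \<Delta> K \<noteq> {}"
    proof (rule ex1I)
      show "{a, b} \<in> splx \<Delta> \<and> {a, b} \<noteq> {} \<and> H_hat \<Delta> {a, b} \<noteq> {}" using ab(2) g(1) by simp
      show "K = {a, b}" if "K \<in> splx \<Delta> \<and> K \<noteq> {} \<and> H_hat \<Delta> K \<noteq> {}" for K using K_eq that by blast
    qed
    have ?B
    proof (intro conjI allI impI n2 ex1)
      fix K assume "K \<in> splx \<Delta> \<and> K \<noteq> {} \<and> H_hat \<Delta> K \<noteq> {}"
      then have K: "K = {a, b}" using K_eq by blast
      show "T_genus \<Delta> = (\<Sum>k = 0..n. (- var_y) ^ k)"
        "T_genus (projected \<Delta> K) = (\<Sum>k = 0..n - 2. (- var_y) ^ k)"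
        "orbifold_T_genus \<Delta> = T_genus \<Delta> + (- var_y) * T_genus (projected \<Delta> K)"
        "T_genus \<Delta> + (- var_y) * T_genus (projected \<Delta> K) = (1 - var_y) * (\<Sum>k = 0..n - 1. (- var_y) ^ k)"
        unfolding K by (rule all)+
    qed
    then show ?thesis ..
  qed
qed

end
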